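(* Let $\alpha,\beta,\gamma\in\{1,\dots,n\}$ with $\alpha\neq\beta$. The differential Galois group $\mathrm{Gal}(\mathrm{EX}_{2,(\alpha,\beta)}^{\gamma})$ over $K=\mathbb{C}(\mathrm{e}^{\mathrm{i}t})$ of the system $$\ddot x=-\omega_\alpha^2x,\qquad \ddot y=-\omega_\beta^2y,\qquad \ddot z=-\omega_\gamma^2z+2\,\frac{\theta^\gamma_{\alpha,\beta}}{\sin t}\,xy$$ is virtually Abelian if and only if either $\theta^{\gamma}_{\alpha,\beta}=0$, or $\theta^{\gamma}_{\alpha,\beta}\neq0$ and $\omega_\alpha,\omega_\beta,\omega_\gamma\in\mathbb{Q}^{\star}$.
   Context: Setting: $V$ is a homogeneous potential of degree $2$ in $n$ complex variables, holomorphic near a Darboux point $d\ne0$ normalised by $V'(d)=d$, with $V''(d)=\operatorname{diag}(\omega_1^2,\dots,\omega_n^2)$, $\omega_i\in\mathbb{C}$; $F=-V'=-\operatorname{grad}V$ and $\theta^{\gamma}_{\alpha,\beta}=\frac{\partial^2F_\gamma}{\partial q_\alpha\partial q_\beta}(d)\in\mathbb{C}$. The system in the claim, called $\mathrm{EX}_{2,(\alpha,\beta)}^\gamma$, is extracted from the second order variational equations of $\ddot q=F(q)$ along the solution $q_0(t)=\sin(t)\,d$. Its Picard-Vessiot extension is the differential field extension of $K=\mathbb{C}(\mathrm{e}^{\mathrm{i}t})$, with derivation $d/dt$ and constants $\mathbb{C}$, generated by the components (and their derivatives) of all solutions $(x,y,z)$; $\mathrm{Gal}(\mathrm{EX}_{2,(\alpha,\beta)}^\gamma)$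 is its group of differential $K$-automorphisms. A linear algebraic group is virtually Abelian if its identity component is Abelian. $\mathbb{Q}^\star=\mathbb{Q}\setminus\{0\}$. *)

theory Defs
  imports "HOL-Complex_Analysis.Complex_Analysis" "HOL-Algebra.Bij"
begin

section \<open>Homogeneous holomorphic potentials in several complex variables\<close>

definition holomorphic_vec_on :: "(complex ^ 'n \<Rightarrow> complex) \<Rightarrow> (complex ^ 'n) set \<Rightarrow> bool" where
  "holomorphic_vec_on f U \<longleftrightarrow>
     (\<forall>q\<in>U. \<exists>f'. (f has_derivative f') (at q) \<and> (\<forall>c h. f' (c *s h) = c * f' h))"

text \<open>
  For a function that is only given on an open set, homogeneity is required whenever both
  \<open>q\<close> and \<open>\<lambda>q\<close> lie in that set. Potentials defined near a point only (for instance branches of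
  algebraic functions) are covered.
\<close>
definition homogeneous_on :: "nat \<Rightarrow> (complex ^ 'n \<Rightarrow> complex) \<Rightarrow> (complex ^ 'n) set \<Rightarrow> bool" where
  "homogeneous_on k f U \<longleftrightarrow> (\<forall>q\<in>U. \<forall>c. c *s q \<in> U \<longrightarrow> f (c *s q) = c ^ k * f q)"

definition partial_deriv :: "'n \<Rightarrow> (complex ^ 'n \<Rightarrow> complex) \<Rightarrow> complex ^ 'n \<Rightarrow> complex" where
  "partial_deriv i f q = deriv (\<lambda>z. f (q + axis i z)) 0"

definition grad :: "(complex ^ 'n \<Rightarrow> complex) \<Rightarrow> complex ^ 'n \<Rightarrow> complex ^ 'n" where
  "grad V q = (\<chi> i. partial_deriv i V q)"

definition hessian :: "(complex ^ 'n \<Rightarrow> complex) \<Rightarrow> complex ^ 'n \<Rightarrow> complex ^ 'n ^ 'n" where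
  "hessian V q = (\<chi> i j. partial_deriv i (partial_deriv j V) q)"

definition force :: "(complex ^ 'n \<Rightarrow> complex) \<Rightarrow> complex ^ 'n \<Rightarrow> complex ^ 'n" where
  "force V q = - grad V q"

definition theta :: "(complex ^ 'n \<Rightarrow> complex) \<Rightarrow> complex ^ 'n \<Rightarrow> 'n \<Rightarrow> 'n \<Rightarrow> 'n \<Rightarrow> complex" where
  "theta V d \<gamma> \<alpha> \<beta> = partial_deriv \<alpha> (partial_deriv \<beta> (\<lambda>q. force V q $ \<gamma>)) d"

section \<open>Differential fields of Laurent series\<close>

text \<open>
  All differential fields below are subfields of the field of Laurent series in \<open>t - t0\<close>, with
  derivation \<^const>\<open>fls_deriv\<close>, i.e. \<open>d/dt\<close>. Its field of constants is \<open>\<complex>\<close>, embedded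
  by \<^const>\<open>fls_const\<close>. At a point where a linear system is regular this field contains a full set
  of solutions, so that the field generated by all solutions is a Picard-Vessiot extension.
\<close>

inductive_set field_generated :: "'a :: field set \<Rightarrow> 'a set" for S where
  incl: "x \<in> S \<Longrightarrow> x \<in> field_generated S"
| one: "1 \<in> field_generated S"
| add: "x \<in> field_generated S \<Longrightarrow> y \<in> field_generated S \<Longrightarrow> x + y \<in> field_generated S"
| uminus: "x \<in> field_generated S \<Longrightarrow> - x \<in> field_generated S"
| mult: "x \<in> field_generated S \<Longrightarrow> y \<in> field_generated S \<Longrightarrow> x * y \<in> field_generated S"
| inverse: "x \<in> field_generated S \<Longrightarrow> inverse x \<in> field_generated S"

definition base_field :: "complex \<Rightarrow> complex fls set" where
  "base_field t0 =
     field_generated (range fls_const \<union> {laurent_expansion (\<lambda>t. exp (\<i> * t)) t0})"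

definition ex2_solutions ::
    "complex \<Rightarrow> complex \<Rightarrow> complex \<Rightarrow> complex \<Rightarrow> complex
      \<Rightarrow> (complex fls \<times> complex fls \<times> complex fls) set" where
  "ex2_solutions t0 a b c \<theta> =
     {(x, y, z).
        fls_deriv (fls_deriv x) = - fls_const (a\<^sup>2) * x \<and>
        fls_deriv (fls_deriv y) = - fls_const (b\<^sup>2) * y \<and>
        fls_deriv (fls_deriv z) =
          - fls_const (c\<^sup>2) * z + 2 * (fls_const \<theta> / laurent_expansion sin t0) * x * y}"

definition components :: "('a \<times> 'a \<times> 'a) set \<Rightarrow> 'a set" where
  "components S = (\<Union>(x, y, z)\<in>S. {x, y, z})"

definition solution_field ::
    "complex fls set \<Rightarrow> (complex fls \<times> complex fls \<times> complex fls) set \<Rightarrow> complex fls set" where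
  "solution_field K S =
     field_generated (K \<union> {(fls_deriv ^^ k) f | k f. f \<in> components S})"

section \<open>Differential Galois groups and their Zariski topology\<close>

definition diff_auts ::
    "complex fls set \<Rightarrow> complex fls set \<Rightarrow> (complex fls \<Rightarrow> complex fls) set" where
  "diff_auts K L = {\<sigma> \<in> Bij L.
     (\<forall>x\<in>L. \<forall>y\<in>L. \<sigma> (x + y) = \<sigma> x + \<sigma> y \<and> \<sigma> (x * y) = \<sigma> x * \<sigma> y) \<and>
     (\<forall>x\<in>K. \<sigma> x = x) \<and>
     (\<forall>x\<in>L. \<sigma> (fls_deriv x) = fls_deriv (\<sigma> x))}"

definition diff_galois_group ::
    "complex fls set \<Rightarrow> complex fls set \<Rightarrow> (complex fls \<Rightarrow> complex fls) monoid" where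
  "diff_galois_group K L = BijGroup L\<lparr>carrier := diff_auts K L\<rparr>"

definition linear_functional_on :: "complex fls set \<Rightarrow> (complex fls \<Rightarrow> complex) \<Rightarrow> bool" where
  "linear_functional_on L \<phi> \<longleftrightarrow>
     (\<forall>x\<in>L. \<forall>y\<in>L. \<phi> (x + y) = \<phi> x + \<phi> y) \<and> (\<forall>c. \<forall>x\<in>L. \<phi> (fls_const c * x) = c * \<phi> x)"

text \<open>
  The Galois group permutes the solutions, hence acts on the finite-dimensional \<open>\<complex>\<close>-linear span
  \<open>W\<close> of the set \<open>B\<close> of their components; this action is faithful because \<open>B\<close> generates \<open>L\<close>
  as a differential field over \<open>K\<close>, and it identifies the Galois group with a linear algebraic
  group in \<open>GL(W)\<close>. The functions \<open>\<sigma> \<mapsto> \<phi> (\<sigma> v)\<close> span the matrix coefficients of this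
  representation, so \<open>regular_functions L B\<close> consists of the polynomials in the matrix entries.
  The inverse of the determinant may be left out, since it does not change the zero sets in the group.
\<close>
inductive_set regular_functions ::
    "complex fls set \<Rightarrow> complex fls set \<Rightarrow> ((complex fls \<Rightarrow> complex fls) \<Rightarrow> complex) set"
  for L B where
  const: "(\<lambda>_. c) \<in> regular_functions L B"
| coefficient: "linear_functional_on L \<phi> \<Longrightarrow> v \<in> B \<Longrightarrow> (\<lambda>\<sigma>. \<phi> (\<sigma> v)) \<in> regular_functions L B"
| add: "f \<in> regular_functions L B \<Longrightarrow> g \<in> regular_functions L B
          \<Longrightarrow> (\<lambda>\<sigma>. f \<sigma> + g \<sigma>) \<in> regular_functions L B"
| mult: "f \<in> regular_functions L B \<Longrightarrow> g \<in> regular_functions L B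
          \<Longrightarrow> (\<lambda>\<sigma>. f \<sigma> * g \<sigma>) \<in> regular_functions L B"

text \<open>
  The principal open sets are closed under finite intersection, so the open sets of the topology they
  generate are their unions, i.e. the complements of zero sets of regular functions.
\<close>
definition zariski_topology ::
    "complex fls set \<Rightarrow> complex fls set \<Rightarrow> complex fls set \<Rightarrow> (complex fls \<Rightarrow> complex fls) topology" where
  "zariski_topology K L B =
     topology_generated_by {{\<sigma> \<in> diff_auts K L. f \<sigma> \<noteq> 0} | f. f \<in> regular_functions L B}"

definition virtually_abelian :: "'g monoid \<Rightarrow> 'g topology \<Rightarrow> bool" where
  "virtually_abelian G T \<longleftrightarrow>
     comm_group (G\<lparr>carrier := connected_component_of_set T \<one>\<^bsub>G\<^esub>\<rparr>)"

definition ex2_virtually_abelian ::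
    "complex \<Rightarrow> complex \<Rightarrow> complex \<Rightarrow> complex \<Rightarrow> complex \<Rightarrow> bool" where
  "ex2_virtually_abelian t0 a b c \<theta> =
     (let K = base_field t0; S = ex2_solutions t0 a b c \<theta>; L = solution_field K S
      in virtually_abelian (diff_galois_group K L) (zariski_topology K L (components S)))"

end

theory Submission
  imports Defs
begin

text \<open>
  Write \<open>a, b, c\<close> for the three frequencies. The term \<open>x y / sin t\<close> has simple poles at the integer multiples of
  \<open>\<pi>\<close>, so the component \<open>z\<close> of a solution is multivalued around these points, whereas \<open>x\<close>, \<open>y\<close> and the elements of
  the base field extend to single-valued meromorphic functions on the whole plane.

  Suppose \<open>\<theta> \<noteq> 0\<close>. Two kinds of analytic continuation act as elements of the Galois group. Continuation along a
  small loop around a pole \<open>p\<close> fixes \<open>x\<close> and \<open>y\<close> and adds to \<open>z\<close> the jump \<open>e * x(p) * y(p) * sn c (t - p)\<close>, where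
  the constant \<open>e \<noteq> 0\<close> comes from the residue of \<open>1 / sin\<close> (\<open>monodromy_automorphism\<close>). Continuation from
  \<open>t0\<close> to \<open>t0 + 2 \<pi>\<close> is an automorphism because the coefficients have period \<open>2 \<pi>\<close>
  (\<open>shift_automorphism\<close>). If the loop commutes with the shift by \<open>T = 2 \<pi> N\<close>, then comparing the jumps gives
  \<open>x(p + T) y(p + T) sn c (t - p) = x(p) y(p) sn c (t + T - p)\<close> for all \<open>x\<close>, \<open>y\<close>, \<open>t\<close>, and this is possible only
  for rational non-zero \<open>a, b, c\<close> (\<open>rational_of_functional_equation\<close>).

  It remains to see that the loop and some power of the shift lie in the identity component. Both act
  by triangular maps on the solutions, so a regular function evaluated at the \<open>k\<close>-th power of such an
  automorphism \<open>g\<close> is an exponential polynomial in \<open>k\<close>. When the eigenvalues generate a torsion-free group, which is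
  automatic for the loop and holds for a suitable power of the shift, these functions of \<open>k\<close> have no zero divisors
  (\<open>exp_polys_irreducible\<close>). So the powers of \<open>g\<close> form an irreducible, hence connected, set that contains
  the identity (\<open>exp_poly_orbit_in_G0\<close>).

  Conversely, if \<open>\<theta> = 0\<close>, the whole group acts on the three decoupled equations by scalars on \<open>exp (\<plusminus>\<i> w t)\<close>, or
  by a translation of \<open>t\<close> if \<open>w = 0\<close>, and is commutative. If \<open>a, b, c\<close> are rational and non-zero, then the
  functions \<open>exp (\<plusminus>\<i> a t)\<close>, \<open>exp (\<plusminus>\<i> b t)\<close>, \<open>exp (\<plusminus>\<i> c t)\<close> are algebraic over the base field. The identity component
  fixes them and only adds homogeneous solutions to \<open>z\<close>, so it is commutative too.
\<close>

section \<open>Exponential polynomials with torsion-free frequencies\<close>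

abbreviation epi :: "complex \<Rightarrow> complex \<Rightarrow> complex" where
  "epi l s \<equiv> exp (2 * of_real pi * \<i> * l * s)"

text \<open>
  The operator that sends \<open>u k\<close> to \<open>u (k + 1) - \<mu> a * u k\<close> lowers the degree of the coefficient polynomial
  at \<open>a\<close>, and at every other frequency it multiplies the leading coefficient by \<open>\<mu> b - \<mu> a \<noteq> 0\<close>. Repeating
  it removes the frequency \<open>a\<close> and loses no information about the others.
\<close>
lemma exponential_sum_vanish:
  fixes \<mu> :: "'a \<Rightarrow> complex" and P :: "'a \<Rightarrow> complex poly"
  assumes "finite A" "inj_on \<mu> A" "\<And>a. a \<in> A \<Longrightarrow> \<mu> a \<noteq> 0"
    and "\<And>k::nat. (\<Sum>a\<in>A. poly (P a) (of_nat k) * \<mu> a ^ k) = 0"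
  shows "\<forall>a\<in>A. P a = 0"
  using assms
proof (induction A arbitrary: P rule: finite_induct)
  case empty
  then show ?case by simp
next
  case (insert a A)
  have inner: "\<forall>b\<in>insert a A. P b = 0"
    if "P a = 0 \<or> degree (P a) < n"
      and "\<And>k::nat. (\<Sum>b\<in>insert a A. poly (P b) (of_nat k) * \<mu> b ^ k) = 0" for n P
    using that
  proof (induction n arbitrary: P)
    case 0
    then have "P a = 0" by simp
    moreover have "\<forall>b\<in>A. P b = 0"
      using insert.hyps insert.prems(1,2) 0(2) \<open>P a = 0\<close>
      by (intro insert.IH) (auto simp: inj_on_def)
    ultimately show ?case by simp
  next
    case (Suc n)
    define sh where "sh = (\<lambda>p::complex poly. p \<circ>\<^sub>p [:1, 1:])"
    define Q where "Q = (\<lambda>b. smult (\<mu> b) (sh (P b)) - smult (\<mu> a) (P b))"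
    have lead: "coeff (sh p) (degree p) = coeff p (degree p)" for p
      using lead_coeff_comp[of "[:1, 1::complex:]" p] by (simp add: sh_def degree_pcompose)
    have deg: "degree (sh p) = degree p" for p
      by (simp add: sh_def degree_pcompose)
    have sumQ: "(\<Sum>b\<in>insert a A. poly (Q b) (of_nat k) * \<mu> b ^ k) = 0" for k :: nat
    proof -
      have "(\<Sum>b\<in>insert a A. poly (Q b) (of_nat k) * \<mu> b ^ k)
          = (\<Sum>b\<in>insert a A. poly (P b) (of_nat (Suc k)) * \<mu> b ^ Suc k)
            - \<mu> a * (\<Sum>b\<in>insert a A. poly (P b) (of_nat k) * \<mu> b ^ k)"
        unfolding sum_distrib_left sum_subtractf[symmetric]
        by (intro sum.cong refl) (simp add: Q_def sh_def poly_pcompose algebra_simps)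
      then show ?thesis using Suc.prems(2)[of k] Suc.prems(2)[of "Suc k"] by simp
    qed
    have Qa: "Q a = 0 \<or> degree (Q a) < n"
    proof (cases "P a = 0")
      case True
      then show ?thesis by (simp add: Q_def sh_def)
    next
      case False
      have "degree (Q a) \<le> degree (P a)"
        unfolding Q_def by (intro degree_diff_le order.trans[OF degree_smult_le]) (auto simp: deg)
      moreover have "coeff (Q a) (degree (P a)) = 0"
        by (simp add: Q_def lead)
      ultimately have "Q a = 0 \<or> degree (Q a) < degree (P a)"
        by (metis leading_coeff_0_iff order_le_less)
      then show ?thesis using Suc.prems(1) False by auto
    qed
    have Q0: "\<forall>b\<in>insert a A. Q b = 0" by (rule Suc.IH[OF Qa sumQ])
    have A0: "P b = 0" if "b \<in> A" for b
    proof -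
      have "coeff (Q b) (degree (P b)) = 0" using Q0 that by simp
      then have "(\<mu> b - \<mu> a) * coeff (P b) (degree (P b)) = 0"
        by (simp add: Q_def lead algebra_simps)
      moreover have "\<mu> b \<noteq> \<mu> a"
        using insert.prems(1) insert.hyps that by (auto simp: inj_on_def)
      ultimately show ?thesis by simp
    qed
    have "poly (P a) (of_nat k) = 0" for k :: nat
      using Suc.prems(2)[of k] insert.hyps insert.prems(2)[of a] A0 by simp
    then have "range (of_nat :: nat \<Rightarrow> complex) \<subseteq> {x. poly (P a) x = 0}"
      by auto
    moreover have "infinite (range (of_nat :: nat \<Rightarrow> complex))"
      by (simp add: range_inj_infinite inj_of_nat)
    ultimately have "P a = 0"
      using poly_roots_finite finite_subset by blast
    with A0 show ?case by simp
  qed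
  show ?case by (rule inner[of P "Suc (degree (P a))"]) (use insert.prems(3) in auto)
qed

text \<open>
  The left-hand side preserves the degree of \<open>q\<close> if \<open>\<alpha> \<noteq> \<beta>\<close>. In the resonant case \<open>\<alpha> = \<beta>\<close> it lowers the
  degree of a non-constant \<open>q\<close> by exactly one. In both cases the leading term of \<open>p\<close> can be matched, and the rest follows by induction.
\<close>
lemma poly_difference_equation:
  fixes \<alpha> \<beta> :: complex and p :: "complex poly"
  assumes "\<alpha> \<noteq> 0"
  shows "\<exists>q. smult \<alpha> (q \<circ>\<^sub>p [:1, 1:]) - smult \<beta> q = p"
proof (induction "degree p" arbitrary: p rule: less_induct)
  case less
  define D where "D = (\<lambda>q::complex poly. smult \<alpha> (q \<circ>\<^sub>p [:1, 1:]) - smult \<beta> q)"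
  have D_add: "D (q + r) = D q + D r" for q r
    by (simp add: D_def pcompose_add smult_add_right)
  have coeffD: "coeff (D (monom e n)) i = e * (\<alpha> * of_nat (n choose i) - (if i = n then \<beta> else 0))" for e n i
  proof -
    have "([:0, 1:] ^ n) \<circ>\<^sub>p [:1, 1::complex:] = [:1, 1:] ^ n"
      by (induction n) (simp_all add: pcompose_1 pcompose_mult pcompose_pCons)
    then have "monom e n \<circ>\<^sub>p [:1, 1:] = smult e ([:1, 1:] ^ n)"
      by (simp add: monom_altdef pcompose_smult)
    moreover have "coeff ([:1, 1::complex:] ^ n) i = of_nat (n choose i)"
    proof (cases "i \<le> n")
      case True
      then show ?thesis by (simp add: coeff_linear_poly_power)
    next
      case False
      then have "degree ([:1, 1::complex:] ^ n) < i" by (simp add: degree_linear_power)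
      then show ?thesis using False by (simp add: coeff_eq_0)
    qed
    ultimately show ?thesis by (auto simp: D_def algebra_simps)
  qed
  show ?case
  proof (cases "p = 0")
    case True
    then show ?thesis by (intro exI[of _ 0]) simp
  next
    case False
    define d where "d = degree p"
    obtain e n where en: "coeff (D (monom e n)) d = coeff p d"
      and hi: "\<And>i. i > d \<Longrightarrow> coeff (D (monom e n)) i = 0"
    proof (cases "\<alpha> = \<beta>")
      case True
      have "coeff (D (monom (coeff p d / (\<alpha> * of_nat (Suc d))) (Suc d))) d = coeff p d"
        using assms by (simp add: coeffD del: of_nat_Suc)
      moreover have "coeff (D (monom (coeff p d / (\<alpha> * of_nat (Suc d))) (Suc d))) i = 0" if "i > d" for i
        using that True by (cases "i = Suc d") (simp_all add: coeffD del: of_nat_Suc binomial_Suc_Suc)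
      ultimately show ?thesis by (rule that)
    next
      case False
      have "coeff (D (monom (coeff p d / (\<alpha> - \<beta>)) d)) d = coeff p d"
        using False by (simp add: coeffD)
      moreover have "coeff (D (monom (coeff p d / (\<alpha> - \<beta>)) d)) i = 0" if "i > d" for i
        using that by (simp add: coeffD)
      ultimately show ?thesis by (rule that)
    qed
    define r where "r = p - D (monom e n)"
    have r0: "coeff r i = 0" if "i \<ge> d" for i
      using that en hi[of i] coeff_eq_0[of p i] unfolding r_def d_def
      by (cases "i = degree p") auto
    have "\<exists>q. D q = r"
    proof (cases "r = 0")
      case True
      then show ?thesis by (intro exI[of _ 0]) (simp add: D_def)
    next
      case False
      then have "degree r < d" using r0 by (metis leading_coeff_0_iff not_le)
      then show ?thesis using less[of r] unfolding d_def D_def by blast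
    qed
    then obtain q where "D q = r" by blast
    then have "D (q + monom e n) = p" by (simp add: D_add r_def)
    then show ?thesis unfolding D_def by blast
  qed
qed

inductive_set exp_polys :: "complex set \<Rightarrow> (complex \<Rightarrow> complex) set" for \<Lambda> where
  zero: "(\<lambda>_. 0) \<in> exp_polys \<Lambda>"
| step: "f \<in> exp_polys \<Lambda> \<Longrightarrow> l \<in> \<Lambda> \<Longrightarrow> (\<lambda>s. f s + poly p s * epi l s) \<in> exp_polys \<Lambda>"

lemma exp_polys_term: "l \<in> \<Lambda> \<Longrightarrow> (\<lambda>s. poly p s * epi l s) \<in> exp_polys \<Lambda>"
  using exp_polys.step[OF exp_polys.zero, of l \<Lambda> p] by simp

lemma exp_polys_add:
  assumes "f \<in> exp_polys \<Lambda>" "g \<in> exp_polys \<Lambda>"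
  shows "(\<lambda>s. f s + g s) \<in> exp_polys \<Lambda>"
  using assms(2)
proof induction
  case zero
  then show ?case using assms(1) by simp
next
  case (step g l p)
  show ?case using exp_polys.step[OF step.IH step.hyps(2), of p] by (simp add: add.assoc)
qed

lemma exp_polys_mult:
  assumes "f \<in> exp_polys \<Lambda>" "g \<in> exp_polys \<Lambda>" and add: "\<And>l m. l \<in> \<Lambda> \<Longrightarrow> m \<in> \<Lambda> \<Longrightarrow> l + m \<in> \<Lambda>"
  shows "(\<lambda>s. f s * g s) \<in> exp_polys \<Lambda>"
  using assms(2)
proof induction
  case zero
  then show ?case by (simp add: exp_polys.zero)
next
  case (step g m q)
  have "(\<lambda>s. f s * (poly q s * epi m s)) \<in> exp_polys \<Lambda>"
    using assms(1)
  proof induction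
    case zero
    then show ?case by (simp add: exp_polys.zero)
  next
    case (step f l p)
    have "(\<lambda>s. f s * (poly q s * epi m s) + poly (p * q) s * epi (l + m) s) \<in> exp_polys \<Lambda>"
      by (intro exp_polys.step step.IH add step.hyps \<open>m \<in> \<Lambda>\<close>)
    then show ?case by (simp add: algebra_simps exp_add)
  qed
  from exp_polys_add[OF step.IH this] show ?case by (simp add: algebra_simps)
qed

lemma exp_polys_const: "0 \<in> \<Lambda> \<Longrightarrow> (\<lambda>_. c) \<in> exp_polys \<Lambda>"
  using exp_polys_term[of 0 \<Lambda> "[:c:]"] by simp

lemma exp_polys_holomorphic: "f \<in> exp_polys \<Lambda> \<Longrightarrow> f holomorphic_on UNIV"
  by (induction rule: exp_polys.induct) (auto intro!: holomorphic_intros)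

lemma exp_polys_normal_form:
  assumes "f \<in> exp_polys \<Lambda>"
  shows "\<exists>A P. finite A \<and> A \<subseteq> \<Lambda> \<and> (\<forall>s. f s = (\<Sum>l\<in>A. poly (P l) s * epi l s))"
  using assms
proof induction
  case zero
  then show ?case by (intro exI[of _ "{}"]) simp
next
  case (step f l p)
  then obtain A P where A: "finite A" "A \<subseteq> \<Lambda>" "\<And>s. f s = (\<Sum>l\<in>A. poly (P l) s * epi l s)"
    by blast
  define P' where "P' = (\<lambda>m. (if m \<in> A then P m else 0) + (if m = l then p else 0))"
  have "f s + poly p s * epi l s = (\<Sum>m\<in>insert l A. poly (P' m) s * epi m s)" for s
  proof -
    have "(\<Sum>m\<in>insert l A. poly (P' m) s * epi m s)
        = (\<Sum>m\<in>insert l A. (if m \<in> A then poly (P m) s * epi m s else 0))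
          + (\<Sum>m\<in>insert l A. (if m = l then poly p s * epi m s else 0))"
      unfolding sum.distrib[symmetric] P'_def by (intro sum.cong refl) (auto simp: algebra_simps)
    moreover have "(\<Sum>m\<in>insert l A. (if m \<in> A then poly (P m) s * epi m s else 0)) = f s"
      unfolding A(3) using A(1) by (intro sum.mono_neutral_cong_right) auto
    moreover have "(\<Sum>m\<in>insert l A. (if m = l then poly p s * epi m s else 0)) = poly p s * epi l s"
      using A(1) by (simp add: sum.delta')
    ultimately show ?thesis by simp
  qed
  then show ?case using A step.hyps
    by (intro exI[of _ "insert l A"] exI[of _ P']) auto
qed

text \<open>
  Distinct exponents in such a set give distinct numbers \<open>exp (2 \<pi> \<i> l)\<close>, and these numbers form a
  multiplicatively closed set. This makes an exponential polynomial
  recoverable from its values at the natural numbers.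
\<close>
definition torsion_free_exponents :: "complex set \<Rightarrow> bool" where
  "torsion_free_exponents \<Lambda> \<longleftrightarrow> 0 \<in> \<Lambda> \<and> (\<forall>l\<in>\<Lambda>. \<forall>m\<in>\<Lambda>. l + m \<in> \<Lambda>) \<and> inj_on (\<lambda>l. epi l 1) \<Lambda>"

lemma exp_polys_eq_0:
  assumes "torsion_free_exponents \<Lambda>" "f \<in> exp_polys \<Lambda>" "\<And>k::nat. f (of_nat k) = 0"
  shows "f s = 0"
proof -
  obtain A P where A: "finite A" "A \<subseteq> \<Lambda>" "\<And>s. f s = (\<Sum>l\<in>A. poly (P l) s * epi l s)"
    using exp_polys_normal_form[OF assms(2)] by blast
  have pow: "epi l (of_nat k) = epi l 1 ^ k" for l and k :: nat
    by (simp add: exp_of_nat_mult[symmetric] mult_ac)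
  have "\<forall>l\<in>A. P l = 0"
  proof (rule exponential_sum_vanish[where \<mu> = "\<lambda>l. epi l 1"])
    show "inj_on (\<lambda>l. epi l 1) A"
      using assms(1) A(2) unfolding torsion_free_exponents_def by (metis inj_on_subset)
    show "(\<Sum>a\<in>A. poly (P a) (of_nat k) * epi a 1 ^ k) = 0" for k
      using assms(3)[of k] A(3)[of "of_nat k"] pow by simp
  qed (use A in auto)
  then show ?thesis by (simp add: A(3))
qed

text \<open>
  If the product vanished at all natural numbers, it would vanish identically as an entire
  function, and so would one of the factors.
\<close>
lemma exp_polys_irreducible:
  assumes \<Lambda>: "torsion_free_exponents \<Lambda>" and f: "f \<in> exp_polys \<Lambda>" and g: "g \<in> exp_polys \<Lambda>"
    and "f x \<noteq> 0" "g y \<noteq> 0"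
  shows "\<exists>k::nat. f (of_nat k) \<noteq> 0 \<and> g (of_nat k) \<noteq> 0"
proof (rule ccontr)
  assume "\<not> ?thesis"
  then have "f (of_nat k) * g (of_nat k) = 0" for k :: nat by auto
  then have fg: "f s * g s = 0" for s
    using \<Lambda> exp_polys_eq_0[OF \<Lambda> exp_polys_mult[OF f g]] unfolding torsion_free_exponents_def by blast
  have cont: "continuous_on UNIV f"
    using exp_polys_holomorphic[OF f] holomorphic_on_imp_continuous_on by blast
  define W where "W = {s. f s \<noteq> 0}"
  have "open W" unfolding W_def using cont by (intro open_Collect_neq) auto
  moreover have "x \<in> W" using assms(4) by (simp add: W_def)
  ultimately have "x islimpt W" using islimpt_subset[of x UNIV W] by (simp add: interior_limit_point interior_open)
  moreover have "g z = 0" if "z \<in> W" for z using fg[of z] that by (auto simp: W_def)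
  ultimately have "g y = 0"
    using analytic_continuation[of g UNIV W x y] exp_polys_holomorphic[OF g] by auto
  with assms(5) show False by simp
qed

text \<open>
  Orbits of a triangular linear map are obtained by solving such recurrences one after the other.
\<close>
lemma exp_polys_recurrence:
  assumes "torsion_free_exponents \<Lambda>" "G \<in> exp_polys \<Lambda>" "l0 \<in> \<Lambda>"
    and rec: "\<And>k::nat. u (Suc k) = epi l0 1 * u k + G (of_nat k)"
  shows "\<exists>F\<in>exp_polys \<Lambda>. \<forall>k. u k = F (of_nat k)"
proof -
  have "\<exists>F\<in>exp_polys \<Lambda>. \<forall>s. F (s + 1) - epi l0 1 * F s = G s"
    using assms(2)
  proof induction
    case zero
    then show ?case by (intro bexI[OF _ exp_polys.zero]) auto
  next
    case (step f l p)
    obtain F where F: "F \<in> exp_polys \<Lambda>" "\<And>s. F (s + 1) - epi l0 1 * F s = f s"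
      using step.IH by blast
    obtain q where q: "smult (epi l 1) (q \<circ>\<^sub>p [:1, 1:]) - smult (epi l0 1) q = p"
      using poly_difference_equation[of "epi l 1" "epi l0 1" p] by auto
    have qs: "epi l 1 * poly q (s + 1) - epi l0 1 * poly q s = poly p s" for s
      using arg_cong[OF q, of "\<lambda>p. poly p s"] by (simp add: poly_pcompose add.commute)
    have "F (s + 1) + poly q (s + 1) * epi l (s + 1) - epi l0 1 * (F s + poly q s * epi l s)
        = f s + poly p s * epi l s" for s
    proof -
      have "epi l (s + 1) = epi l 1 * epi l s" by (simp add: exp_add[symmetric] algebra_simps)
      then show ?thesis unfolding F(2)[symmetric] qs[symmetric] by (simp add: algebra_simps)
    qed
    moreover have "(\<lambda>s. F s + poly q s * epi l s) \<in> exp_polys \<Lambda>"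
      by (intro exp_polys.step F step.hyps)
    ultimately show ?case by (intro bexI[of _ "\<lambda>s. F s + poly q s * epi l s"]) auto
  qed
  then obtain F where F: "F \<in> exp_polys \<Lambda>" "\<And>s. F (s + 1) - epi l0 1 * F s = G s" by blast
  have u: "u k = F (of_nat k) + poly [:u 0 - F 0:] (of_nat k) * epi l0 (of_nat k)" for k
  proof (induction k)
    case 0
    then show ?case by simp
  next
    case (Suc k)
    have "F (of_nat k + 1) = epi l0 1 * F (of_nat k) + G (of_nat k)"
      using F(2)[of "of_nat k"] by (simp add: algebra_simps)
    moreover have "epi l0 (of_nat k + 1) = epi l0 1 * epi l0 (of_nat k)"
      by (simp add: exp_add[symmetric] algebra_simps)
    ultimately show ?case using rec[of k] Suc by (simp add: algebra_simps)
  qed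
  have "(\<lambda>s. F s + poly [:u 0 - F 0:] s * epi l0 s) \<in> exp_polys \<Lambda>"
    by (intro exp_polys.step F assms)
  then show ?thesis
    by (rule bexI[rotated]) (intro allI u)
qed

text \<open>
  The coordinate at \<open>1\<close> with respect to a basis of \<open>\<complex>\<close> over \<open>\<rat>\<close> that contains \<open>1\<close>.
\<close>
lemma rational_projection:
  "\<exists>h :: complex \<Rightarrow> rat. (\<forall>x y. h (x + y) = h x + h y) \<and> (\<forall>q. h (of_rat q) = q)"
proof -
  interpret V: vector_space "\<lambda>(q::rat) (z::complex). of_rat q * z"
    by unfold_locales (auto simp: algebra_simps of_rat_add of_rat_mult)
  have ind: "V.independent {1}" by (simp add: V.dependent_single)
  define B where "B = V.extend_basis {1}"
  have B: "V.independent B" "V.span B = UNIV" "1 \<in> B"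
    using V.independent_extend_basis[OF ind] V.span_extend_basis[OF ind] V.extend_basis_superset[OF ind]
    unfolding B_def by auto
  define h where "h = (\<lambda>x. V.representation B x 1)"
  have "h (x + y) = h x + h y" for x y
    unfolding h_def using B by (simp add: V.representation_add)
  moreover have "h (of_rat q) = q" for q
  proof -
    have "h (of_rat q * 1) = q * h 1"
      unfolding h_def using B by (subst V.representation_scale) auto
    moreover have "h 1 = 1" unfolding h_def using B by (simp add: V.representation_basis)
    ultimately show ?thesis by simp
  qed
  ultimately show ?thesis by blast
qed

lemma epi_eq_1_iff: "epi l 1 = 1 \<longleftrightarrow> l \<in> \<int>"
proof
  assume "epi l 1 = 1"
  then obtain n :: int where "Re (2 * of_real pi * \<i> * l) = 0" "Im (2 * of_real pi * \<i> * l) = of_int (2 * n) * pi"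
    using exp_eq_1 by (metis mult.right_neutral)
  then have "l = of_int n" by (auto simp: complex_eq_iff)
  then show "l \<in> \<int>" by simp
next
  assume "l \<in> \<int>"
  then obtain n where "l = of_int n" by (auto elim: Ints_cases)
  then show "epi l 1 = 1" by (auto simp: exp_eq_1)
qed

text \<open>
  Split each exponent into its rational part and a part in a fixed complement of \<open>\<rat>\<close> in \<open>\<complex>\<close>. A common
  denominator \<open>N\<close> of the rational parts makes them invisible to \<open>exp (2 \<pi> \<i> l)\<close>, and the complement
  contains no non-zero integer. In terms of groups, the \<open>N\<close>-th power kills the torsion of the group
  generated by the numbers \<open>exp (2 \<pi> \<i> a)\<close>.
\<close>
lemma torsion_free_exponents_exist:
  assumes "finite A"
  shows "\<exists>(N::nat) \<Lambda>. N > 0 \<and> torsion_free_exponents \<Lambda> \<and> (\<forall>a\<in>A. \<exists>l\<in>\<Lambda>. epi (of_nat N * a) 1 = epi l 1)"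
proof -
  obtain h :: "complex \<Rightarrow> rat" where h: "\<And>x y. h (x + y) = h x + h y" "\<And>q. h (of_rat q) = q"
    using rational_projection by blast
  have h0: "h 0 = 0" using h(2)[of 0] by simp
  have hn: "h (- x) = - h x" for x using h(1)[of x "- x"] h0 by simp
  have hN: "h (of_nat N * x) = of_nat N * h x" for N x
    by (induction N) (simp_all add: h0 h(1) algebra_simps)
  define \<psi> where "\<psi> = (\<lambda>x. x - of_rat (h x))"
  have h\<psi>: "h (\<psi> x) = 0" for x
    using h(1)[of x "- of_rat (h x)"] by (simp add: \<psi>_def hn h(2))
  have "torsion_free_exponents (range \<psi>)"
    unfolding torsion_free_exponents_def
  proof (intro conjI ballI inj_onI)
    show "0 \<in> range \<psi>" using h0 by (intro image_eqI[of _ _ 0]) (auto simp: \<psi>_def)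
  next
    fix l m assume "l \<in> range \<psi>" "m \<in> range \<psi>"
    then obtain x y where "l = \<psi> x" "m = \<psi> y" by auto
    then have "l + m = \<psi> (x + y)" by (simp add: \<psi>_def h(1) of_rat_add)
    then show "l + m \<in> range \<psi>" by simp
  next
    fix l m assume lm: "l \<in> range \<psi>" "m \<in> range \<psi>" "epi l 1 = epi m 1"
    have "epi (l - m) 1 = 1"
      using lm(3) by (simp add: right_diff_distrib left_diff_distrib exp_diff)
    then obtain n :: int where n: "l - m = of_int n" using epi_eq_1_iff by (auto elim: Ints_cases)
    have "h (l - m) = 0"
      using lm h\<psi> h(1)[of l "- m"] by (auto simp: hn)
    then have "n = 0" using n h(2)[of "of_int n"] by simp
    then show "l = m" using n by simp
  qed
  moreover have "\<exists>N::nat. N > 0 \<and> (\<forall>a\<in>A. of_nat N * h a \<in> \<int>)"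
    using assms
  proof induction
    case empty
    then show ?case by (intro exI[of _ 1]) auto
  next
    case (insert a A)
    then obtain N :: nat where N: "N > 0" "\<forall>a\<in>A. of_nat N * h a \<in> \<int>" by blast
    obtain p q where pq: "h a = of_int p / of_int q" "q > 0"
      by (cases "h a") (auto simp: Fract_of_int_quotient)
    define M where "M = N * nat q"
    have "of_nat M * h a \<in> \<int>"
      using pq by (simp add: M_def)
    moreover have "of_nat M * h b \<in> \<int>" if "b \<in> A" for b
    proof -
      have "of_nat M * h b = of_nat (nat q) * (of_nat N * h b)" by (simp add: M_def mult_ac)
      then show ?thesis using N(2) that by (metis Ints_mult Ints_of_nat)
    qed
    ultimately show ?case using N(1) pq(2) by (intro exI[of _ M]) (auto simp: M_def)
  qed
  then obtain N :: nat where N: "N > 0" "\<And>a. a \<in> A \<Longrightarrow> of_nat N * h a \<in> \<int>" by blast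
  have "epi (of_nat N * a) 1 = epi (\<psi> (of_nat N * a)) 1" if "a \<in> A" for a
  proof -
    obtain n where n: "of_nat N * h a = of_int n" using N(2)[OF \<open>a \<in> A\<close>] by (auto elim: Ints_cases)
    have "of_nat N * a = \<psi> (of_nat N * a) + of_int n"
      by (simp add: \<psi>_def hN n)
    then have "epi (of_nat N * a) 1 = epi (\<psi> (of_nat N * a)) 1 * epi (of_int n) 1"
      by (metis exp_add distrib_left distrib_right)
    also have "epi (of_int n) 1 = 1" using epi_eq_1_iff[of "of_int n"] by simp
    finally show ?thesis by simp
  qed
  ultimately show ?thesis using N(1) by blast
qed

section \<open>Differential automorphisms and their Zariski topology\<close>

lemma field_generated_zero: "0 \<in> field_generated S"
  using field_generated.add[OF field_generated.one field_generated.uminus[OF field_generated.one], of S]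
  by simp

lemma fls_deriv_inverse_field:
  fixes x :: "complex fls"
  shows "fls_deriv (inverse x) = - (fls_deriv x * (inverse x * inverse x))"
proof (cases "x = 0")
  case False
  have "fls_deriv (x * inverse x) = 0" using False by simp
  then have "x * fls_deriv (inverse x) = - (fls_deriv x * inverse x)"
    by (simp add: eq_neg_iff_add_eq_0)
  then have "inverse x * (x * fls_deriv (inverse x)) = - (fls_deriv x * (inverse x * inverse x))"
    by (simp add: mult_ac)
  then show ?thesis using False by (simp add: mult.assoc[symmetric])
qed simp

lemma field_generated_deriv:
  fixes S :: "complex fls set"
  assumes "\<And>x. x \<in> S \<Longrightarrow> fls_deriv x \<in> field_generated S" "x \<in> field_generated S"
  shows "fls_deriv x \<in> field_generated S"
  using assms(2)
  by induction
    (auto simp: fls_deriv_inverse_field field_generated_zero intro!: assms(1) intro: field_generated.intros)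

locale diff_subfield =
  fixes K L :: "complex fls set"
  assumes K_L: "K \<subseteq> L"
    and const_K: "fls_const e \<in> K"
    and L_add: "x \<in> L \<Longrightarrow> y \<in> L \<Longrightarrow> x + y \<in> L"
    and L_mult: "x \<in> L \<Longrightarrow> y \<in> L \<Longrightarrow> x * y \<in> L"
    and L_uminus: "x \<in> L \<Longrightarrow> - x \<in> L"
    and L_inverse: "x \<in> L \<Longrightarrow> inverse x \<in> L"
    and L_deriv: "x \<in> L \<Longrightarrow> fls_deriv x \<in> L"
begin

abbreviation "G \<equiv> diff_auts K L"

lemma const_L: "fls_const e \<in> L"
  using K_L const_K by blast

lemma L_0: "0 \<in> L" and L_1: "1 \<in> L"
  using const_L[of 0] const_L[of 1] by simp_all

lemma L_diff: "x \<in> L \<Longrightarrow> y \<in> L \<Longrightarrow> x - y \<in> L"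
  using L_add[of x "- y"] L_uminus by simp

lemma G_I:
  assumes "bij_betw \<sigma> L L" "\<sigma> \<in> extensional L"
    and "\<And>x y. x \<in> L \<Longrightarrow> y \<in> L \<Longrightarrow> \<sigma> (x + y) = \<sigma> x + \<sigma> y"
    and "\<And>x y. x \<in> L \<Longrightarrow> y \<in> L \<Longrightarrow> \<sigma> (x * y) = \<sigma> x * \<sigma> y"
    and "\<And>x. x \<in> K \<Longrightarrow> \<sigma> x = x"
    and "\<And>x. x \<in> L \<Longrightarrow> \<sigma> (fls_deriv x) = fls_deriv (\<sigma> x)"
  shows "\<sigma> \<in> G"
  using assms by (simp add: diff_auts_def Bij_def)

lemma G_bij: "\<sigma> \<in> G \<Longrightarrow> bij_betw \<sigma> L L"
  and G_ext: "\<sigma> \<in> G \<Longrightarrow> \<sigma> \<in> extensional L"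
  and G_add: "\<sigma> \<in> G \<Longrightarrow> x \<in> L \<Longrightarrow> y \<in> L \<Longrightarrow> \<sigma> (x + y) = \<sigma> x + \<sigma> y"
  and G_mult: "\<sigma> \<in> G \<Longrightarrow> x \<in> L \<Longrightarrow> y \<in> L \<Longrightarrow> \<sigma> (x * y) = \<sigma> x * \<sigma> y"
  and G_fix: "\<sigma> \<in> G \<Longrightarrow> x \<in> K \<Longrightarrow> \<sigma> x = x"
  and G_deriv: "\<sigma> \<in> G \<Longrightarrow> x \<in> L \<Longrightarrow> \<sigma> (fls_deriv x) = fls_deriv (\<sigma> x)"
  by (auto simp: diff_auts_def Bij_def)

lemma G_Bij: "\<sigma> \<in> G \<Longrightarrow> \<sigma> \<in> Bij L"
  by (simp add: diff_auts_def)

lemma G_in: "\<sigma> \<in> G \<Longrightarrow> x \<in> L \<Longrightarrow> \<sigma> x \<in> L"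
  using G_bij by (meson bij_betwE)

lemma G_const: "\<sigma> \<in> G \<Longrightarrow> \<sigma> (fls_const e) = fls_const e"
  using G_fix const_K by blast

lemma G_0: "\<sigma> \<in> G \<Longrightarrow> \<sigma> 0 = 0" and G_1: "\<sigma> \<in> G \<Longrightarrow> \<sigma> 1 = 1"
  using G_const[of \<sigma> 0] G_const[of \<sigma> 1] by simp_all

lemma G_scale: "\<sigma> \<in> G \<Longrightarrow> x \<in> L \<Longrightarrow> \<sigma> (fls_const e * x) = fls_const e * \<sigma> x"
  using G_mult[of \<sigma> "fls_const e" x] G_const const_L by simp

lemma G_uminus: "\<sigma> \<in> G \<Longrightarrow> x \<in> L \<Longrightarrow> \<sigma> (- x) = - \<sigma> x"
  using G_add[of \<sigma> x "- x"] G_0[of \<sigma>] L_uminus[of x]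
  by (metis add.right_inverse add.inverse_unique)

lemma G_diff: "\<sigma> \<in> G \<Longrightarrow> x \<in> L \<Longrightarrow> y \<in> L \<Longrightarrow> \<sigma> (x - y) = \<sigma> x - \<sigma> y"
  using G_add[of \<sigma> x "- y"] G_uminus L_uminus by simp

lemma G_inverse: "\<sigma> \<in> G \<Longrightarrow> x \<in> L \<Longrightarrow> \<sigma> (inverse x) = inverse (\<sigma> x)"
proof (cases "x = 0")
  case False
  assume \<sigma>: "\<sigma> \<in> G" "x \<in> L"
  have "\<sigma> x * \<sigma> (inverse x) = 1"
    using G_mult[OF \<sigma> L_inverse[OF \<sigma>(2)]] G_1[OF \<sigma>(1)] False by simp
  then show ?thesis by (rule inverse_unique[symmetric])
qed (simp add: G_0)

lemma compose_in_G: "\<sigma> \<in> G \<Longrightarrow> \<tau> \<in> G \<Longrightarrow> compose L \<sigma> \<tau> \<in> G"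
  using compose_Bij[OF G_Bij G_Bij]
  by (intro G_I)
    (auto simp: compose_def Bij_def G_in G_add G_mult G_fix G_deriv L_add L_mult L_deriv subsetD[OF K_L])

lemma id_in_G: "(\<lambda>x\<in>L. x) \<in> G"
  by (rule G_I) (auto simp: L_add L_mult L_deriv subsetD[OF K_L] bij_betw_def inj_on_def)

lemma inverse_in_G:
  assumes "\<sigma> \<in> G"
  shows "restrict (inv_into L \<sigma>) L \<in> G"
proof (rule G_I)
  have bij: "bij_betw \<sigma> L L" using assms by (rule G_bij)
  then show "bij_betw (restrict (inv_into L \<sigma>) L) L L"
    using restrict_inv_into_Bij[OF G_Bij[OF assms]] by (simp add: Bij_def)
  have r: "inv_into L \<sigma> x \<in> L" "\<sigma> (inv_into L \<sigma> x) = x" if "x \<in> L" for x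
    using bij that by (auto simp: bij_betw_def inv_into_into f_inv_into_f)
  have u: "inv_into L \<sigma> x = y" if "y \<in> L" "\<sigma> y = x" for x y
    using bij that by (auto simp: bij_betw_def)
  show "restrict (inv_into L \<sigma>) L (x + y) = restrict (inv_into L \<sigma>) L x + restrict (inv_into L \<sigma>) L y"
    if "x \<in> L" "y \<in> L" for x y
    using that by (auto simp: L_add r G_add[OF assms] intro!: u)
  show "restrict (inv_into L \<sigma>) L (x * y) = restrict (inv_into L \<sigma>) L x * restrict (inv_into L \<sigma>) L y"
    if "x \<in> L" "y \<in> L" for x y
    using that by (auto simp: L_mult r G_mult[OF assms] intro!: u)
  show "restrict (inv_into L \<sigma>) L x = x" if "x \<in> K" for x
    using that K_L by (auto simp: G_fix[OF assms] intro!: u)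
  show "restrict (inv_into L \<sigma>) L (fls_deriv x) = fls_deriv (restrict (inv_into L \<sigma>) L x)" if "x \<in> L" for x
    using that by (auto simp: L_deriv r G_deriv[OF assms] intro!: u)
qed auto

definition power_aut :: "(complex fls \<Rightarrow> complex fls) \<Rightarrow> nat \<Rightarrow> complex fls \<Rightarrow> complex fls" where
  "power_aut \<sigma> k = restrict (\<sigma> ^^ k) L"

lemma power_in_L: "\<sigma> \<in> G \<Longrightarrow> x \<in> L \<Longrightarrow> (\<sigma> ^^ k) x \<in> L"
  by (induction k) (auto simp: G_in)

lemma power_aut_Suc: "\<sigma> \<in> G \<Longrightarrow> power_aut \<sigma> (Suc k) = compose L \<sigma> (power_aut \<sigma> k)"
  by (auto simp: power_aut_def compose_def fun_eq_iff)

lemma power_aut_in_G: "\<sigma> \<in> G \<Longrightarrow> power_aut \<sigma> k \<in> G"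
proof (induction k)
  case 0
  have "power_aut \<sigma> 0 = (\<lambda>x\<in>L. x)" by (auto simp: power_aut_def fun_eq_iff)
  then show ?case using id_in_G by (simp only:)
next
  case (Suc k)
  then show ?case by (simp add: power_aut_Suc compose_in_G)
qed

lemma G_eqI:
  assumes "\<sigma> \<in> G" "\<tau> \<in> G" "L = field_generated A" "\<And>x. x \<in> A \<Longrightarrow> \<sigma> x = \<tau> x"
  shows "\<sigma> = \<tau>"
proof (rule extensionalityI[OF G_ext[OF assms(1)] G_ext[OF assms(2)]])
  fix x assume "x \<in> L"
  then have "x \<in> field_generated A" using assms(3) by simp
  then have "x \<in> L \<and> \<sigma> x = \<tau> x"
  proof induction
    case (incl x)
    then show ?case using assms by (auto intro: field_generated.incl)
  qed (auto simp: L_1 L_add L_mult L_uminus L_inverse G_1 G_add G_mult G_uminus G_inverse assms(1,2))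
  then show "\<sigma> x = \<tau> x" by blast
qed

end

locale diff_galois = diff_subfield +
  fixes B :: "complex fls set"
  assumes B_L: "B \<subseteq> L" and G_B: "\<sigma> \<in> diff_auts K L \<Longrightarrow> v \<in> B \<Longrightarrow> \<sigma> v \<in> B"
begin

abbreviation "T \<equiv> zariski_topology K L B"
abbreviation "G0 \<equiv> connected_component_of_set T (\<lambda>x\<in>L. x)"

lemma openin_principal: "f \<in> regular_functions L B \<Longrightarrow> openin T {\<sigma> \<in> G. f \<sigma> \<noteq> 0}"
  unfolding zariski_topology_def by (rule topology_generated_by_Basis) blast

lemma topspace_T: "topspace T = G"
proof
  show "topspace T \<subseteq> G" by (auto simp: zariski_topology_def)
  show "G \<subseteq> topspace T"
    using openin_subset[OF openin_principal[OF regular_functions.const[of 1]]] by simp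
qed

lemma openin_contains_principal:
  assumes "openin T U" "\<sigma> \<in> U"
  shows "\<sigma> \<in> G \<and> (\<exists>f\<in>regular_functions L B. f \<sigma> \<noteq> 0 \<and> {\<tau> \<in> G. f \<tau> \<noteq> 0} \<subseteq> U)"
proof -
  have "generate_topology_on {{\<sigma> \<in> diff_auts K L. f \<sigma> \<noteq> 0} | f. f \<in> regular_functions L B} U"
    using assms(1) unfolding zariski_topology_def by (rule openin_topology_generated_by)
  then show ?thesis using assms(2)
  proof induction
    case (Int U W)
    then obtain f g where "f \<in> regular_functions L B" "f \<sigma> \<noteq> 0" "{\<tau> \<in> G. f \<tau> \<noteq> 0} \<subseteq> U"
      "g \<in> regular_functions L B" "g \<sigma> \<noteq> 0" "{\<tau> \<in> G. g \<tau> \<noteq> 0} \<subseteq> W" "\<sigma> \<in> G"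
      by blast
    then show ?case
      by (intro conjI bexI[OF _ regular_functions.mult[of f L B g]]) auto
  next
    case (UN F)
    then show ?case by blast
  qed auto
qed

lemma translate_regular:
  assumes "\<tau> \<in> G" "f \<in> regular_functions L B"
  shows "\<exists>g\<in>regular_functions L B. \<forall>\<sigma>\<in>G. f (compose L \<tau> \<sigma>) = g \<sigma>"
  using assms(2)
proof induction
  case (const e)
  then show ?case by (intro bexI[OF _ regular_functions.const[of e]]) simp
next
  case (coefficient \<phi> v)
  have "linear_functional_on L (\<lambda>x. \<phi> (\<tau> x))"
    using coefficient(1) assms(1) unfolding linear_functional_on_def
    by (auto simp: G_add G_scale G_in)
  then have "(\<lambda>\<sigma>. \<phi> (\<tau> (\<sigma> v))) \<in> regular_functions L B"
    using coefficient(2) by (rule regular_functions.coefficient)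
  then show ?case using coefficient(2) B_L by (force simp: compose_def)
next
  case (add f1 f2)
  then obtain g1 g2 where "g1 \<in> regular_functions L B" "g2 \<in> regular_functions L B"
    "\<forall>\<sigma>\<in>G. f1 (compose L \<tau> \<sigma>) = g1 \<sigma>" "\<forall>\<sigma>\<in>G. f2 (compose L \<tau> \<sigma>) = g2 \<sigma>" by blast
  then show ?case by (intro bexI[OF _ regular_functions.add[of g1 L B g2]]) auto
next
  case (mult f1 f2)
  then obtain g1 g2 where "g1 \<in> regular_functions L B" "g2 \<in> regular_functions L B"
    "\<forall>\<sigma>\<in>G. f1 (compose L \<tau> \<sigma>) = g1 \<sigma>" "\<forall>\<sigma>\<in>G. f2 (compose L \<tau> \<sigma>) = g2 \<sigma>" by blast
  then show ?case by (intro bexI[OF _ regular_functions.mult[of g1 L B g2]]) auto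
qed

lemma translation_continuous:
  assumes "\<tau> \<in> G"
  shows "continuous_map T T (compose L \<tau>)"
proof -
  have "openin T (compose L \<tau> -` {\<sigma> \<in> G. f \<sigma> \<noteq> 0} \<inter> topspace T)" if f: "f \<in> regular_functions L B" for f
  proof -
    obtain g where g: "g \<in> regular_functions L B" "\<forall>\<sigma>\<in>G. f (compose L \<tau> \<sigma>) = g \<sigma>"
      using translate_regular[OF assms f] by blast
    then have "compose L \<tau> -` {\<sigma> \<in> G. f \<sigma> \<noteq> 0} \<inter> topspace T = {\<sigma> \<in> G. g \<sigma> \<noteq> 0}"
      using assms by (auto simp: topspace_T compose_in_G)
    then show ?thesis using openin_principal[OF g(1)] by simp
  qed
  moreover have "compose L \<tau> ` topspace T \<subseteq> G"
    using assms by (auto simp: topspace_T compose_in_G)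
  ultimately show ?thesis
    using topspace_T unfolding zariski_topology_def
    by (intro continuous_on_generated_topo) auto
qed

lemma G0_G: "G0 \<subseteq> G"
  using connected_component_of_subset_topspace topspace_T by metis

lemma id_in_G0: "(\<lambda>x\<in>L. x) \<in> G0"
  using connected_component_of_refl[of T] topspace_T id_in_G by simp

lemma compose_id_right: "\<tau> \<in> G \<Longrightarrow> compose L \<tau> (\<lambda>x\<in>L. x) = \<tau>"
  using G_ext[of \<tau>] by (auto simp: compose_def fun_eq_iff extensional_def)

text \<open>
  The identity component is a subgroup as soon as left translations are continuous: inverses only
  enter through the translate of \<open>G0\<close> by the inverse of one of its elements, a connected set that
  contains the identity. So continuity of the inversion, which would bring in the determinant, is
  avoided.
\<close>
lemma translate_G0_subset:
  assumes "\<tau> \<in> G" "(\<lambda>x\<in>L. x) \<in> compose L \<tau> ` G0 \<or> \<tau> \<in> G0"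
  shows "compose L \<tau> ` G0 \<subseteq> G0"
proof -
  have con: "connectedin T (compose L \<tau> ` G0)"
    by (rule connectedin_continuous_map_image[OF translation_continuous[OF assms(1)]
          connectedin_connected_component_of])
  have \<tau>: "\<tau> \<in> compose L \<tau> ` G0"
    by (rule image_eqI[OF _ id_in_G0]) (simp only: compose_id_right[OF assms(1)])
  from assms(2) show ?thesis
  proof
    assume "(\<lambda>x\<in>L. x) \<in> compose L \<tau> ` G0"
    then show ?thesis by (rule connected_component_of_maximal[OF con])
  next
    assume "\<tau> \<in> G0"
    then have "connected_component_of_set T \<tau> = G0"
      using connected_component_of_equiv[of T "\<lambda>x\<in>L. x" \<tau>] by auto
    then show ?thesis using connected_component_of_maximal[OF con \<tau>] by simp
  qed
qed

lemma compose_in_G0: "\<sigma> \<in> G0 \<Longrightarrow> \<tau> \<in> G0 \<Longrightarrow> compose L \<sigma> \<tau> \<in> G0"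
  using translate_G0_subset[of \<sigma>] G0_G by blast

lemma inverse_in_G0:
  assumes "\<sigma> \<in> G0"
  shows "restrict (inv_into L \<sigma>) L \<in> G0"
proof -
  have \<sigma>: "\<sigma> \<in> G" using assms G0_G by blast
  have inv: "compose L (restrict (inv_into L \<sigma>) L) \<sigma> = (\<lambda>x\<in>L. x)"
    using Bij_compose_restrict_eq[OF G_Bij[OF \<sigma>]] .
  have "(\<lambda>x\<in>L. x) \<in> compose L (restrict (inv_into L \<sigma>) L) ` G0"
    by (rule image_eqI[OF _ assms]) (simp only: inv)
  then have "compose L (restrict (inv_into L \<sigma>) L) ` G0 \<subseteq> G0"
    by (intro translate_G0_subset inverse_in_G \<sigma> disjI1)
  then have "compose L (restrict (inv_into L \<sigma>) L) (\<lambda>x\<in>L. x) \<in> G0"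
    using id_in_G0 by blast
  then show ?thesis using compose_id_right[OF inverse_in_G[OF \<sigma>]] by (simp only:)
qed

lemma virtually_abelian_iff:
  "virtually_abelian (diff_galois_group K L) T \<longleftrightarrow>
     (\<forall>\<sigma>\<in>G0. \<forall>\<tau>\<in>G0. compose L \<sigma> \<tau> = compose L \<tau> \<sigma>)"
proof -
  let ?M = "diff_galois_group K L\<lparr>carrier := G0\<rparr>"
  have one: "\<one>\<^bsub>diff_galois_group K L\<^esub> = (\<lambda>x\<in>L. x)" "\<one>\<^bsub>?M\<^esub> = (\<lambda>x\<in>L. x)"
    by (simp_all add: diff_galois_group_def BijGroup_def)
  have mult: "\<sigma> \<otimes>\<^bsub>?M\<^esub> \<tau> = compose L \<sigma> \<tau>" if "\<sigma> \<in> G0" "\<tau> \<in> G0" for \<sigma> \<tau>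
    using that G0_G G_Bij by (auto simp: diff_galois_group_def BijGroup_def subset_iff)
  have ext: "\<sigma> \<in> extensional L" "\<sigma> \<in> L \<rightarrow> L" if "\<sigma> \<in> G0" for \<sigma>
    using that G0_G G_ext G_in by blast+
  have "comm_group ?M" if "\<forall>\<sigma>\<in>G0. \<forall>\<tau>\<in>G0. compose L \<sigma> \<tau> = compose L \<tau> \<sigma>"
  proof (rule comm_groupI)
    fix \<sigma> \<tau> \<rho> assume *: "\<sigma> \<in> carrier ?M" "\<tau> \<in> carrier ?M" "\<rho> \<in> carrier ?M"
    then have **: "\<sigma> \<in> G0" "\<tau> \<in> G0" "\<rho> \<in> G0" by simp_all
    show "\<sigma> \<otimes>\<^bsub>?M\<^esub> \<tau> \<otimes>\<^bsub>?M\<^esub> \<rho> = \<sigma> \<otimes>\<^bsub>?M\<^esub> (\<tau> \<otimes>\<^bsub>?M\<^esub> \<rho>)"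
      unfolding mult[OF **(1,2)] mult[OF **(2,3)] mult[OF **(1) compose_in_G0[OF **(2,3)]]
        mult[OF compose_in_G0[OF **(1,2)] **(3)]
      using compose_assoc[OF ext(2)[OF **(3)] , of \<sigma> \<tau>] by simp
  next
    fix \<sigma> assume "\<sigma> \<in> carrier ?M"
    then have \<sigma>: "\<sigma> \<in> G0" by simp
    then have \<sigma>G: "\<sigma> \<in> G" using G0_G by blast
    show "\<one>\<^bsub>?M\<^esub> \<otimes>\<^bsub>?M\<^esub> \<sigma> = \<sigma>"
      unfolding one mult[OF id_in_G0 \<sigma>] using Id_compose[OF ext(2,1)] \<sigma> by simp
    show "\<exists>\<tau>\<in>carrier ?M. \<tau> \<otimes>\<^bsub>?M\<^esub> \<sigma> = \<one>\<^bsub>?M\<^esub>"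
    proof (rule bexI)
      show "restrict (inv_into L \<sigma>) L \<otimes>\<^bsub>?M\<^esub> \<sigma> = \<one>\<^bsub>?M\<^esub>"
        unfolding one mult[OF inverse_in_G0[OF \<sigma>] \<sigma>]
        by (rule Bij_compose_restrict_eq[OF G_Bij[OF \<sigma>G]])
      show "restrict (inv_into L \<sigma>) L \<in> carrier ?M"
        using inverse_in_G0[OF \<sigma>] by simp
    qed
  next
    show "\<one>\<^bsub>?M\<^esub> \<in> carrier ?M"
      unfolding one using id_in_G0 by simp
  next
    fix \<sigma> \<tau> assume "\<sigma> \<in> carrier ?M" "\<tau> \<in> carrier ?M"
    then have *: "\<sigma> \<in> G0" "\<tau> \<in> G0" by simp_all
    then show "\<sigma> \<otimes>\<^bsub>?M\<^esub> \<tau> \<in> carrier ?M"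
      unfolding mult[OF *] using compose_in_G0[OF *] by simp
    show "\<sigma> \<otimes>\<^bsub>?M\<^esub> \<tau> = \<tau> \<otimes>\<^bsub>?M\<^esub> \<sigma>"
      unfolding mult[OF *] mult[OF *(2,1)] using that * by blast
  qed
  moreover have "\<forall>\<sigma>\<in>G0. \<forall>\<tau>\<in>G0. compose L \<sigma> \<tau> = compose L \<tau> \<sigma>" if "comm_group ?M"
  proof -
    interpret comm_group ?M by fact
    show ?thesis
    proof (intro ballI)
      fix \<sigma> \<tau> assume "\<sigma> \<in> G0" "\<tau> \<in> G0"
      then show "compose L \<sigma> \<tau> = compose L \<tau> \<sigma>"
        using m_comm[of \<sigma> \<tau>] mult by simp
    qed
  qed
  ultimately show ?thesis unfolding virtually_abelian_def one by blast
qed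

text \<open>
  Linear functionals give the matrix coefficients, so this says that every matrix coefficient of the
  \<open>k\<close>-th power in the column of \<open>v\<close> is an exponential polynomial in \<open>k\<close>.
\<close>
definition exp_poly_orbit ::
  "complex set \<Rightarrow> (complex fls \<Rightarrow> complex fls) \<Rightarrow> complex fls \<Rightarrow> bool" where
  "exp_poly_orbit \<Lambda> \<sigma> v \<longleftrightarrow>
     (\<forall>\<phi>. linear_functional_on L \<phi> \<longrightarrow> (\<exists>F\<in>exp_polys \<Lambda>. \<forall>k. \<phi> ((\<sigma> ^^ k) v) = F (of_nat k)))"

lemma exp_poly_orbit_add:
  assumes "\<sigma> \<in> G" "v \<in> L" "w \<in> L" "exp_poly_orbit \<Lambda> \<sigma> v" "exp_poly_orbit \<Lambda> \<sigma> w"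
  shows "exp_poly_orbit \<Lambda> \<sigma> (v + w)"
  unfolding exp_poly_orbit_def
proof (intro allI impI)
  fix \<phi> assume \<phi>: "linear_functional_on L \<phi>"
  obtain f where f: "f \<in> exp_polys \<Lambda>" "\<forall>k. \<phi> ((\<sigma> ^^ k) v) = f (of_nat k)"
    using assms(4) \<phi> unfolding exp_poly_orbit_def by blast
  obtain g where g: "g \<in> exp_polys \<Lambda>" "\<forall>k. \<phi> ((\<sigma> ^^ k) w) = g (of_nat k)"
    using assms(5) \<phi> unfolding exp_poly_orbit_def by blast
  have "(\<sigma> ^^ k) (v + w) = (\<sigma> ^^ k) v + (\<sigma> ^^ k) w" for k
    by (induction k) (simp_all add: G_add power_in_L assms)
  then have "\<phi> ((\<sigma> ^^ k) (v + w)) = f (of_nat k) + g (of_nat k)" for k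
    using f g \<phi> power_in_L[OF assms(1)] assms(2,3) unfolding linear_functional_on_def by simp
  then show "\<exists>F\<in>exp_polys \<Lambda>. \<forall>k. \<phi> ((\<sigma> ^^ k) (v + w)) = F (of_nat k)"
    using exp_polys_add[OF f(1) g(1)] by (intro bexI) auto
qed

lemma exp_poly_orbit_scale:
  assumes \<Lambda>: "torsion_free_exponents \<Lambda>" and "\<sigma> \<in> G" "v \<in> L" "exp_poly_orbit \<Lambda> \<sigma> v"
  shows "exp_poly_orbit \<Lambda> \<sigma> (fls_const e * v)"
  unfolding exp_poly_orbit_def
proof (intro allI impI)
  fix \<phi> assume \<phi>: "linear_functional_on L \<phi>"
  obtain f where f: "f \<in> exp_polys \<Lambda>" "\<forall>k. \<phi> ((\<sigma> ^^ k) v) = f (of_nat k)"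
    using assms(4) \<phi> unfolding exp_poly_orbit_def by blast
  have "(\<sigma> ^^ k) (fls_const e * v) = fls_const e * (\<sigma> ^^ k) v" for k
    by (induction k) (simp_all add: G_scale power_in_L assms)
  then have "\<phi> ((\<sigma> ^^ k) (fls_const e * v)) = e * f (of_nat k)" for k
    using f \<phi> power_in_L[OF assms(2,3)] unfolding linear_functional_on_def by simp
  moreover have "(\<lambda>s. e * f s) \<in> exp_polys \<Lambda>"
    using \<Lambda> exp_polys_mult[OF exp_polys_const f(1)] unfolding torsion_free_exponents_def by blast
  ultimately show "\<exists>F\<in>exp_polys \<Lambda>. \<forall>k. \<phi> ((\<sigma> ^^ k) (fls_const e * v)) = F (of_nat k)"
    by (intro bexI) auto
qed

lemma exp_poly_orbit_triangular:
  assumes \<Lambda>: "torsion_free_exponents \<Lambda>" and "\<sigma> \<in> G" "v \<in> L" "l \<in> \<Lambda>"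
    and rest: "exp_poly_orbit \<Lambda> \<sigma> (\<sigma> v - fls_const (epi l 1) * v)"
  shows "exp_poly_orbit \<Lambda> \<sigma> v"
  unfolding exp_poly_orbit_def
proof (intro allI impI)
  fix \<phi> assume \<phi>: "linear_functional_on L \<phi>"
  define w where "w = \<sigma> v - fls_const (epi l 1) * v"
  have wL: "w \<in> L" 
    unfolding w_def by (rule L_diff[OF G_in[OF assms(2,3)] L_mult[OF const_L assms(3)]])
  obtain f where f: "f \<in> exp_polys \<Lambda>" "\<And>k. \<phi> ((\<sigma> ^^ k) w) = f (of_nat k)"
    using rest \<phi> unfolding exp_poly_orbit_def w_def by blast
  have "(\<sigma> ^^ Suc k) v = fls_const (epi l 1) * (\<sigma> ^^ k) v + (\<sigma> ^^ k) w" for k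
  proof (induction k)
    case 0
    then show ?case by (simp add: w_def)
  next
    case (Suc k)
    have "(\<sigma> ^^ Suc (Suc k)) v = \<sigma> (fls_const (epi l 1) * (\<sigma> ^^ k) v + (\<sigma> ^^ k) w)"
      using Suc by simp
    also have "\<dots> = fls_const (epi l 1) * (\<sigma> ^^ Suc k) v + (\<sigma> ^^ Suc k) w"
      using power_in_L[OF assms(2)] assms(2,3) wL by (simp add: G_add G_scale L_mult const_L)
    finally show ?case .
  qed
  then have "\<phi> ((\<sigma> ^^ Suc k) v) = epi l 1 * \<phi> ((\<sigma> ^^ k) v) + f (of_nat k)" for k
    using f(2) \<phi> power_in_L[OF assms(2)] assms(3) wL L_mult const_L
    unfolding linear_functional_on_def by simp
  then show "\<exists>F\<in>exp_polys \<Lambda>. \<forall>k. \<phi> ((\<sigma> ^^ k) v) = F (of_nat k)"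
    by (rule exp_polys_recurrence[OF \<Lambda> f(1) assms(4)])
qed

lemma exp_poly_orbit_0:
  assumes "\<sigma> \<in> G"
  shows "exp_poly_orbit \<Lambda> \<sigma> 0"
proof -
  have "(\<sigma> ^^ k) 0 = 0" for k by (induction k) (simp_all add: G_0 assms)
  moreover have "\<phi> 0 = 0" if "linear_functional_on L \<phi>" for \<phi>
    using that L_0 unfolding linear_functional_on_def by (metis add_cancel_right_left)
  ultimately show ?thesis
    unfolding exp_poly_orbit_def using exp_polys.zero[of \<Lambda>] by fastforce
qed

lemma exp_poly_orbit_eigenvector:
  assumes "torsion_free_exponents \<Lambda>" "\<sigma> \<in> G" "v \<in> L" "l \<in> \<Lambda>" "\<sigma> v = fls_const (epi l 1) * v"
  shows "exp_poly_orbit \<Lambda> \<sigma> v"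
  using exp_poly_orbit_triangular[OF assms(1-4)] exp_poly_orbit_0[OF assms(2)] assms(5) by simp

text \<open>
  Every regular function is an exponential polynomial along the powers of \<open>\<sigma>\<close>, and two such functions
  that do not vanish identically are simultaneously non-zero somewhere. So the set of powers of \<open>\<sigma>\<close> is
  irreducible, hence connected, and it contains the identity.
\<close>
lemma exp_poly_orbit_in_G0:
  assumes \<Lambda>: "torsion_free_exponents \<Lambda>" and \<sigma>: "\<sigma> \<in> G" and B: "\<And>v. v \<in> B \<Longrightarrow> exp_poly_orbit \<Lambda> \<sigma> v"
  shows "power_aut \<sigma> k \<in> G0"
proof -
  have reg: "\<exists>F\<in>exp_polys \<Lambda>. \<forall>k. f (power_aut \<sigma> k) = F (of_nat k)" if "f \<in> regular_functions L B" for f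
    using that
  proof induction
    case (const e)
    have "(\<lambda>_. e) \<in> exp_polys \<Lambda>"
      using \<Lambda> by (intro exp_polys_const) (simp add: torsion_free_exponents_def)
    then show ?case by (rule bexI[rotated]) simp
  next
    case (coefficient \<phi> v)
    then show ?case using B[of v] B_L unfolding exp_poly_orbit_def power_aut_def by auto
  next
    case (add f1 f2)
    then obtain F1 F2 where "F1 \<in> exp_polys \<Lambda>" "F2 \<in> exp_polys \<Lambda>"
      "\<forall>k. f1 (power_aut \<sigma> k) = F1 (of_nat k)" "\<forall>k. f2 (power_aut \<sigma> k) = F2 (of_nat k)" by blast
    then show ?case by (intro bexI[OF _ exp_polys_add[of F1 \<Lambda> F2]]) auto
  next
    case (mult f1 f2)
    then obtain F1 F2 where "F1 \<in> exp_polys \<Lambda>" "F2 \<in> exp_polys \<Lambda>"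
      "\<forall>k. f1 (power_aut \<sigma> k) = F1 (of_nat k)" "\<forall>k. f2 (power_aut \<sigma> k) = F2 (of_nat k)" by blast
    moreover have "(\<lambda>s. F1 s * F2 s) \<in> exp_polys \<Lambda>"
      using calculation(1,2) \<Lambda> by (intro exp_polys_mult) (auto simp: torsion_free_exponents_def)
    ultimately show ?case by (intro bexI[of _ "\<lambda>s. F1 s * F2 s"]) auto
  qed
  have "connectedin T (range (power_aut \<sigma>))"
    unfolding connectedin
  proof (intro conjI notI)
    show "range (power_aut \<sigma>) \<subseteq> topspace T"
      using power_aut_in_G[OF \<sigma>] by (auto simp: topspace_T)
  next
    assume "\<exists>E1 E2. openin T E1 \<and> openin T E2 \<and> range (power_aut \<sigma>) \<subseteq> E1 \<union> E2 \<and>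
      E1 \<inter> E2 \<inter> range (power_aut \<sigma>) = {} \<and> E1 \<inter> range (power_aut \<sigma>) \<noteq> {} \<and> E2 \<inter> range (power_aut \<sigma>) \<noteq> {}"
    then obtain E1 E2 i j where E: "openin T E1" "openin T E2" "E1 \<inter> E2 \<inter> range (power_aut \<sigma>) = {}"
      "power_aut \<sigma> i \<in> E1" "power_aut \<sigma> j \<in> E2" by blast
    obtain f where f: "f \<in> regular_functions L B" "f (power_aut \<sigma> i) \<noteq> 0" "{\<tau> \<in> G. f \<tau> \<noteq> 0} \<subseteq> E1"
      using openin_contains_principal[OF E(1,4)] by blast
    obtain g where g: "g \<in> regular_functions L B" "g (power_aut \<sigma> j) \<noteq> 0" "{\<tau> \<in> G. g \<tau> \<noteq> 0} \<subseteq> E2"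
      using openin_contains_principal[OF E(2,5)] by blast
    obtain F where F: "F \<in> exp_polys \<Lambda>" "\<And>k. f (power_aut \<sigma> k) = F (of_nat k)" using reg[OF f(1)] by blast
    obtain H where H: "H \<in> exp_polys \<Lambda>" "\<And>k. g (power_aut \<sigma> k) = H (of_nat k)" using reg[OF g(1)] by blast
    obtain k :: nat where "F (of_nat k) \<noteq> 0" "H (of_nat k) \<noteq> 0"
      using exp_polys_irreducible[OF \<Lambda> F(1) H(1), of "of_nat i" "of_nat j"] f(2) g(2) F(2) H(2) by auto
    then have "power_aut \<sigma> k \<in> E1 \<inter> E2"
      using F(2) H(2) f(3) g(3) power_aut_in_G[OF \<sigma>] by auto
    then show False using E(3) by blast
  qed
  moreover have "(\<lambda>x\<in>L. x) \<in> range (power_aut \<sigma>)"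
    by (rule range_eqI[of _ _ 0]) (auto simp: power_aut_def fun_eq_iff)
  ultimately have "range (power_aut \<sigma>) \<subseteq> G0"
    by (rule connected_component_of_maximal)
  then show ?thesis by blast
qed

end

section \<open>Germs of the elementary solutions\<close>

abbreviation germ :: "(complex \<Rightarrow> complex) \<Rightarrow> complex \<Rightarrow> complex fls" where
  "germ \<equiv> laurent_expansion"

lemma has_germ: "f meromorphic_on D \<Longrightarrow> p \<in> D \<Longrightarrow> (\<lambda>w. f (p + w)) has_laurent_expansion germ f p"
  by (rule meromorphic_on_imp_has_laurent_expansion)

lemma germ_const: "germ (\<lambda>_. e) p = fls_const e"
  by (rule laurent_expansion_eqI) (auto intro: laurent_expansion_intros)

lemma germ_add:
  "f meromorphic_on D \<Longrightarrow> g meromorphic_on D \<Longrightarrow> p \<in> D \<Longrightarrow> germ (\<lambda>z. f z + g z) p = germ f p + germ g p"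
  by (intro laurent_expansion_eqI has_laurent_expansion_add has_germ[of _ D])

lemma germ_uminus:
  "f meromorphic_on D \<Longrightarrow> p \<in> D \<Longrightarrow> germ (\<lambda>z. - f z) p = - germ f p"
  by (intro laurent_expansion_eqI has_laurent_expansion_minus has_germ[of _ D])

lemma germ_diff:
  "f meromorphic_on D \<Longrightarrow> g meromorphic_on D \<Longrightarrow> p \<in> D \<Longrightarrow> germ (\<lambda>z. f z - g z) p = germ f p - germ g p"
  by (intro laurent_expansion_eqI has_laurent_expansion_diff has_germ[of _ D])

lemma germ_mult:
  "f meromorphic_on D \<Longrightarrow> g meromorphic_on D \<Longrightarrow> p \<in> D \<Longrightarrow> germ (\<lambda>z. f z * g z) p = germ f p * germ g p"
  by (intro laurent_expansion_eqI has_laurent_expansion_mult has_germ[of _ D])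

lemma germ_inverse:
  "f meromorphic_on D \<Longrightarrow> p \<in> D \<Longrightarrow> germ (\<lambda>z. inverse (f z)) p = inverse (germ f p)"
  by (intro laurent_expansion_eqI has_laurent_expansion_inverse has_germ[of _ D])

lemma germ_scale:
  "f meromorphic_on D \<Longrightarrow> p \<in> D \<Longrightarrow> germ (\<lambda>z. e * f z) p = fls_const e * germ f p"
  using germ_mult[of "\<lambda>_. e" D f p] by (simp add: germ_const meromorphic_on_const)

lemma germ_deriv:
  assumes "f meromorphic_on D" "p \<in> D"
  shows "fls_deriv (germ f p) = germ (deriv f) p"
proof -
  have "deriv (\<lambda>w. f (p + w)) has_laurent_expansion fls_deriv (germ f p)"
    by (intro has_laurent_expansion_deriv has_germ[OF assms])
  moreover have "deriv (\<lambda>w. f (p + w)) = (\<lambda>w. deriv f (p + w))"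
    by (simp add: deriv_def DERIV_shift add.commute fun_eq_iff)
  ultimately show ?thesis by (simp add: laurent_expansion_eqI)
qed

lemma germ_has_derivative:
  assumes "open D" "p \<in> D" "\<And>z. z \<in> D \<Longrightarrow> (f has_field_derivative f' z) (at z)"
  shows "fls_deriv (germ f p) = germ f' p"
proof -
  have "f holomorphic_on D" using assms(1,3) by (auto simp: holomorphic_on_open)
  then have "f meromorphic_on D"
    using assms(1) by (simp add: analytic_on_open analytic_on_imp_meromorphic_on)
  then have "fls_deriv (germ f p) = germ (deriv f) p" using assms(2) by (rule germ_deriv)
  also have "\<dots> = germ f' p"
  proof (rule laurent_expansion_cong[OF _ refl])
    have "eventually (\<lambda>z. z \<in> D) (nhds p)" using assms(1,2) by (rule eventually_nhds_in_open)
    then have "eventually (\<lambda>z. z \<in> D) (at p)" by (simp add: eventually_at_filter eventually_mono)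
    then show "eventually (\<lambda>z. deriv f z = f' z) (at p)"
      by (rule eventually_mono) (auto intro: DERIV_imp_deriv assms)
  qed
  finally show ?thesis .
qed

lemma entire_meromorphic: "f holomorphic_on UNIV \<Longrightarrow> f meromorphic_on D"
  using analytic_on_open[of UNIV f] analytic_on_imp_meromorphic_on meromorphic_on_subset by blast

text \<open>
  \<open>cs a\<close> and \<open>sn a\<close> solve \<open>x'' = -a\<^sup>2 x\<close> with initial values \<open>(1, 0)\<close> and \<open>(0, 1)\<close>. The separate case \<open>a = 0\<close>
  keeps them a basis of the solutions for every \<open>a\<close>.
\<close>
definition cs :: "complex \<Rightarrow> complex \<Rightarrow> complex" where
  "cs a t = cos (a * t)"

definition sn :: "complex \<Rightarrow> complex \<Rightarrow> complex" where
  "sn a t = (if a = 0 then t else sin (a * t) / a)"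

definition ex :: "complex \<Rightarrow> complex \<Rightarrow> complex" where
  "ex l t = exp (\<i> * l * t)"

lemma has_derivative_cs: "(cs a has_field_derivative - a\<^sup>2 * sn a t) (at t)"
  unfolding cs_def[abs_def] sn_def
  by (auto intro!: derivative_eq_intros simp: power2_eq_square)

lemma has_derivative_sn: "(sn a has_field_derivative cs a t) (at t)"
  unfolding cs_def sn_def[abs_def]
  by (cases "a = 0") (auto intro!: derivative_eq_intros)

lemma has_derivative_ex: "(ex l has_field_derivative \<i> * l * ex l t) (at t)"
  unfolding ex_def[abs_def] by (auto intro!: derivative_eq_intros)

lemma entire_cs: "cs a holomorphic_on UNIV" and entire_sn: "sn a holomorphic_on UNIV"
  and entire_ex: "ex l holomorphic_on UNIV"
  using has_derivative_cs has_derivative_sn has_derivative_ex holomorphic_on_open[OF open_UNIV] by blast+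

lemmas elementary_meromorphic = entire_cs[THEN entire_meromorphic] entire_sn[THEN entire_meromorphic]
  entire_ex[THEN entire_meromorphic]

lemma cs_sn_pythagoras: "cs a t * cs a t + a\<^sup>2 * (sn a t * sn a t) = 1"
  using sin_cos_squared_add2[of "a * t"]
  by (auto simp: cs_def sn_def power2_eq_square)

lemma ex_cs_sn: "ex l t = cs l t + \<i> * l * sn l t"
proof -
  have "exp (\<i> * (l * t)) = cos (l * t) + \<i> * sin (l * t)" by (rule exp_Euler)
  then show ?thesis by (simp add: ex_def cs_def sn_def mult.assoc)
qed

lemma cs_minus: "cs (- l) = cs l" and sn_minus: "sn (- l) = sn l"
  by (auto simp: cs_def sn_def fun_eq_iff)

lemma germ_cs_deriv: "fls_deriv (germ (cs a) p) = - fls_const (a\<^sup>2) * germ (sn a) p"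
proof -
  have "fls_deriv (germ (cs a) p) = germ (\<lambda>t. - a\<^sup>2 * sn a t) p"
    by (rule germ_has_derivative[OF open_UNIV]) (use has_derivative_cs in auto)
  also have "\<dots> = fls_const (- a\<^sup>2) * germ (sn a) p"
    by (rule germ_scale[of _ UNIV]) (auto intro: elementary_meromorphic)
  finally show ?thesis by (simp add: fls_const_uminus)
qed

lemma germ_sn_deriv: "fls_deriv (germ (sn a) p) = germ (cs a) p"
  by (rule germ_has_derivative[OF open_UNIV]) (auto intro: has_derivative_sn)

lemma germ_ex_deriv: "fls_deriv (germ (ex l) p) = fls_const (\<i> * l) * germ (ex l) p"
proof -
  have "fls_deriv (germ (ex l) p) = germ (\<lambda>t. \<i> * l * ex l t) p"
    by (rule germ_has_derivative[OF open_UNIV]) (auto intro: has_derivative_ex)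
  also have "\<dots> = fls_const (\<i> * l) * germ (ex l) p"
    by (rule germ_scale[of _ UNIV]) (auto intro: elementary_meromorphic)
  finally show ?thesis .
qed

lemma germ_pythagoras:
  "germ (cs a) p * germ (cs a) p + fls_const (a\<^sup>2) * (germ (sn a) p * germ (sn a) p) = 1"
proof -
  have "germ (\<lambda>t. cs a t * cs a t + a\<^sup>2 * (sn a t * sn a t)) p
      = germ (cs a) p * germ (cs a) p + fls_const (a\<^sup>2) * (germ (sn a) p * germ (sn a) p)"
    by (simp add: germ_add[of _ UNIV] germ_mult[of _ UNIV] germ_const meromorphic_on_mult
        meromorphic_on_const elementary_meromorphic)
  then show ?thesis by (simp add: cs_sn_pythagoras germ_const[of 1, simplified])
qed

lemma germ_ex_add: "germ (ex (l + m)) p = germ (ex l) p * germ (ex m) p"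
proof -
  have "ex (l + m) = (\<lambda>t. ex l t * ex m t)"
    by (simp add: ex_def fun_eq_iff exp_add[symmetric] algebra_simps)
  then show ?thesis by (simp add: germ_mult[of _ UNIV] elementary_meromorphic)
qed

lemma germ_ex_0: "germ (ex 0) p = 1"
  using germ_const[of 1 p] by (simp add: ex_def[abs_def])

lemma germ_ex_nonzero: "germ (ex l) p \<noteq> 0"
  and germ_ex_minus: "germ (ex (- l)) p = inverse (germ (ex l) p)"
proof -
  have *: "germ (ex l) p * germ (ex (- l)) p = 1"
    using germ_ex_add[of l "- l" p] by (simp add: germ_ex_0)
  then show "germ (ex l) p \<noteq> 0" by auto
  show "germ (ex (- l)) p = inverse (germ (ex l) p)"
    using inverse_unique[OF *] by simp
qed

lemma germ_ex_power: "germ (ex (of_nat n * l)) p = germ (ex l) p ^ n"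
  by (induction n) (simp_all add: germ_ex_0 germ_ex_add distrib_right)

lemma germ_ex_cs_sn: "germ (ex l) p = germ (cs l) p + fls_const (\<i> * l) * germ (sn l) p"
proof -
  have "germ (\<lambda>t. cs l t + \<i> * l * sn l t) p = germ (cs l) p + fls_const (\<i> * l) * germ (sn l) p"
    by (simp add: germ_add[of _ UNIV] germ_scale[of _ UNIV] meromorphic_on_mult meromorphic_on_const
        elementary_meromorphic)
  then show ?thesis by (simp add: ex_cs_sn[abs_def])
qed

definition oscillator :: "complex \<Rightarrow> complex fls \<Rightarrow> bool" where
  "oscillator a x \<longleftrightarrow> fls_deriv (fls_deriv x) = - fls_const (a\<^sup>2) * x"

lemma oscillator_cs: "oscillator a (germ (cs a) p)" and oscillator_sn: "oscillator a (germ (sn a) p)"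
  by (simp_all add: oscillator_def germ_cs_deriv germ_sn_deriv)

lemma oscillator_add: "oscillator a x \<Longrightarrow> oscillator a y \<Longrightarrow> oscillator a (x + y)"
  by (simp add: oscillator_def algebra_simps)

lemma oscillator_scale: "oscillator a x \<Longrightarrow> oscillator a (fls_const e * x)"
  by (simp add: oscillator_def algebra_simps)

lemma oscillator_0: "oscillator a 0"
  by (simp add: oscillator_def)

lemma oscillator_ex: "oscillator a (germ (ex a) p)" "oscillator a (germ (ex (- a)) p)"
proof -
  show "oscillator a (germ (ex a) p)"
    unfolding germ_ex_cs_sn[of a] by (intro oscillator_add oscillator_scale oscillator_cs oscillator_sn)
  show "oscillator a (germ (ex (- a)) p)"
    unfolding germ_ex_cs_sn[of "- a"] cs_minus sn_minus
    by (intro oscillator_add oscillator_scale oscillator_cs oscillator_sn)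
qed

text \<open>
  The Wronskians of \<open>x\<close> with the two standard solutions are constants, and they are the coefficients.
\<close>
lemma oscillator_span:
  assumes "oscillator a x"
  shows "\<exists>u v. x = fls_const u * germ (cs a) p + fls_const v * germ (sn a) p"
proof -
  define C S where "C = germ (cs a) p" and "S = germ (sn a) p"
  define A where "A = fls_const (a\<^sup>2)"
  have d: "fls_deriv C = - A * S" "fls_deriv S = C" "fls_deriv A = 0"
    by (simp_all add: C_def S_def A_def germ_cs_deriv germ_sn_deriv)
  have py: "C * C + A * (S * S) = 1" using germ_pythagoras by (simp add: C_def S_def A_def)
  have x: "fls_deriv (fls_deriv x) = - A * x" using assms by (simp add: oscillator_def A_def)
  have "fls_deriv (x * C - fls_deriv x * S) = 0" "fls_deriv (fls_deriv x * C + A * x * S) = 0"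
    by (simp_all add: d x algebra_simps)
  then obtain u v where u: "x * C - fls_deriv x * S = fls_const u" and v: "fls_deriv x * C + A * x * S = fls_const v"
    by (metis fls_deriv_eq_0_iff)
  have "x = x * (C * C + A * (S * S))" by (simp add: py)
  also have "\<dots> = fls_const u * C + fls_const v * S"
    unfolding u[symmetric] v[symmetric] by (simp add: algebra_simps)
  finally show ?thesis unfolding C_def S_def by blast
qed

lemma oscillator_span_ex:
  assumes "a \<noteq> 0" "oscillator a x"
  shows "\<exists>u v. x = fls_const u * germ (ex a) p + fls_const v * germ (ex (- a)) p"
proof -
  obtain u v where x: "x = fls_const u * germ (cs a) p + fls_const v * germ (sn a) p"
    using oscillator_span[OF assms(2)] by blast
  define u' v' where "u' = (u + v / (\<i> * a)) / 2" and "v' = (u - v / (\<i> * a)) / 2"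
  have uv: "u = u' + v'" "v = \<i> * a * u' - \<i> * a * v'"
    using assms(1) by (simp_all add: u'_def v'_def field_simps)
  have "x = fls_const u' * germ (ex a) p + fls_const v' * germ (ex (- a)) p"
    unfolding x uv germ_ex_cs_sn[of a] germ_ex_cs_sn[of "- a"] cs_minus sn_minus
    by (simp add: fls_plus_const[symmetric] fls_minus_const[symmetric] fls_const_mult_const[symmetric] algebra_simps fls_const_uminus
        del: fls_const_mult_const)
  then show ?thesis by blast
qed

lemma exponential_unique:
  fixes u e :: "complex fls"
  assumes "fls_deriv u = l * u" "fls_deriv e = l * e" "e \<noteq> 0"
  shows "\<exists>\<eta>. u = fls_const \<eta> * e"
proof -
  have "fls_deriv (u * inverse e) = 0"
    using assms(3) by (simp add: fls_deriv_inverse_field assms(1,2) mult_ac)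
  then obtain \<eta> where "u * inverse e = fls_const \<eta>" by (metis fls_deriv_eq_0_iff)
  then have "u = fls_const \<eta> * e" using assms(3) by (simp add: field_simps)
  then show ?thesis by blast
qed

section \<open>The Galois group of the variational system\<close>

lemma base_field_const: "fls_const e \<in> base_field p"
  unfolding base_field_def by (auto intro: field_generated.incl)

lemma base_field_ex: "germ (ex 1) p \<in> base_field p"
  unfolding base_field_def ex_def[abs_def] by (auto intro: field_generated.incl)

lemma base_field_add: "x \<in> base_field p \<Longrightarrow> y \<in> base_field p \<Longrightarrow> x + y \<in> base_field p"
  and base_field_mult: "x \<in> base_field p \<Longrightarrow> y \<in> base_field p \<Longrightarrow> x * y \<in> base_field p"
  and base_field_uminus: "x \<in> base_field p \<Longrightarrow> - x \<in> base_field p"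
  and base_field_inverse: "x \<in> base_field p \<Longrightarrow> inverse x \<in> base_field p"
  unfolding base_field_def by (auto intro: field_generated.intros)

lemma base_field_deriv: "x \<in> base_field p \<Longrightarrow> fls_deriv x \<in> base_field p"
proof -
  assume x: "x \<in> base_field p"
  have 1: "fls_deriv (germ (ex 1) p) \<in> base_field p"
    unfolding germ_ex_deriv by (intro base_field_mult base_field_const base_field_ex)
  have 0: "0 \<in> base_field p" using base_field_const[of 0] by simp
  show ?thesis
    using x unfolding base_field_def
    by (rule field_generated_deriv[rotated])
      (use 0 1 in \<open>auto simp: base_field_def ex_def[abs_def]\<close>)
qed

lemma germ_sin: "germ sin p = fls_const (1 / (2 * \<i>)) * (germ (ex 1) p - inverse (germ (ex 1) p))"
proof -
  have "sin = (\<lambda>t. 1 / (2 * \<i>) * (ex 1 t - ex (- 1) t))"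
    by (simp add: fun_eq_iff ex_def sin_exp_eq)
  then have "germ sin p = germ (\<lambda>t. 1 / (2 * \<i>) * (ex 1 t - ex (- 1) t)) p" by simp
  also have "\<dots> = fls_const (1 / (2 * \<i>)) * (germ (ex 1) p - germ (ex (- 1)) p)"
    by (subst germ_scale[of _ UNIV], intro meromorphic_on_diff elementary_meromorphic, simp,
        subst germ_diff[of _ UNIV]) (simp_all add: elementary_meromorphic)
  finally show ?thesis by (simp add: germ_ex_minus)
qed

lemma base_field_sin: "germ sin p \<in> base_field p"
  unfolding germ_sin diff_conv_add_uminus
  by (intro base_field_mult base_field_add base_field_uminus base_field_inverse base_field_const base_field_ex)

lemma base_field_ex_nat: "germ (ex (of_nat n)) p \<in> base_field p"
proof (induction n)
  case 0
  then show ?case using base_field_const[of 1 p] by (simp add: germ_ex_0)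
next
  case (Suc n)
  then show ?case by (simp add: germ_ex_add base_field_mult base_field_ex)
qed

lemma base_field_ex_int: "germ (ex (of_int n)) p \<in> base_field p"
proof (cases "n \<ge> 0")
  case True
  then show ?thesis using base_field_ex_nat[of "nat n" p] by simp
next
  case False
  then have "of_int n = - (of_nat (nat (- n)) :: complex)" by simp
  then show ?thesis using base_field_ex_nat[of "nat (- n)" p] by (metis germ_ex_minus base_field_inverse)
qed

locale ex2 =
  fixes t0 a b c \<theta> :: complex
begin

abbreviation "K \<equiv> base_field t0"
abbreviation "S \<equiv> ex2_solutions t0 a b c \<theta>"
abbreviation "L \<equiv> solution_field K S"
abbreviation "B \<equiv> components S"

lemma S_iff: "(x, y, z) \<in> S \<longleftrightarrow> oscillator a x \<and> oscillator b y \<and>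
    fls_deriv (fls_deriv z) = - fls_const (c\<^sup>2) * z + 2 * (fls_const \<theta> / germ sin t0) * x * y"
  by (simp add: ex2_solutions_def oscillator_def)

lemma B_I: "(x, y, z) \<in> S \<Longrightarrow> x \<in> B" "(x, y, z) \<in> S \<Longrightarrow> y \<in> B" "(x, y, z) \<in> S \<Longrightarrow> z \<in> B"
  by (auto simp: components_def)

lemma B_cases:
  assumes "v \<in> B"
  obtains x y where "(v, x, y) \<in> S" | x y where "(x, v, y) \<in> S" | x y where "(x, y, v) \<in> S"
  using assms by (auto simp: components_def)

lemma B_oscillator_a: "oscillator a x \<Longrightarrow> x \<in> B"
  and B_oscillator_b: "oscillator b x \<Longrightarrow> x \<in> B"
  and B_oscillator_c: "oscillator c x \<Longrightarrow> x \<in> B"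
  using B_I(1)[of x 0 0] B_I(2)[of 0 x 0] B_I(3)[of 0 0 x]
  by (simp_all add: S_iff oscillator_0) (simp_all add: oscillator_def)

lemma forcing_in_K: "2 * (fls_const \<theta> / germ sin t0) \<in> K"
proof -
  have "fls_const 2 * (fls_const \<theta> * inverse (germ sin t0)) \<in> K"
    by (intro base_field_mult base_field_const base_field_inverse base_field_sin)
  then show ?thesis by (simp add: divide_inverse)
qed

sublocale diff_subfield K L
proof
  show "K \<subseteq> L" unfolding solution_field_def by (auto intro: field_generated.incl)
  show "fls_const e \<in> K" for e by (rule base_field_const)
  show "fls_deriv x \<in> L" if "x \<in> L" for x
    using that unfolding solution_field_def
  proof (rule field_generated_deriv[rotated])
    fix y assume "y \<in> K \<union> {(fls_deriv ^^ k) f |k f. f \<in> B}"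
    then have "fls_deriv y \<in> K \<union> {(fls_deriv ^^ k) f |k f. f \<in> B}"
    proof
      assume "y \<in> {(fls_deriv ^^ k) f |k f. f \<in> B}"
      then obtain k f where "y = (fls_deriv ^^ k) f" "f \<in> B" by blast
      then have "fls_deriv y = (fls_deriv ^^ Suc k) f" "f \<in> B" by simp_all
      then show ?thesis by blast
    qed (simp add: base_field_deriv)
    then show "fls_deriv y \<in> field_generated (K \<union> {(fls_deriv ^^ k) f |k f. f \<in> B})"
      by (rule field_generated.incl)
  qed
qed (auto simp: solution_field_def intro: field_generated.intros)

lemma B_in_L: "v \<in> B \<Longrightarrow> v \<in> L"
proof -
  assume "v \<in> B"
  moreover have "v = (fls_deriv ^^ 0) v" by simp
  ultimately have "v \<in> {(fls_deriv ^^ k) f |k f. f \<in> B}" by blast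
  then show "v \<in> L" unfolding solution_field_def by (auto intro: field_generated.incl)
qed

lemmas oscillator_in_L = B_oscillator_a[THEN B_in_L] B_oscillator_b[THEN B_in_L] B_oscillator_c[THEN B_in_L]

lemma G_oscillator: "\<sigma> \<in> G \<Longrightarrow> x \<in> L \<Longrightarrow> oscillator w x \<Longrightarrow> oscillator w (\<sigma> x)"
proof -
  assume \<sigma>: "\<sigma> \<in> G" "x \<in> L" "oscillator w x"
  have "fls_deriv (fls_deriv (\<sigma> x)) = \<sigma> (fls_deriv (fls_deriv x))"
    using \<sigma> by (simp add: G_deriv L_deriv)
  also have "\<dots> = \<sigma> (- (fls_const (w\<^sup>2) * x))" using \<sigma>(3) by (simp add: oscillator_def)
  also have "\<dots> = - (fls_const (w\<^sup>2) * \<sigma> x)"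
    using \<sigma>(1,2) by (simp only: G_uminus[OF \<sigma>(1) L_mult[OF const_L \<sigma>(2)]] G_scale)
  finally show ?thesis by (simp add: oscillator_def)
qed

lemma G_S:
  assumes "\<sigma> \<in> G" "(x, y, z) \<in> S"
  shows "(\<sigma> x, \<sigma> y, \<sigma> z) \<in> S"
proof -
  have xyz: "x \<in> L" "y \<in> L" "z \<in> L" using B_I[OF assms(2)] B_in_L by blast+
  define q where "q = 2 * (fls_const \<theta> / germ sin t0)"
  have q: "q \<in> K" "q \<in> L" using forcing_in_K K_L by (auto simp: q_def)
  have z: "fls_deriv (fls_deriv z) = - (fls_const (c\<^sup>2) * z) + q * x * y"
    using assms(2) by (simp add: S_iff q_def)
  have "fls_deriv (fls_deriv (\<sigma> z)) = \<sigma> (fls_deriv (fls_deriv z))"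
    using assms(1) xyz by (simp add: G_deriv L_deriv)
  also have "\<dots> = \<sigma> (- (fls_const (c\<^sup>2) * z)) + \<sigma> (q * x * y)"
    unfolding z by (intro G_add assms L_uminus L_mult const_L xyz q)
  also have "\<dots> = - (fls_const (c\<^sup>2) * \<sigma> z) + q * \<sigma> x * \<sigma> y"
    using assms(1) xyz q by (simp add: G_uminus G_scale G_mult G_fix L_mult const_L)
  finally show ?thesis
    using assms xyz G_oscillator by (simp add: S_iff q_def)
qed

sublocale diff_galois K L B
proof
  show "B \<subseteq> L" using B_in_L by blast
  show "\<sigma> v \<in> B" if "\<sigma> \<in> G" "v \<in> B" for \<sigma> v
    using that(2) by (rule B_cases) (blast dest: G_S[OF that(1)] intro: B_I)+
qed

lemma ex2_virtually_abelian_iff: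
  "ex2_virtually_abelian t0 a b c \<theta> \<longleftrightarrow> (\<forall>\<sigma>\<in>G0. \<forall>\<tau>\<in>G0. compose L \<sigma> \<tau> = compose L \<tau> \<sigma>)"
  unfolding ex2_virtually_abelian_def Let_def by (rule virtually_abelian_iff)

lemma G_eq_on_B:
  assumes "\<sigma> \<in> G" "\<tau> \<in> G" "\<And>v. v \<in> B \<Longrightarrow> \<sigma> v = \<tau> v"
  shows "\<sigma> = \<tau>"
proof (rule G_eqI[OF assms(1,2) solution_field_def])
  have "\<sigma> ((fls_deriv ^^ k) f) = \<tau> ((fls_deriv ^^ k) f) \<and> (fls_deriv ^^ k) f \<in> L" if "f \<in> B" for k f
    by (induction k) (auto simp: assms B_in_L that G_deriv L_deriv)
  then show "\<sigma> x = \<tau> x" if "x \<in> K \<union> {(fls_deriv ^^ k) f |k f. f \<in> B}" for x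
    using that assms(1,2) by (auto simp: G_fix)
qed

lemma commute_on_B:
  assumes "\<sigma> \<in> G" "\<tau> \<in> G" "\<And>v. v \<in> B \<Longrightarrow> \<sigma> (\<tau> v) = \<tau> (\<sigma> v)"
  shows "compose L \<sigma> \<tau> = compose L \<tau> \<sigma>"
  by (rule G_eq_on_B) (auto simp: compose_in_G assms compose_eq B_in_L)

lemma G_ex:
  assumes "\<sigma> \<in> G" "germ (ex l) t0 \<in> L"
  shows "\<exists>\<eta>. \<sigma> (germ (ex l) t0) = fls_const \<eta> * germ (ex l) t0"
proof (rule exponential_unique)
  show "fls_deriv (\<sigma> (germ (ex l) t0)) = fls_const (\<i> * l) * \<sigma> (germ (ex l) t0)"
    using assms by (simp only: G_deriv[symmetric] germ_ex_deriv G_scale)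
qed (rule germ_ex_deriv germ_ex_nonzero)+

text \<open>
  An automorphism multiplies \<open>exp (\<i> w t)\<close> and \<open>exp (-\<i> w t)\<close> by constants if \<open>w \<noteq> 0\<close>, and it adds a constant
  to \<open>t\<close> if \<open>w = 0\<close>.
\<close>
lemma G_commute_oscillator:
  assumes \<sigma>: "\<sigma> \<in> G" and \<tau>: "\<tau> \<in> G" and L: "\<And>y. oscillator w y \<Longrightarrow> y \<in> L" and x: "oscillator w x"
  shows "\<sigma> (\<tau> x) = \<tau> (\<sigma> x)"
proof (cases "w = 0")
  case True
  define s where "s = germ (sn 0) t0"
  have sL: "s \<in> L" using L oscillator_sn True by (simp add: s_def)
  have "\<exists>u. \<rho> s = s + fls_const u" if "\<rho> \<in> G" for \<rho>
  proof -
    have s1: "fls_deriv s = 1"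
      using germ_const[of 1 t0] by (simp add: s_def germ_sn_deriv cs_def[abs_def])
    have "fls_deriv (\<rho> s - s) = 0"
      using G_deriv[OF that sL] by (simp add: s1 G_1 that)
    then obtain u where "\<rho> s - s = fls_const u" by (metis fls_deriv_eq_0_iff)
    then show ?thesis by (intro exI[of _ u]) (simp add: algebra_simps)
  qed
  then obtain u v where uv: "\<sigma> s = s + fls_const u" "\<tau> s = s + fls_const v" using \<sigma> \<tau> by blast
  obtain e f where "x = fls_const e * germ (cs 0) t0 + fls_const f * s"
    using oscillator_span x True unfolding s_def by blast
  moreover have "germ (cs 0) t0 = 1" using germ_const[of 1 t0] by (simp add: cs_def[abs_def])
  ultimately have xs: "x = fls_const e + fls_const f * s" by simp
  show ?thesis
    using \<sigma> \<tau> sL unfolding xs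
    by (simp add: G_add G_scale G_const L_mult L_add const_L uv add_ac distrib_left)
next
  case False
  define s r where "s = germ (ex w) t0" and "r = germ (ex (- w)) t0"
  have sL: "s \<in> L" "r \<in> L" using L oscillator_ex by (auto simp: s_def r_def)
  obtain u v where uv: "\<sigma> s = fls_const u * s" "\<tau> s = fls_const v * s"
    using G_ex \<sigma> \<tau> sL unfolding s_def by blast
  obtain u' v' where uv': "\<sigma> r = fls_const u' * r" "\<tau> r = fls_const v' * r"
    using G_ex \<sigma> \<tau> sL unfolding r_def by blast
  obtain e f where xs: "x = fls_const e * s + fls_const f * r"
    using oscillator_span_ex[OF False x] unfolding s_def r_def by blast
  show ?thesis
    using \<sigma> \<tau> sL unfolding xs
    by (simp add: G_add G_scale G_const L_mult L_add const_L uv uv' mult.left_commute del: fls_const_mult_const)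
qed

lemma virtually_abelian_if_theta_zero:
  assumes "\<theta> = 0"
  shows "ex2_virtually_abelian t0 a b c \<theta>"
  unfolding ex2_virtually_abelian_iff
proof (intro ballI commute_on_B)
  fix \<sigma> \<tau> v assume "\<sigma> \<in> G0" "\<tau> \<in> G0" and v: "v \<in> B"
  then have *: "\<sigma> \<in> G" "\<tau> \<in> G" using G0_G by auto
  from v have "oscillator a v \<or> oscillator b v \<or> oscillator c v"
    by (rule B_cases) (auto simp: S_iff[unfolded assms] assms oscillator_def)
  then show "\<sigma> (\<tau> v) = \<tau> (\<sigma> v)"
    using G_commute_oscillator[OF *] oscillator_in_L by blast
qed (use G0_G in auto)

lemma regular_prod:
  "finite A \<Longrightarrow> (\<And>i. i \<in> A \<Longrightarrow> f i \<in> regular_functions L B) \<Longrightarrow> (\<lambda>\<sigma>. \<Prod>i\<in>A. f i \<sigma>) \<in> regular_functions L B"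
proof (induction A rule: finite_induct)
  case empty
  then show ?case using regular_functions.const[of 1 L B] by simp
next
  case (insert i A)
  then show ?case using regular_functions.mult[of "f i" L B] by simp
qed

text \<open>
  A power of \<open>exp (\<i> w t)\<close> lies in the base field, so every automorphism multiplies this function by a
  root of unity. This root of unity is a regular function with finitely many values, hence constant on
  the identity component.
\<close>
lemma G0_fixes_rational_ex:
  assumes "w \<in> \<rat>" "germ (ex w) t0 \<in> B" "\<sigma> \<in> G0"
  shows "\<sigma> (germ (ex w) t0) = germ (ex w) t0"
proof -
  define e where "e = germ (ex w) t0"
  have eB: "e \<in> B" and eL: "e \<in> L" using assms(2) B_in_L by (auto simp: e_def)
  obtain m N :: int where w: "w = of_int m / of_int N" "N > 0"
    using assms(1) by (auto elim!: Rats_cases' )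
  define n where "n = nat N"
  have n: "n > 0" "of_nat n * w = of_int m" using w by (auto simp: n_def)
  have en: "e ^ n \<in> K" using base_field_ex_int[of m t0] n(2) by (simp add: e_def germ_ex_power[symmetric])
  obtain j where j: "fls_nth e j \<noteq> 0" using germ_ex_nonzero[of w t0] fls_eqI[of e 0] by (auto simp: e_def)
  \<comment> \<open>A non-zero Laurent coefficient of \<open>e\<close> reads off the factor by which an automorphism multiplies \<open>e\<close>.\<close>
  define \<phi> where "\<phi> = (\<lambda>x. fls_nth x j / fls_nth e j)"
  have \<phi>: "linear_functional_on L \<phi>"
    by (simp add: linear_functional_on_def \<phi>_def add_divide_distrib)
  have \<eta>: "\<rho> e = fls_const (\<phi> (\<rho> e)) * e \<and> \<phi> (\<rho> e) ^ n = 1" if \<rho>: "\<rho> \<in> G" for \<rho>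
  proof -
    obtain \<eta> where \<eta>: "\<rho> e = fls_const \<eta> * e" using G_ex[OF \<rho>] eL unfolding e_def by blast
    then have \<phi>\<eta>: "\<phi> (\<rho> e) = \<eta>" using j by (simp add: \<phi>_def)
    have "\<rho> (e ^ k) = \<rho> e ^ k \<and> e ^ k \<in> L" for k
      by (induction k) (simp_all add: G_1 \<rho> L_1 G_mult eL L_mult)
    then have "e ^ n = (fls_const \<eta> * e) ^ n" using G_fix[OF \<rho> en] \<eta> by simp
    also have "\<dots> = fls_const (\<eta> ^ n) * e ^ n" by (simp add: power_mult_distrib fls_const_power)
    finally have "fls_const (\<eta> ^ n) * e ^ n = 1 * e ^ n" by simp
    moreover have "e ^ n \<noteq> 0" using germ_ex_nonzero by (simp add: e_def)
    ultimately have "fls_const (\<eta> ^ n) = (1 :: complex fls)" by (metis mult_cancel_right)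
    then have "\<eta> ^ n = 1" by (metis fls_const_1 fls_const_nth)
    with \<eta> \<phi>\<eta> show ?thesis by simp
  qed
  define Z where "Z = {\<zeta>::complex. \<zeta> ^ n = 1} - {1}"
  have finZ: "finite Z" unfolding Z_def using n(1) by (simp add: finite_roots_unity)
  have r: "(\<lambda>\<rho>. \<phi> (\<rho> e) + (- \<zeta>)) \<in> regular_functions L B" for \<zeta>
    by (intro regular_functions.add regular_functions.coefficient regular_functions.const \<phi> eB)
  define U1 where "U1 = {\<rho> \<in> G. \<phi> (\<rho> e) + (- 1) \<noteq> 0}"
  define U2 where "U2 = {\<rho> \<in> G. (\<Prod>\<zeta>\<in>Z. \<phi> (\<rho> e) + (- \<zeta>)) \<noteq> 0}"
  have op: "openin T U1" "openin T U2"
    unfolding U1_def U2_def by (intro openin_principal regular_prod r finZ)+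
  have U12: "\<rho> \<in> U1 \<longleftrightarrow> \<phi> (\<rho> e) \<noteq> 1" "\<rho> \<in> U2 \<longleftrightarrow> \<phi> (\<rho> e) = 1" if "\<rho> \<in> G" for \<rho>
    using that \<eta>[OF that] finZ by (auto simp: U1_def U2_def Z_def)
  have id: "(\<lambda>x\<in>L. x) \<in> U2" using U12(2)[OF id_in_G] j eL by (simp add: \<phi>_def)
  have con: "connectedin T G0" by (rule connectedin_connected_component_of)
  have "U1 \<inter> G0 = {}"
  proof (rule ccontr)
    assume "U1 \<inter> G0 \<noteq> {}"
    moreover have "G0 \<subseteq> U1 \<union> U2" "U1 \<inter> U2 \<inter> G0 = {}" using U12 G0_G by auto
    moreover have "U2 \<inter> G0 \<noteq> {}" using id id_in_G0 by blast
    ultimately show False using connectedinD[OF con op] by blast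
  qed
  moreover have "\<sigma> \<in> G" using assms(3) G0_G by blast
  ultimately have "\<phi> (\<sigma> e) = 1" using U12(1)[of \<sigma>] assms(3) by blast
  then show ?thesis using \<eta>[OF \<open>\<sigma> \<in> G\<close>] by (simp add: e_def)
qed

lemma G0_fixes_rational_oscillator:
  assumes "w \<in> \<rat>" "w \<noteq> 0" "\<And>y. oscillator w y \<Longrightarrow> y \<in> B" "\<sigma> \<in> G0" "oscillator w x"
  shows "\<sigma> x = x"
proof -
  have \<sigma>: "\<sigma> \<in> G" using assms(4) G0_G by blast
  have B: "germ (ex w) t0 \<in> B" "germ (ex (- w)) t0 \<in> B" using assms(3) oscillator_ex by auto
  have "\<sigma> (germ (ex w) t0) = germ (ex w) t0" "\<sigma> (germ (ex (- w)) t0) = germ (ex (- w)) t0"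
    using G0_fixes_rational_ex assms(1,4) B by auto
  moreover obtain u v where "x = fls_const u * germ (ex w) t0 + fls_const v * germ (ex (- w)) t0"
    using oscillator_span_ex[OF assms(2,5)] by blast
  ultimately show ?thesis
    using \<sigma> B[THEN B_in_L] by (simp add: G_add G_scale L_mult const_L)
qed

text \<open>
  The identity component fixes the homogeneous solutions, so it acts on the \<open>z\<close>-component by adding
  homogeneous solutions, which it fixes again.
\<close>
lemma virtually_abelian_if_rational:
  assumes "a \<in> \<rat> - {0}" "b \<in> \<rat> - {0}" "c \<in> \<rat> - {0}"
  shows "ex2_virtually_abelian t0 a b c \<theta>"
  unfolding ex2_virtually_abelian_iff
proof (intro ballI commute_on_B)
  fix \<sigma> \<tau> v assume \<sigma>: "\<sigma> \<in> G0" and \<tau>: "\<tau> \<in> G0" and v: "v \<in> B"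
  have fix_a: "\<rho> x = x" if "\<rho> \<in> G0" "oscillator a x" for \<rho> x
    using G0_fixes_rational_oscillator[of a] B_oscillator_a assms(1) that by blast
  have fix_b: "\<rho> x = x" if "\<rho> \<in> G0" "oscillator b x" for \<rho> x
    using G0_fixes_rational_oscillator[of b] B_oscillator_b assms(2) that by blast
  have fix_c: "\<rho> x = x" if "\<rho> \<in> G0" "oscillator c x" for \<rho> x
    using G0_fixes_rational_oscillator[of c] B_oscillator_c assms(3) that by blast
  from v show "\<sigma> (\<tau> v) = \<tau> (\<sigma> v)"
  proof (rule B_cases)
    fix x y assume "(v, x, y) \<in> S"
    then have "oscillator a v" by (simp add: S_iff)
    then show ?thesis using fix_a[OF \<sigma>] fix_a[OF \<tau>] by simp
  next
    fix x y assume "(x, v, y) \<in> S"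
    then have "oscillator b v" by (simp add: S_iff)
    then show ?thesis using fix_b[OF \<sigma>] fix_b[OF \<tau>] by simp
  next
    fix x y assume xyv: "(x, y, v) \<in> S"
    then have osc: "oscillator a x" "oscillator b y" by (auto simp: S_iff)
    have shift: "\<exists>h. oscillator c h \<and> \<rho> v = v + h" if "\<rho> \<in> G0" for \<rho>
    proof -
      have "(x, y, \<rho> v) \<in> S"
        using G_S[OF _ xyv, of \<rho>] G0_G that fix_a[OF that osc(1)] fix_b[OF that osc(2)] by auto
      then have "oscillator c (\<rho> v - v)"
        using xyv by (simp add: S_iff oscillator_def algebra_simps)
      then show ?thesis by (intro exI[of _ "\<rho> v - v"]) simp
    qed
    obtain h k where h: "oscillator c h" "\<sigma> v = v + h" and k: "oscillator c k" "\<tau> v = v + k"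
      using shift \<sigma> \<tau> by blast
    have vL: "v \<in> L" "h \<in> L" "k \<in> L" using v B_in_L oscillator_in_L(3) h k by auto
    have "\<sigma> \<in> G" "\<tau> \<in> G" using \<sigma> \<tau> G0_G by auto
    then show ?thesis
      using h k vL fix_c[OF \<sigma> k(1)] fix_c[OF \<tau> h(1)] by (simp add: G_add algebra_simps)
  qed
qed (use G0_G in auto)

end

section \<open>Correspondences between germs at two points\<close>

text \<open>
  A partial isomorphism between differential fields of germs at \<open>p\<close> and at \<open>q\<close> over the coefficients
  of the system, given by its graph. Graphs are convenient because they compose and invert without reference
  to domains, as analytic continuation along consecutive paths does.
\<close>
locale diff_correspondence =
  fixes p q :: complex and R :: "(complex fls \<times> complex fls) set"
  assumes R_const: "(fls_const e, fls_const e) \<in> R"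
    and R_ex: "(germ (ex 1) p, germ (ex 1) q) \<in> R"
    and R_add: "(x, x') \<in> R \<Longrightarrow> (y, y') \<in> R \<Longrightarrow> (x + y, x' + y') \<in> R"
    and R_mult: "(x, x') \<in> R \<Longrightarrow> (y, y') \<in> R \<Longrightarrow> (x * y, x' * y') \<in> R"
    and R_uminus: "(x, x') \<in> R \<Longrightarrow> (- x, - x') \<in> R"
    and R_inverse: "(x, x') \<in> R \<Longrightarrow> (inverse x, inverse x') \<in> R"
    and R_deriv: "(x, x') \<in> R \<Longrightarrow> (fls_deriv x, fls_deriv x') \<in> R"
    and R_unique: "(x, x') \<in> R \<Longrightarrow> (x, x'') \<in> R \<Longrightarrow> x' = x''"
    and R_injective: "(x, x') \<in> R \<Longrightarrow> (y, x') \<in> R \<Longrightarrow> x = y"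
begin

lemma R_diff: "(x, x') \<in> R \<Longrightarrow> (y, y') \<in> R \<Longrightarrow> (x - y, x' - y') \<in> R"
  using R_add[of x x' "- y" "- y'"] R_uminus by simp

lemma R_sin: "(germ sin p, germ sin q) \<in> R"
  unfolding germ_sin by (intro R_mult R_diff R_inverse R_const R_ex)

lemma R_oscillator: "(x, x') \<in> R \<Longrightarrow> oscillator w x \<Longrightarrow> oscillator w x'"
proof -
  assume x: "(x, x') \<in> R" "oscillator w x"
  have "(fls_deriv (fls_deriv x), fls_deriv (fls_deriv x')) \<in> R" by (intro R_deriv x)
  moreover have "(- (fls_const (w\<^sup>2) * x), - (fls_const (w\<^sup>2) * x')) \<in> R"
    by (intro R_uminus R_mult R_const x)
  ultimately show ?thesis using x(2) R_unique by (simp add: oscillator_def)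
qed

lemma R_solutions:
  assumes "(x, x') \<in> R" "(y, y') \<in> R" "(z, z') \<in> R" "(x, y, z) \<in> ex2_solutions p a b c \<theta>"
  shows "(x', y', z') \<in> ex2_solutions q a b c \<theta>"
proof -
  have 2: "(2, 2) \<in> R" using R_const[of 2] by simp
  have "(fls_deriv (fls_deriv z), fls_deriv (fls_deriv z')) \<in> R" by (intro R_deriv assms)
  moreover have "(- (fls_const (c\<^sup>2) * z) + 2 * (fls_const \<theta> * inverse (germ sin p)) * x * y,
      - (fls_const (c\<^sup>2) * z') + 2 * (fls_const \<theta> * inverse (germ sin q)) * x' * y') \<in> R"
    by (intro R_add R_uminus R_mult R_inverse R_const R_sin 2 assms)
  moreover have "fls_deriv (fls_deriv z) = - (fls_const (c\<^sup>2) * z) + 2 * (fls_const \<theta> * inverse (germ sin p)) * x * y"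
    using assms(4) by (simp add: ex2.S_iff divide_inverse)
  ultimately have "fls_deriv (fls_deriv z')
      = - (fls_const (c\<^sup>2) * z') + 2 * (fls_const \<theta> * inverse (germ sin q)) * x' * y'"
    using R_unique by metis
  then show ?thesis
    using R_oscillator assms unfolding ex2.S_iff by (auto simp: divide_inverse)
qed

lemma R_base_field:
  assumes eq: "germ (ex 1) p = germ (ex 1) q" and x: "x \<in> base_field p"
  shows "(x, x) \<in> R"
proof -
  from x show ?thesis unfolding base_field_def
  proof induction
    case (incl x)
    then show ?case using R_const R_ex eq by (auto simp: ex_def[abs_def])
  next
    case one
    then show ?case using R_const[of 1] by simp
  qed (auto intro: R_add R_mult R_uminus R_inverse)
qed

end

lemma diff_correspondence_converse:
  assumes "diff_correspondence p q R"
  shows "diff_correspondence q p (R\<inverse>)"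
proof -
  interpret diff_correspondence p q R by fact
  show ?thesis
    by unfold_locales
      (auto intro: R_const R_ex R_add R_mult R_uminus R_inverse R_deriv dest: R_unique R_injective)
qed

lemma diff_correspondence_comp:
  assumes "diff_correspondence p q R" "diff_correspondence q r R'"
  shows "diff_correspondence p r (R O R')"
proof -
  interpret R: diff_correspondence p q R by fact
  interpret R': diff_correspondence q r R' by fact
  show ?thesis
  proof
    fix x x' x'' assume "(x, x') \<in> R O R'" "(x, x'') \<in> R O R'"
    then show "x' = x''" using R.R_unique R'.R_unique by blast
  next
    fix x x' y assume "(x, x') \<in> R O R'" "(y, x') \<in> R O R'"
    then show "x = y" using R.R_injective R'.R_injective by blast
  qed (use R.R_const R'.R_const R.R_ex R'.R_ex in \<open>blast intro: R.R_add R'.R_add R.R_mult R'.R_mult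
      R.R_uminus R'.R_uminus R.R_inverse R'.R_inverse R.R_deriv R'.R_deriv\<close>)+
qed

definition total_on_solutions ::
  "(complex fls \<times> complex fls \<times> complex fls) set \<Rightarrow> (complex fls \<times> complex fls) set \<Rightarrow> bool" where
  "total_on_solutions S R \<longleftrightarrow> (\<forall>(x, y, z)\<in>S. \<exists>x' y' z'. (x, x') \<in> R \<and> (y, y') \<in> R \<and> (z, z') \<in> R)"

lemma total_on_solutions_comp:
  assumes "diff_correspondence p q R"
    and "total_on_solutions (ex2_solutions p a b c \<theta>) R" "total_on_solutions (ex2_solutions q a b c \<theta>) R'"
  shows "total_on_solutions (ex2_solutions p a b c \<theta>) (R O R')"
  unfolding total_on_solutions_def
proof clarify
  fix x y z assume s: "(x, y, z) \<in> ex2_solutions p a b c \<theta>"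
  then obtain x' y' z' where R: "(x, x') \<in> R" "(y, y') \<in> R" "(z, z') \<in> R"
    using assms(2) unfolding total_on_solutions_def by blast
  then have "(x', y', z') \<in> ex2_solutions q a b c \<theta>"
    using diff_correspondence.R_solutions[OF assms(1)] s by blast
  then obtain x'' y'' z'' where "(x', x'') \<in> R'" "(y', y'') \<in> R'" "(z', z'') \<in> R'"
    using assms(3) unfolding total_on_solutions_def by blast
  then show "\<exists>x'' y'' z''. (x, x'') \<in> R O R' \<and> (y, y'') \<in> R O R' \<and> (z, z'') \<in> R O R'"
    using R by blast
qed

context ex2
begin

text \<open>
  A correspondence sends solutions to solutions, and \<open>L\<close> is generated by them.
\<close>
lemma total_on_L:
  assumes R: "diff_correspondence t0 t0 R" and tot: "total_on_solutions S R" and x: "x \<in> L"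
  shows "\<exists>x'\<in>L. (x, x') \<in> R"
proof -
  interpret R: diff_correspondence t0 t0 R by fact
  have B: "\<exists>v'\<in>B. (v, v') \<in> R" if "v \<in> B" for v
  proof -
    obtain x y z where xyz: "(x, y, z) \<in> S" "v \<in> {x, y, z}" using \<open>v \<in> B\<close> by (auto simp: components_def)
    then obtain x' y' z' where R': "(x, x') \<in> R" "(y, y') \<in> R" "(z, z') \<in> R"
      using tot unfolding total_on_solutions_def by blast
    then have "(x', y', z') \<in> S" using R.R_solutions xyz(1) by blast
    then show ?thesis using xyz(2) R' B_I by blast
  qed
  show ?thesis
    using x unfolding solution_field_def
  proof induction
    case (incl x)
    then show ?case
    proof
      assume "x \<in> K"
      then show ?thesis using R.R_base_field by (auto intro: field_generated.incl)
    next
      assume "x \<in> {(fls_deriv ^^ k) f |k f. f \<in> B}"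
      then obtain k f where x: "x = (fls_deriv ^^ k) f" "f \<in> B" by blast
      then obtain f' where f': "f' \<in> B" "(f, f') \<in> R" using B by blast
      have "((fls_deriv ^^ k) f, (fls_deriv ^^ k) f') \<in> R"
        by (induction k) (simp_all add: f' R.R_deriv)
      then show ?thesis using x f' by (intro bexI[of _ "(fls_deriv ^^ k) f'"] field_generated.incl) auto
    qed
  next
    case one
    show ?case using R.R_const[of 1] by (intro bexI[of _ 1] field_generated.one) simp
  next
    case (add x y)
    then show ?case using R.R_add field_generated.add by blast
  next
    case (uminus x)
    then show ?case using R.R_uminus field_generated.uminus by blast
  next
    case (mult x y)
    then show ?case using R.R_mult field_generated.mult by blast
  next
    case (inverse x)
    then show ?case using R.R_inverse field_generated.inverse by blast
  qed
qed

lemma automorphism_of_correspondence: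
  assumes R: "diff_correspondence t0 t0 R"
    and tot: "total_on_solutions S R" "total_on_solutions S (R\<inverse>)"
  shows "\<exists>\<sigma>\<in>G. \<forall>x\<in>L. (x, \<sigma> x) \<in> R"
proof -
  interpret R: diff_correspondence t0 t0 R by fact
  define \<sigma> where "\<sigma> = (\<lambda>x\<in>L. SOME x'. x' \<in> L \<and> (x, x') \<in> R)"
  have \<sigma>: "\<sigma> x \<in> L \<and> (x, \<sigma> x) \<in> R" if "x \<in> L" for x
    using someI_ex[of "\<lambda>x'. x' \<in> L \<and> (x, x') \<in> R"] total_on_L[OF R tot(1) that] that
    by (auto simp: \<sigma>_def)
  have eq: "\<sigma> x = x'" if "x \<in> L" "(x, x') \<in> R" for x x'
    using \<sigma>[OF that(1)] that(2) R.R_unique by blast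
  have "\<sigma> \<in> G"
  proof (rule G_I)
    show "bij_betw \<sigma> L L"
      unfolding bij_betw_def
    proof
      show "inj_on \<sigma> L" using \<sigma> R.R_injective by (intro inj_onI) metis
      have "x' \<in> \<sigma> ` L" if "x' \<in> L" for x'
      proof -
        obtain x where "x \<in> L" "(x, x') \<in> R"
          using total_on_L[OF diff_correspondence_converse[OF R] tot(2) \<open>x' \<in> L\<close>] by blast
        then show ?thesis using eq by blast
      qed
      then show "\<sigma> ` L = L" using \<sigma> by blast
    qed
    show "\<sigma> \<in> extensional L" by (simp add: \<sigma>_def)
    show "\<sigma> (x + y) = \<sigma> x + \<sigma> y" if "x \<in> L" "y \<in> L" for x y
      using that \<sigma> by (intro eq L_add R.R_add) auto
    show "\<sigma> (x * y) = \<sigma> x * \<sigma> y" if "x \<in> L" "y \<in> L" for x y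
      using that \<sigma> by (intro eq L_mult R.R_mult) auto
    show "\<sigma> x = x" if "x \<in> K" for x
      using that K_L R.R_base_field by (intro eq) auto
    show "\<sigma> (fls_deriv x) = fls_deriv (\<sigma> x)" if "x \<in> L" for x
      using that \<sigma> by (intro eq L_deriv R.R_deriv) auto
  qed
  then show ?thesis using \<sigma> by blast
qed

end

section \<open>Analytic continuation\<close>

definition continuation :: "complex set \<Rightarrow> complex \<Rightarrow> complex \<Rightarrow> (complex fls \<times> complex fls) set" where
  "continuation D p q = {(germ f p, germ f q) | f. f meromorphic_on D}"

lemma continuation_converse: "(continuation D p q)\<inverse> = continuation D q p"
  by (auto simp: continuation_def)

text \<open>
  The identity theorem, which makes continuation inside a connected domain single-valued.
\<close>
lemma meromorphic_germ_identity:
  assumes D: "open D" "connected D" "p \<in> D" "q \<in> D"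
    and fg: "f meromorphic_on D" "g meromorphic_on D" "germ f p = germ g p"
  shows "germ f q = germ g q"
proof -
  define h where "h = (\<lambda>z. f z - g z)"
  have h: "h meromorphic_on D" unfolding h_def by (intro meromorphic_on_diff fg)
  have hp: "germ h p = 0" unfolding h_def using fg D by (simp add: germ_diff[of _ D])
  have "(\<forall>\<^sub>\<approx>z\<in>D. h z = 0) \<or> (\<forall>\<^sub>\<approx>z\<in>D. h z \<noteq> 0)"
    by (rule meromorphic_imp_constant_or_avoid[OF h D(1,2)])
  moreover have "\<not> (\<forall>\<^sub>\<approx>z\<in>D. h z \<noteq> 0)"
  proof
    assume "\<forall>\<^sub>\<approx>z\<in>D. h z \<noteq> 0"
    then have "eventually (\<lambda>z. h z \<noteq> 0) (at p)" using D by (simp add: eventually_cosparse_open_eq)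
    then show False
      using has_laurent_expansion_eventually_nonzero_iff[OF has_germ[OF h D(3)]] hp by simp
  qed
  ultimately have "eventually (\<lambda>z. h z = 0) (at q)" using D by (simp add: eventually_cosparse_open_eq)
  then have "germ h q = 0"
    using has_laurent_expansion_eventually_zero_iff[OF has_germ[OF h D(4)]] by simp
  then show ?thesis unfolding h_def using fg D by (simp add: germ_diff[of _ D])
qed

lemma continuation_correspondence:
  assumes D: "open D" "connected D" "p \<in> D" "q \<in> D"
  shows "diff_correspondence p q (continuation D p q)"
proof
  show "(fls_const e, fls_const e) \<in> continuation D p q" for e
    unfolding continuation_def
    using germ_const[of e p] germ_const[of e q] meromorphic_on_const[of e D] by force
  show "(germ (ex 1) p, germ (ex 1) q) \<in> continuation D p q"
    unfolding continuation_def using elementary_meromorphic by blast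
next
  fix x x' y y' assume "(x, x') \<in> continuation D p q" "(y, y') \<in> continuation D p q"
  then obtain f g where fg: "f meromorphic_on D" "g meromorphic_on D"
    and e: "x = germ f p" "x' = germ f q" "y = germ g p" "y' = germ g q"
    unfolding continuation_def by blast
  have "(germ (\<lambda>z. f z + g z) p, germ (\<lambda>z. f z + g z) q) \<in> continuation D p q"
    unfolding continuation_def using meromorphic_on_add[OF fg] by blast
  then show "(x + y, x' + y') \<in> continuation D p q" using D fg by (simp add: e germ_add[of _ D])
  have "(germ (\<lambda>z. f z * g z) p, germ (\<lambda>z. f z * g z) q) \<in> continuation D p q"
    unfolding continuation_def using meromorphic_on_mult[OF fg] by blast
  then show "(x * y, x' * y') \<in> continuation D p q" using D fg by (simp add: e germ_mult[of _ D])
next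
  fix x x' assume "(x, x') \<in> continuation D p q"
  then obtain f where f: "f meromorphic_on D" and e: "x = germ f p" "x' = germ f q"
    unfolding continuation_def by blast
  have "(germ (\<lambda>z. - f z) p, germ (\<lambda>z. - f z) q) \<in> continuation D p q"
    unfolding continuation_def using meromorphic_on_uminus[OF f] by blast
  then show "(- x, - x') \<in> continuation D p q" using D f by (simp add: e germ_uminus[of _ D])
  have "(germ (\<lambda>z. inverse (f z)) p, germ (\<lambda>z. inverse (f z)) q) \<in> continuation D p q"
    unfolding continuation_def using meromorphic_on_inverse[OF f] by blast
  then show "(inverse x, inverse x') \<in> continuation D p q" using D f by (simp add: e germ_inverse[of _ D])
  have "(germ (deriv f) p, germ (deriv f) q) \<in> continuation D p q"
    unfolding continuation_def using meromorphic_on_deriv[OF f] by blast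
  then show "(fls_deriv x, fls_deriv x') \<in> continuation D p q" using D f by (simp add: e germ_deriv[of _ D])
next
  fix x x' x'' assume "(x, x') \<in> continuation D p q" "(x, x'') \<in> continuation D p q"
  then show "x' = x''" unfolding continuation_def using meromorphic_germ_identity[OF D] by blast
next
  fix x x' y assume "(x, x') \<in> continuation D p q" "(y, x') \<in> continuation D p q"
  then show "x = y" unfolding continuation_def using meromorphic_germ_identity[OF D(1,2,4,3)] by blast
qed

definition slit_plane :: "real \<Rightarrow> real \<Rightarrow> complex set" where
  "slit_plane u v = {z. Im z \<noteq> 0} \<union> {z. u < Re z \<and> Re z < v}"

lemma open_slit_plane: "open (slit_plane u v)"
proof -
  have "{z. Im z \<noteq> 0} = {z. Im z > 0} \<union> {z. Im z < 0}" by auto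
  then have "open {z. Im z \<noteq> 0}" by (simp add: open_Un open_halfspace_Im_gt open_halfspace_Im_lt)
  moreover have "{z. u < Re z \<and> Re z < v} = {z. Re z > u} \<inter> {z. Re z < v}" by auto
  then have "open {z. u < Re z \<and> Re z < v}"
    by (simp add: open_Int open_halfspace_Re_gt open_halfspace_Re_lt)
  ultimately show ?thesis by (simp add: slit_plane_def open_Un)
qed

lemma starlike_slit_plane:
  assumes "u < v"
  shows "starlike (slit_plane u v)"
proof -
  define r where "r = (u + v) / 2"
  have r: "u < r" "r < v" using assms by (auto simp: r_def)
  have "w \<in> slit_plane u v" if z: "z \<in> slit_plane u v" and w: "w \<in> closed_segment (of_real r) z" for z w
  proof (cases "Im z = 0")
    case False
    obtain s where s: "w = (1 - s) *\<^sub>R of_real r + s *\<^sub>R z" "0 \<le> s" "s \<le> 1"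
      using w by (auto simp: in_segment)
    show ?thesis
      using False s r by (cases "s = 0") (auto simp: slit_plane_def)
  next
    case True
    then have "u < Re z" "Re z < v" using z by (auto simp: slit_plane_def)
    moreover have "convex {w. u < Re w \<and> Re w < v}"
    proof -
      have "{w. u < Re w \<and> Re w < v} = {w. Re w > u} \<inter> {w. Re w < v}" by auto
      then show ?thesis by (simp add: convex_Int convex_halfspace_Re_gt convex_halfspace_Re_lt)
    qed
    ultimately have "closed_segment (of_real r) z \<subseteq> {w. u < Re w \<and> Re w < v}"
      using r by (intro closed_segment_subset) auto
    then show ?thesis using w by (auto simp: slit_plane_def)
  qed
  moreover have "of_real r \<in> slit_plane u v" using r by (simp add: slit_plane_def)
  ultimately show ?thesis unfolding starlike_def by blast
qed

lemma connected_slit_plane: "u < v \<Longrightarrow> connected (slit_plane u v)"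
  by (intro starlike_imp_connected starlike_slit_plane)

lemma slit_plane_primitive:
  assumes "u < v" "f holomorphic_on slit_plane u v"
  shows "\<exists>g. \<forall>z\<in>slit_plane u v. (g has_field_derivative f z) (at z)"
proof (rule holomorphic_starlike_primitive[OF _ starlike_slit_plane[OF assms(1)] open_slit_plane, of f "{}"])
  show "continuous_on (slit_plane u v) f" using assms(2) by (rule holomorphic_on_imp_continuous_on)
  show "f field_differentiable at z" if "z \<in> slit_plane u v - {}" for z
    using assms(2) that open_slit_plane holomorphic_on_imp_differentiable_at by auto
qed auto

text \<open>
  The plane cut along the real axis outside the open interval between two consecutive zeros of \<open>sin\<close>. It is
  starlike, so holomorphic functions have primitives there, and \<open>1 / sin\<close> is holomorphic on it. Passing from
  one gap to another through the upper or through the lower half-plane realises all paths needed below.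
\<close>
definition gap :: "int \<Rightarrow> complex set" where
  "gap m = slit_plane (of_int m * pi) (of_int (m + 1) * pi)"

lemma gap_less: "of_int m * pi < of_int (m + 1) * pi"
  by simp

lemma open_gap: "open (gap m)" and connected_gap: "connected (gap m)"
  unfolding gap_def using open_slit_plane connected_slit_plane[OF gap_less] by auto

lemma gap_primitive:
  "f holomorphic_on gap m \<Longrightarrow> \<exists>g. \<forall>z\<in>gap m. (g has_field_derivative f z) (at z)"
  unfolding gap_def by (rule slit_plane_primitive[OF gap_less])

lemma sin_nonzero_gap: "z \<in> gap m \<Longrightarrow> sin z \<noteq> 0"
proof
  assume z: "z \<in> gap m" and "sin z = 0"
  then obtain n :: int where n: "z = of_real (of_int n * pi)" by (auto simp: sin_eq_0)
  then have "of_int m * pi < of_int n * pi" "of_int n * pi < of_int (m + 1) * pi"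
    using z by (auto simp: gap_def slit_plane_def)
  then have "m < n" "n < m + 1" by (simp_all only: mult_less_cancel_right_pos[OF pi_gt_zero] of_int_less_iff)
  then show False by simp
qed

lemma gap_exists:
  assumes "sin z \<noteq> 0"
  shows "\<exists>m. z \<in> gap m"
proof -
  define m where "m = \<lfloor>Re z / pi\<rfloor>"
  have m: "of_int m * pi \<le> Re z" "Re z < of_int (m + 1) * pi"
    using floor_divide_lower[of pi "Re z"] floor_divide_upper[of pi "Re z"] by (auto simp: m_def)
  have "z \<in> gap m"
  proof (rule ccontr)
    assume "z \<notin> gap m"
    then have "z = of_real (of_int m * pi)" using m by (auto simp: gap_def slit_plane_def complex_eq_iff)
    then show False using assms sin_eq_0 by blast
  qed
  then show ?thesis by blast
qed

lemma nonreal_in_gap: "Im z \<noteq> 0 \<Longrightarrow> z \<in> gap m"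
  by (simp add: gap_def slit_plane_def)

lemma primitive_meromorphic:
  assumes "open D" "\<And>z. z \<in> D \<Longrightarrow> (g has_field_derivative f z) (at z)"
  shows "g meromorphic_on D"
proof -
  have "g holomorphic_on D" using assms by (auto simp: holomorphic_on_open)
  then show ?thesis using assms(1) by (simp add: analytic_on_open analytic_on_imp_meromorphic_on)
qed

lemma gap_primitive_germ:
  assumes "N holomorphic_on UNIV"
  obtains F where "F meromorphic_on gap m"
    "\<And>p. p \<in> gap m \<Longrightarrow> fls_deriv (germ F p) = germ N p * inverse (germ sin p)"
proof -
  have N: "N meromorphic_on gap m" using assms by (rule entire_meromorphic)
  have s: "sin meromorphic_on gap m" by (intro entire_meromorphic holomorphic_intros)
  have "(\<lambda>z. N z * inverse (sin z)) holomorphic_on gap m"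
    using sin_nonzero_gap holomorphic_on_subset[OF assms] by (intro holomorphic_intros) auto
  then obtain F where F: "\<And>z. z \<in> gap m \<Longrightarrow> (F has_field_derivative N z * inverse (sin z)) (at z)"
    using gap_primitive by blast
  have "fls_deriv (germ F p) = germ N p * inverse (germ sin p)" if "p \<in> gap m" for p
  proof -
    have "fls_deriv (germ F p) = germ (\<lambda>z. N z * inverse (sin z)) p"
      by (rule germ_has_derivative[OF open_gap that F])
    also have "\<dots> = germ N p * inverse (germ sin p)"
      using that by (simp add: germ_mult[of _ "gap m"] germ_inverse[of _ "gap m"] N s meromorphic_on_inverse)
    finally show ?thesis .
  qed
  then show ?thesis using that primitive_meromorphic[OF open_gap F] by blast
qed

text \<open>
  For a pair \<open>s, k\<close> that behaves like \<open>sn c\<close>, \<open>cs c\<close>, possibly shifted in time.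
\<close>
lemma variation_of_constants:
  fixes s k A F Q :: "complex fls"
  assumes "fls_deriv s = k" "fls_deriv k = - fls_const (c\<^sup>2) * s"
    and "k * k + fls_const (c\<^sup>2) * (s * s) = 1"
    and "fls_deriv A = k * Q" "fls_deriv F = s * Q"
  shows "fls_deriv (fls_deriv (s * A - k * F)) = - fls_const (c\<^sup>2) * (s * A - k * F) + Q"
proof -
  have 1: "fls_deriv (s * A - k * F) = k * A + fls_const (c\<^sup>2) * s * F"
    by (simp add: assms(1,2,4,5) algebra_simps)
  have "fls_deriv (k * A + fls_const (c\<^sup>2) * s * F)
      = - fls_const (c\<^sup>2) * (s * A - k * F) + (k * k + fls_const (c\<^sup>2) * (s * s)) * Q"
    by (simp add: assms(1,2,4,5) algebra_simps)
  then show ?thesis unfolding 1 assms(3) by simp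
qed

definition oscillator_functions :: "complex \<Rightarrow> (complex \<Rightarrow> complex) set" where
  "oscillator_functions a = {\<lambda>t. u * cs a t + v * sn a t | u v. True}"

lemma oscillator_function_entire: "f \<in> oscillator_functions a \<Longrightarrow> f holomorphic_on UNIV"
  by (auto simp: oscillator_functions_def intro!: holomorphic_intros entire_cs entire_sn)

lemma germ_oscillator_function:
  "germ (\<lambda>t. u * cs a t + v * sn a t) p = fls_const u * germ (cs a) p + fls_const v * germ (sn a) p"
  by (simp add: germ_add[of _ UNIV] germ_scale[of _ UNIV] meromorphic_on_mult meromorphic_on_const
      elementary_meromorphic)

lemma oscillator_germ: "f \<in> oscillator_functions a \<Longrightarrow> oscillator a (germ f p)"
  by (auto simp: oscillator_functions_def germ_oscillator_function
      intro!: oscillator_add oscillator_scale oscillator_cs oscillator_sn)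

lemma oscillator_germ_ex: "oscillator a x \<Longrightarrow> \<exists>f\<in>oscillator_functions a. x = germ f p"
  using oscillator_span[of a x p] unfolding oscillator_functions_def
  by (auto simp: germ_oscillator_function[symmetric])

lemma particular_solution:
  assumes "p \<in> gap m" "f \<in> oscillator_functions a" "g \<in> oscillator_functions b"
  shows "\<exists>h. h meromorphic_on gap m \<and> (germ f p, germ g p, germ h p) \<in> ex2_solutions p a b c \<theta>"
proof -
  have fe: "f holomorphic_on UNIV" and ge: "g holomorphic_on UNIV"
    using assms oscillator_function_entire by blast+
  define M where "M = (\<lambda>t. 2 * \<theta> * (f t * g t))"
  have M: "M holomorphic_on UNIV" unfolding M_def by (intro holomorphic_intros fe ge)
  have gM: "germ M p = 2 * fls_const \<theta> * germ f p * germ g p"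
    unfolding M_def
    using germ_scale[of "\<lambda>t. f t * g t" UNIV p "2 * \<theta>"]
    by (simp add: germ_mult[of _ UNIV] entire_meromorphic fe ge meromorphic_on_mult
        flip: fls_const_mult_const)
  obtain A where A: "A meromorphic_on gap m"
    "fls_deriv (germ A p) = germ (\<lambda>t. cs c t * M t) p * inverse (germ sin p)"
    using gap_primitive_germ[of "\<lambda>t. cs c t * M t" m] assms(1) M entire_cs
    by (metis holomorphic_on_mult)
  obtain F where F: "F meromorphic_on gap m"
    "fls_deriv (germ F p) = germ (\<lambda>t. sn c t * M t) p * inverse (germ sin p)"
    using gap_primitive_germ[of "\<lambda>t. sn c t * M t" m] assms(1) M entire_sn
    by (metis holomorphic_on_mult)
  define Q where "Q = germ M p * inverse (germ sin p)"
  have dA: "fls_deriv (germ A p) = germ (cs c) p * Q" and dF: "fls_deriv (germ F p) = germ (sn c) p * Q"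
    unfolding A(2) F(2) Q_def
    by (simp_all add: germ_mult[of _ UNIV] entire_meromorphic M entire_cs entire_sn)
  define h where "h = (\<lambda>t. sn c t * A t - cs c t * F t)"
  have e: "sn c meromorphic_on gap m" "cs c meromorphic_on gap m" by (intro elementary_meromorphic)+
  have h: "germ h p = germ (sn c) p * germ A p - germ (cs c) p * germ F p"
    unfolding h_def using assms(1)
    by (simp add: germ_diff[of _ "gap m"] germ_mult[of _ "gap m"] meromorphic_on_mult e A F)
  have "fls_deriv (fls_deriv (germ h p)) = - fls_const (c\<^sup>2) * germ h p + Q"
    unfolding h
    by (rule variation_of_constants[OF germ_sn_deriv germ_cs_deriv germ_pythagoras dA dF])
  then have "(germ f p, germ g p, germ h p) \<in> ex2_solutions p a b c \<theta>"
    using assms oscillator_germ by (simp add: ex2.S_iff Q_def gM divide_inverse algebra_simps)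
  moreover have "h meromorphic_on gap m"
    unfolding h_def by (intro meromorphic_on_diff meromorphic_on_mult e A F)
  ultimately show ?thesis by blast
qed

lemma solution_extends_to_gap:
  assumes "p \<in> gap m" "(x, y, z) \<in> ex2_solutions p a b c \<theta>"
  obtains f g h where "f meromorphic_on gap m" "g meromorphic_on gap m" "h meromorphic_on gap m"
    "x = germ f p" "y = germ g p" "z = germ h p"
proof -
  have "oscillator a x" "oscillator b y" using assms(2) by (auto simp: ex2.S_iff)
  then obtain f g where f: "f \<in> oscillator_functions a" "x = germ f p"
    and g: "g \<in> oscillator_functions b" "y = germ g p"
    using oscillator_germ_ex by metis
  obtain h where h: "h meromorphic_on gap m" "(x, y, germ h p) \<in> ex2_solutions p a b c \<theta>"
    using particular_solution[OF assms(1) f(1) g(1)] f(2) g(2) by blast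
  have "oscillator c (z - germ h p)"
    using assms(2) h(2) by (simp add: ex2.S_iff oscillator_def algebra_simps)
  then obtain k where k: "k \<in> oscillator_functions c" "z - germ h p = germ k p"
    using oscillator_germ_ex by blast
  have km: "k meromorphic_on gap m" using k oscillator_function_entire entire_meromorphic by blast
  have "germ (\<lambda>t. h t + k t) p = germ h p + (z - germ h p)"
    using assms(1) h km k(2) by (simp add: germ_add[of _ "gap m"])
  then have z: "z = germ (\<lambda>t. h t + k t) p" by simp
  have "f meromorphic_on gap m" "g meromorphic_on gap m"
    using f g oscillator_function_entire entire_meromorphic by blast+
  then show ?thesis
    using meromorphic_on_add[OF h(1) km] f(2) g(2) z by (rule that)
qed

lemma continuation_gap:
  assumes "p \<in> gap m" "q \<in> gap m"
  shows "diff_correspondence p q (continuation (gap m) p q)"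
    and "total_on_solutions (ex2_solutions p a b c \<theta>) (continuation (gap m) p q)"
proof -
  show "diff_correspondence p q (continuation (gap m) p q)"
    by (rule continuation_correspondence[OF open_gap connected_gap assms])
  show "total_on_solutions (ex2_solutions p a b c \<theta>) (continuation (gap m) p q)"
    unfolding total_on_solutions_def
  proof clarify
    fix x y z assume "(x, y, z) \<in> ex2_solutions p a b c \<theta>"
    from solution_extends_to_gap[OF assms(1) this] obtain f g h where
      fgh: "f meromorphic_on gap m" "g meromorphic_on gap m" "h meromorphic_on gap m"
      and e: "x = germ f p" "y = germ g p" "z = germ h p" by blast
    show "\<exists>x' y' z'. (x, x') \<in> continuation (gap m) p q \<and> (y, y') \<in> continuation (gap m) p q \<and>
        (z, z') \<in> continuation (gap m) p q"
      unfolding e continuation_def using fgh by blast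
  qed
qed

section \<open>The loop around a single pole\<close>

lemma entire_factor:
  fixes N :: "complex \<Rightarrow> complex"
  assumes "N holomorphic_on UNIV" "N p = 0"
  obtains h where "h holomorphic_on UNIV" "\<And>t. N t = (t - p) * h t" "h p = deriv N p"
proof
  show "(\<lambda>z. if z = p then deriv N p else (N z - N p) / (z - p)) holomorphic_on UNIV"
    by (rule pole_lemma_open[OF assms(1) open_UNIV])
qed (auto simp: assms(2))

text \<open>
  The pole \<open>p = m \<pi>\<close> of \<open>1 / sin\<close> separates \<open>gap (m - 1)\<close> from \<open>gap m\<close>; the domain \<open>D\<close> is their union
  together with \<open>p\<close>, and it is again a slit plane.
\<close>
locale pole =
  fixes m :: int
begin

definition "p = complex_of_real (of_int m * pi)"
definition "D = slit_plane (of_int (m - 1) * pi) (of_int (m + 1) * pi)"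

lemma interval: "of_int (m - 1) * pi < of_int m * pi" "of_int m * pi < of_int (m + 1) * pi"
  "of_int (m - 1) * pi < of_int (m + 1) * pi"
  by simp_all

lemma D_gap: "D - {p} = gap m \<union> gap (m - 1)" and gap_D: "gap m \<subseteq> D" "gap (m - 1) \<subseteq> D"
  and p_D: "p \<in> D" and gap_p: "p \<notin> gap m" "p \<notin> gap (m - 1)" and gap_Int: "z \<in> gap m \<Longrightarrow> z \<in> gap (m - 1) \<Longrightarrow> Im z \<noteq> 0"
proof -
  define u v w where "u = of_int (m - 1) * pi" and "v = of_int m * pi" and "w = of_int (m + 1) * pi"
  have uvw: "u < v" "v < w" using interval by (simp_all only: u_def v_def w_def)
  have *: "D = slit_plane u w" "p = of_real v" "gap m = slit_plane v w" "gap (m - 1) = slit_plane u v"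
    by (simp_all add: D_def p_def gap_def u_def v_def w_def)
  show "D - {p} = gap m \<union> gap (m - 1)" "gap m \<subseteq> D" "gap (m - 1) \<subseteq> D" "p \<in> D"
    "p \<notin> gap m" "p \<notin> gap (m - 1)" "z \<in> gap m \<Longrightarrow> z \<in> gap (m - 1) \<Longrightarrow> Im z \<noteq> 0"
    unfolding * using uvw by (auto simp: slit_plane_def complex_eq_iff)
qed

lemma sin_factor:
  obtains h where "h holomorphic_on UNIV" "\<And>t. sin t = (t - p) * h t" "\<And>t. t \<in> D \<Longrightarrow> h t \<noteq> 0"
proof -
  have sp: "sin p = 0" unfolding p_def sin_eq_0 by blast
  have dp: "deriv sin p = cos p" by (auto intro!: DERIV_imp_deriv derivative_eq_intros)
  obtain h where h: "h holomorphic_on UNIV" "\<And>t. sin t = (t - p) * h t" "h p = deriv sin p"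
    using entire_factor[of sin p] sp holomorphic_on_sin by blast
  have "h t \<noteq> 0" if "t \<in> D" for t
  proof (cases "t = p")
    case True
    have "cos p \<noteq> 0" using sin_cos_squared_add[of p] sp by auto
    then show ?thesis using True h(3) dp by simp
  next
    case False
    then have "t \<in> gap m \<or> t \<in> gap (m - 1)" using that D_gap by blast
    then have "sin t \<noteq> 0" using sin_nonzero_gap by blast
    then show ?thesis using h(2)[of t] by auto
  qed
  then show ?thesis using that h by blast
qed

text \<open>
  The residue of \<open>1 / sin\<close> at \<open>p\<close> is not zero.
\<close>
lemma no_global_primitive_of_csc:
  assumes "\<And>z. z \<in> D - {p} \<Longrightarrow> (J has_field_derivative inverse (sin z)) (at z)"
  shows False
proof -
  obtain h where h: "h holomorphic_on UNIV" "\<And>t. sin t = (t - p) * h t" "\<And>t. t \<in> D \<Longrightarrow> h t \<noteq> 0"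
    using sin_factor by blast
  have "open D" unfolding D_def by (rule open_slit_plane)
  then obtain r where r: "r > 0" "cball p r \<subseteq> D" using p_D open_contains_cball by blast
  have sph: "path_image (circlepath p r) \<subseteq> D - {p}"
    using r by (auto simp: sphere_def cball_def subset_iff)
  have "(\<lambda>u. inverse (h u)) holomorphic_on cball p r"
    using h r by (intro holomorphic_intros) (auto intro: holomorphic_on_subset)
  then have "((\<lambda>u. inverse (h u) / (u - p)) has_contour_integral (2 * of_real pi * \<i> * inverse (h p))) (circlepath p r)"
    using r(1) by (intro Cauchy_integral_circlepath_simple) auto
  moreover have "((\<lambda>u. inverse (sin u)) has_contour_integral 0) (circlepath p r)"
    by (rule Cauchy_theorem_primitive[of "D - {p}" J])
      (use sph assms r in \<open>auto intro: has_field_derivative_at_within\<close>)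
  then have "((\<lambda>u. inverse (h u) / (u - p)) has_contour_integral 0) (circlepath p r)"
    by (rule has_contour_integral_eq) (simp add: h(2) divide_inverse)
  ultimately have "2 * of_real pi * \<i> * inverse (h p) = 0"
    using has_contour_integral_unique by blast
  then show False using h(3)[OF p_D] by simp
qed

text \<open>
  Primitives of \<open>1 / sin\<close> on the two gaps differ by a constant on each half-plane. If they are made to
  agree on the upper one, then they cannot agree on the lower one, as otherwise they would glue to a
  primitive around \<open>p\<close>.
\<close>
lemma csc_primitives:
  obtains I1 I2 \<kappa> where
    "\<And>z. z \<in> gap m \<Longrightarrow> (I1 has_field_derivative inverse (sin z)) (at z)"
    "\<And>z. z \<in> gap (m - 1) \<Longrightarrow> (I2 has_field_derivative inverse (sin z)) (at z)"
    "\<And>z. Im z > 0 \<Longrightarrow> I2 z = I1 z" "\<And>z. Im z < 0 \<Longrightarrow> I2 z = I1 z + \<kappa>" "\<kappa> \<noteq> 0"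
proof -
  have hol: "(\<lambda>z. inverse (sin z)) holomorphic_on gap k" for k
    using sin_nonzero_gap by (intro holomorphic_intros) auto
  obtain I1 where I1: "\<And>z. z \<in> gap m \<Longrightarrow> (I1 has_field_derivative inverse (sin z)) (at z)"
    using gap_primitive[OF hol] by blast
  obtain I0 where I0: "\<And>z. z \<in> gap (m - 1) \<Longrightarrow> (I0 has_field_derivative inverse (sin z)) (at z)"
    using gap_primitive[OF hol] by blast
  have const: "\<exists>e. \<forall>z\<in>H. I0 z - I1 z = e" if "convex H" "open H" "\<And>z. z \<in> H \<Longrightarrow> Im z \<noteq> 0" for H
  proof -
    have "((\<lambda>z. I0 z - I1 z) has_field_derivative 0) (at z)" if "z \<in> H" for z
      using DERIV_diff[OF I0 I1, of z] nonreal_in_gap \<open>\<And>z. z \<in> H \<Longrightarrow> Im z \<noteq> 0\<close> that by simp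
    then have "(\<lambda>z. I0 z - I1 z) constant_on H"
      using has_field_derivative_0_imp_constant_on[of H "\<lambda>z. I0 z - I1 z"] that(1,2) convex_connected by blast
    then show ?thesis by (simp add: constant_on_def)
  qed
  obtain e where e: "\<And>z. Im z > 0 \<Longrightarrow> I0 z - I1 z = e"
    using const[of "{z. Im z > 0}"] by (auto simp: convex_halfspace_Im_gt open_halfspace_Im_gt)
  obtain e' where e': "\<And>z. Im z < 0 \<Longrightarrow> I0 z - I1 z = e'"
    using const[of "{z. Im z < 0}"] by (auto simp: convex_halfspace_Im_lt open_halfspace_Im_lt)
  define I2 where "I2 = (\<lambda>z. I0 z - e)"
  have I2: "(I2 has_field_derivative inverse (sin z)) (at z)" if "z \<in> gap (m - 1)" for z
    unfolding I2_def using I0[OF that] by (auto intro!: derivative_eq_intros)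
  have up: "I2 z = I1 z" if "Im z > 0" for z using e[OF that] by (simp add: I2_def algebra_simps)
  have lo: "I2 z = I1 z + (e' - e)" if "Im z < 0" for z using e'[OF that] by (simp add: I2_def algebra_simps)
  have "e' - e \<noteq> 0"
  proof
    assume "e' - e = 0"
    then have same: "I2 z = I1 z" if "Im z \<noteq> 0" for z using up[of z] lo[of z] that by (cases "Im z > 0") auto
    define J where "J = (\<lambda>z. if z \<in> gap m then I1 z else I2 z)"
    have J1: "J z = I1 z" if "z \<in> gap m" for z using that by (simp add: J_def)
    have J2: "J z = I2 z" if "z \<in> gap (m - 1)" for z using that same gap_Int[of z] by (auto simp: J_def)
    have "(J has_field_derivative inverse (sin z)) (at z)" if "z \<in> D - {p}" for z
    proof (cases "z \<in> gap m")
      case True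
      have "eventually (\<lambda>w. w \<in> gap m) (nhds z)" using True open_gap by (intro eventually_nhds_in_open)
      then have "eventually (\<lambda>w. J w = I1 w) (nhds z)" by (rule eventually_mono) (rule J1)
      then show ?thesis using I1[OF True] DERIV_cong_ev[of z z J I1] by blast
    next
      case False
      then have z: "z \<in> gap (m - 1)" using that D_gap by blast
      have "eventually (\<lambda>w. w \<in> gap (m - 1)) (nhds z)" using z open_gap by (intro eventually_nhds_in_open)
      then have "eventually (\<lambda>w. J w = I2 w) (nhds z)" by (rule eventually_mono) (rule J2)
      then show ?thesis using I2[OF z] DERIV_cong_ev[of z z J I2] by blast
    qed
    then show False by (rule no_global_primitive_of_csc)
  qed
  then show ?thesis using that I1 I2 up lo by blast
qed

text \<open>
  Continuation along a loop around \<open>p\<close>: from \<open>q\<close> to the upper half-plane, through \<open>gap (m - 1)\<close> to the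
  lower half-plane, and back to \<open>q\<close> through \<open>gap m\<close>.
\<close>
definition loop :: "complex \<Rightarrow> (complex fls \<times> complex fls) set" where
  "loop q = continuation (gap m) q \<i> O continuation (gap (m - 1)) \<i> (- \<i>) O continuation (gap m) (- \<i>) q"

lemma i_gap: "\<i> \<in> gap k" "- \<i> \<in> gap k"
  by (rule nonreal_in_gap, simp)+

lemma loop_correspondence: "q \<in> gap m \<Longrightarrow> diff_correspondence q q (loop q)"
  unfolding loop_def by (intro diff_correspondence_comp[of _ \<i>] diff_correspondence_comp[of _ "- \<i>"] continuation_gap i_gap)

lemma loop_total:
  "q \<in> gap m \<Longrightarrow> total_on_solutions (ex2_solutions q a b c \<theta>) (loop q)"
  unfolding loop_def
  by (intro total_on_solutions_comp[of _ \<i>] total_on_solutions_comp[of _ "- \<i>"] continuation_gap i_gap)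

lemma loop_total_converse:
  "q \<in> gap m \<Longrightarrow> total_on_solutions (ex2_solutions q a b c \<theta>) ((loop q)\<inverse>)"
  unfolding loop_def converse_relcomp continuation_converse O_assoc
  by (intro total_on_solutions_comp[of _ \<i>] total_on_solutions_comp[of _ "- \<i>"] continuation_gap i_gap)

lemma loop_I:
  assumes f: "f meromorphic_on gap m" and g: "g meromorphic_on gap (m - 1)" and h: "h meromorphic_on gap m"
    and up: "\<And>z. Im z > 0 \<Longrightarrow> f z = g z" and lo: "\<And>z. Im z < 0 \<Longrightarrow> g z = h z"
  shows "(germ f q, germ h q) \<in> loop q"
proof -
  have "eventually (\<lambda>z. Im z > 0) (nhds \<i>)" "eventually (\<lambda>z. Im z < 0) (nhds (- \<i>))"
    using eventually_nhds_in_open[OF open_halfspace_Im_gt[of 0], of \<i>]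
      eventually_nhds_in_open[OF open_halfspace_Im_lt[of 0], of "- \<i>"] by simp_all
  then have "eventually (\<lambda>z. f z = g z) (at \<i>)" "eventually (\<lambda>z. g z = h z) (at (- \<i>))"
    using up lo by (auto simp: eventually_at_filter elim: eventually_mono)
  then have "germ f \<i> = germ g \<i>" "germ g (- \<i>) = germ h (- \<i>)"
    by (auto intro: laurent_expansion_cong)
  then have "(germ f q, germ g \<i>) \<in> continuation (gap m) q \<i>"
    "(germ g \<i>, germ h (- \<i>)) \<in> continuation (gap (m - 1)) \<i> (- \<i>)"
    "(germ h (- \<i>), germ h q) \<in> continuation (gap m) (- \<i>) q"
    unfolding continuation_def using f g h by (metis (mono_tags, lifting) mem_Collect_eq)+
  then show ?thesis unfolding loop_def by blast
qed

lemma loop_entire: "f holomorphic_on UNIV \<Longrightarrow> (germ f q, germ f q) \<in> loop q"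
  by (rule loop_I) (auto intro: entire_meromorphic)

text \<open>
  Write \<open>N = N p + (N - N p)\<close>. The second part divided by \<open>sin\<close> has no pole at \<open>p\<close>, so its primitive on \<open>D\<close>
  returns unchanged from the loop; the first part contributes \<open>N p\<close> times the jump of the primitive of
  \<open>1 / sin\<close>, a non-zero constant that does not depend on \<open>N\<close>.
\<close>
lemma monodromy_of_primitive:
  assumes q: "q \<in> gap m"
  obtains \<kappa> where "\<kappa> \<noteq> 0"
    "\<And>N. N holomorphic_on UNIV \<Longrightarrow> \<exists>F. fls_deriv F = germ N q * inverse (germ sin q) \<and>
        (F, F + fls_const (N p * \<kappa>)) \<in> loop q"
proof -
  obtain I1 I2 \<kappa> where
    I1: "\<And>z. z \<in> gap m \<Longrightarrow> (I1 has_field_derivative inverse (sin z)) (at z)"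
    and I2: "\<And>z. z \<in> gap (m - 1) \<Longrightarrow> (I2 has_field_derivative inverse (sin z)) (at z)"
    and I12: "\<And>z. Im z > 0 \<Longrightarrow> I2 z = I1 z" "\<And>z. Im z < 0 \<Longrightarrow> I2 z = I1 z + \<kappa>" and "\<kappa> \<noteq> 0"
    using csc_primitives by blast
  have s: "sin meromorphic_on A" for A by (intro entire_meromorphic holomorphic_intros)
  have mI: "I1 meromorphic_on gap m" "I2 meromorphic_on gap (m - 1)"
    using primitive_meromorphic[OF open_gap I1] primitive_meromorphic[OF open_gap I2] by auto
  have "\<exists>F. fls_deriv F = germ N q * inverse (germ sin q) \<and> (F, F + fls_const (N p * \<kappa>)) \<in> loop q"
    if N: "N holomorphic_on UNIV" for N
  proof -
    obtain h where h: "h holomorphic_on UNIV" "\<And>t. sin t = (t - p) * h t" "\<And>t. t \<in> D \<Longrightarrow> h t \<noteq> 0"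
      using sin_factor by blast
    have "(\<lambda>t. N t - N p) holomorphic_on UNIV" by (intro holomorphic_intros N)
    then obtain k where k: "k holomorphic_on UNIV" "\<And>t. N t - N p = (t - p) * k t"
      by (rule entire_factor[of _ p]) (simp, blast)
    have "(\<lambda>t. k t * inverse (h t)) holomorphic_on D"
      using h k by (intro holomorphic_intros) (auto intro: holomorphic_on_subset)
    then obtain H where H: "\<And>z. z \<in> D \<Longrightarrow> (H has_field_derivative k z * inverse (h z)) (at z)"
      using slit_plane_primitive[OF interval(3)] unfolding D_def by blast
    define F1 F2 where "F1 = (\<lambda>z. N p * I1 z + H z)" and "F2 = (\<lambda>z. N p * I2 z + H z)"
    have mH: "H meromorphic_on gap m" "H meromorphic_on gap (m - 1)"
      using primitive_meromorphic[OF _ H] gap_D open_slit_plane meromorphic_on_subset unfolding D_def by metis+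
    have mF: "F1 meromorphic_on gap m" "F2 meromorphic_on gap (m - 1)" "(\<lambda>z. F1 z + N p * \<kappa>) meromorphic_on gap m"
      unfolding F1_def F2_def by (intro meromorphic_on_add meromorphic_on_mult meromorphic_on_const mI mH)+
    have "(germ F1 q, germ (\<lambda>z. F1 z + N p * \<kappa>) q) \<in> loop q"
      by (rule loop_I[OF mF]) (simp_all add: F1_def F2_def I12 algebra_simps)
    then have "(germ F1 q, germ F1 q + fls_const (N p * \<kappa>)) \<in> loop q"
      using germ_add[OF mF(1) meromorphic_on_const q] by (simp add: germ_const)
    moreover have "fls_deriv (germ F1 q) = germ N q * inverse (germ sin q)"
    proof -
      have "(F1 has_field_derivative N z * inverse (sin z)) (at z)" if z: "z \<in> gap m" for z
      proof -
        have "z \<noteq> p" using z gap_p by auto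
        have "N p * inverse (sin z) + k z * inverse (h z) = N z * inverse (sin z)"
        proof -
          define e where "e = z - p"
          have "N z = N p + e * k z" "sin z = e * h z"
            using k(2)[of z] h(2)[of z] by (simp_all add: e_def algebra_simps)
          then have "N z * inverse (sin z) = N p * inverse (sin z) + (e * inverse e) * (k z * inverse (h z))"
            by (simp add: algebra_simps)
          moreover have "e \<noteq> 0" using \<open>z \<noteq> p\<close> by (simp add: e_def)
          ultimately show ?thesis by simp
        qed
        moreover have "z \<in> D" using z gap_D by blast
        ultimately show ?thesis
          unfolding F1_def using DERIV_add[OF DERIV_cmult[OF I1[OF z], of "N p"] H[OF \<open>z \<in> D\<close>]] by simp
      qed
      then have "fls_deriv (germ F1 q) = germ (\<lambda>z. N z * inverse (sin z)) q"
        by (rule germ_has_derivative[OF open_gap q])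
      also have "\<dots> = germ N q * inverse (germ sin q)"
        using q by (simp add: germ_mult[of _ "gap m"] germ_inverse[of _ "gap m"] entire_meromorphic N s meromorphic_on_inverse)
      finally show ?thesis .
    qed
    ultimately show ?thesis by blast
  qed
  then show ?thesis using that \<open>\<kappa> \<noteq> 0\<close> by blast
qed

end

section \<open>The shift by a period\<close>

lemma germ_translate:
  assumes "f holomorphic_on UNIV"
  shows "germ f (p + T) = germ (\<lambda>t. f (t + T)) p"
proof -
  have "(\<lambda>w. f (p + T + w)) has_laurent_expansion germ f (p + T)"
    by (rule has_germ[of _ UNIV]) (auto intro: entire_meromorphic assms)
  then have "germ (\<lambda>t. f (t + T)) p = germ f (p + T)"
    by (intro laurent_expansion_eqI) (simp add: add_ac)
  then show ?thesis by simp
qed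

lemma gap_shift: "z \<in> gap m \<Longrightarrow> z + 2 * of_real pi \<in> gap (m + 2)"
  by (auto simp: gap_def slit_plane_def algebra_simps)

lemma germ_ex_period: "germ (ex 1) (p + 2 * of_real pi) = germ (ex 1) p"
proof -
  have "ex 1 (t + 2 * of_real pi) = ex 1 t" for t
  proof -
    have "ex 1 (t + 2 * of_real pi) = ex 1 t * exp (\<i> * (of_real pi * 2))"
      by (simp add: ex_def distrib_left exp_add mult_ac)
    then show ?thesis by simp
  qed
  then show ?thesis by (simp add: germ_translate[OF entire_ex])
qed

lemma ex2_solutions_period: "ex2_solutions (p + 2 * of_real pi) a b c \<theta> = ex2_solutions p a b c \<theta>"
  using germ_sin[of "p + 2 * of_real pi"] germ_sin[of p] by (simp add: ex2_solutions_def germ_ex_period)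

lemma oscillator_function_translate:
  "f \<in> oscillator_functions a \<Longrightarrow> (\<lambda>t. f (t + T)) \<in> oscillator_functions a"
proof -
  assume "f \<in> oscillator_functions a"
  then obtain u v where f: "f = (\<lambda>t. u * cs a t + v * sn a t)" by (auto simp: oscillator_functions_def)
  have "f (t + T) = (u * cs a T + v * sn a T) * cs a t + (v * cs a T - u * a\<^sup>2 * sn a T) * sn a t" for t
    by (cases "a = 0") (simp_all add: f cs_def sn_def cos_add sin_add field_simps power2_eq_square)
  then show ?thesis unfolding oscillator_functions_def by blast
qed

lemma cs_oscillator_function: "cs a \<in> oscillator_functions a"
  and sn_oscillator_function: "sn a \<in> oscillator_functions a"
  and ex_oscillator_function: "ex a \<in> oscillator_functions a" "ex (- a) \<in> oscillator_functions a"
proof -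
  have "cs a = (\<lambda>t. 1 * cs a t + 0 * sn a t)" "sn a = (\<lambda>t. 0 * cs a t + 1 * sn a t)"
    "ex a = (\<lambda>t. 1 * cs a t + \<i> * a * sn a t)" "ex (- a) = (\<lambda>t. 1 * cs a t + \<i> * (- a) * sn a t)"
    using ex_cs_sn[of a] ex_cs_sn[of "- a"] by (simp_all add: fun_eq_iff cs_minus sn_minus)
  then show "cs a \<in> oscillator_functions a" "sn a \<in> oscillator_functions a"
    "ex a \<in> oscillator_functions a" "ex (- a) \<in> oscillator_functions a"
    unfolding oscillator_functions_def by blast+
qed

lemma entire_germ_eq:
  assumes "f holomorphic_on UNIV" "g holomorphic_on UNIV" "germ f p = germ g p"
  shows "f t = g t"
proof -
  have "germ f t = germ g t"
    by (rule meromorphic_germ_identity[of UNIV p]) (use assms in \<open>auto intro: entire_meromorphic\<close>)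
  then have "germ (\<lambda>z. f z - g z) t = 0"
    by (simp add: germ_diff[of _ UNIV] entire_meromorphic assms)
  moreover have "(\<lambda>z. f z - g z) holomorphic_on UNIV" by (intro holomorphic_intros assms)
  ultimately have ev: "eventually (\<lambda>z. f z - g z = 0) (at t)"
    using has_laurent_expansion_eventually_zero_iff[OF has_germ[of "\<lambda>z. f z - g z" UNIV t]]
    by (simp add: entire_meromorphic)
  have "continuous_on UNIV (\<lambda>z. f z - g z)"
    by (intro holomorphic_on_imp_continuous_on holomorphic_intros assms)
  then have "((\<lambda>z. f z - g z) \<longlongrightarrow> f t - g t) (at t)"
    by (simp add: continuous_on_eq_continuous_at isCont_def)
  moreover have "((\<lambda>z. f z - g z) \<longlongrightarrow> 0) (at t)" using ev by (rule tendsto_eventually)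
  ultimately have "f t - g t = 0" by (rule tendsto_unique[rotated]) simp
  then show ?thesis by simp
qed

context ex2
begin

definition forcing :: "complex fls" where
  "forcing = 2 * (fls_const \<theta> / germ sin t0)"

lemma S_forcing: "(x, y, z) \<in> S \<Longrightarrow> fls_deriv (fls_deriv z) = - (fls_const (c\<^sup>2) * z) + forcing * x * y"
  by (simp add: S_iff forcing_def)

text \<open>
  Continuation through the upper half-plane from \<open>t0\<close> to \<open>t0 + 2 \<pi>\<close>. The coefficients of the system are
  periodic, so the Laurent series of the solutions at the two points are the same, and the continuation is an
  automorphism of \<open>L\<close>.
\<close>
lemma shift_automorphism:
  assumes "sin t0 \<noteq> 0"
  shows "\<exists>\<sigma>\<in>G. \<forall>f. f holomorphic_on UNIV \<longrightarrow> germ f t0 \<in> L \<longrightarrow> \<sigma> (germ f t0) = germ (\<lambda>t. f (t + 2 * of_real pi)) t0"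
proof -
  obtain m where m: "t0 \<in> gap m" using gap_exists[OF assms] by blast
  define t1 where "t1 = t0 + 2 * of_real pi"
  have t1: "t1 \<in> gap (m + 2)" unfolding t1_def using m by (rule gap_shift)
  have i: "\<i> \<in> gap k" for k by (rule nonreal_in_gap) simp
  define R where "R = continuation (gap m) t0 \<i> O continuation (gap (m + 2)) \<i> t1"
  have "diff_correspondence t0 t1 R"
    unfolding R_def by (intro diff_correspondence_comp[of _ \<i>] continuation_gap m t1 i)
  \<comment> \<open>The two base points enter a correspondence only through the germs of \<open>exp (\<i> t)\<close>, which agree at \<open>t0\<close>
    and \<open>t1\<close>.\<close>
  then have R: "diff_correspondence t0 t0 R"
    unfolding diff_correspondence_def t1_def germ_ex_period .
  have tot: "total_on_solutions S R"
    unfolding R_def by (intro total_on_solutions_comp[of _ \<i>] continuation_gap m t1 i)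
  have "total_on_solutions (ex2_solutions t1 a b c \<theta>) (R\<inverse>)"
    unfolding R_def converse_relcomp continuation_converse
    by (intro total_on_solutions_comp[of _ \<i>] continuation_gap m t1 i)
  then have tot': "total_on_solutions S (R\<inverse>)" by (simp add: t1_def ex2_solutions_period)
  obtain \<sigma> where \<sigma>: "\<sigma> \<in> G" "\<And>x. x \<in> L \<Longrightarrow> (x, \<sigma> x) \<in> R"
    using automorphism_of_correspondence[OF R tot tot'] by blast
  have "\<sigma> (germ f t0) = germ (\<lambda>t. f (t + 2 * of_real pi)) t0" if f: "f holomorphic_on UNIV" "germ f t0 \<in> L" for f
  proof -
    have "(germ f t0, germ f t1) \<in> R"
      unfolding R_def continuation_def using entire_meromorphic[OF f(1)] by blast
    then have "\<sigma> (germ f t0) = germ f t1"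
      using \<sigma>(2)[OF f(2)] diff_correspondence.R_unique[OF R] by blast
    then show ?thesis by (simp add: t1_def germ_translate[OF f(1)])
  qed
  then show ?thesis using \<sigma>(1) by blast
qed

text \<open>
  By variation of constants around the pole \<open>p\<close>, the solution is \<open>z = s A - k F\<close> where \<open>s = sn c (t - p)\<close>,
  \<open>k = cs c (t - p)\<close>, and \<open>A, F\<close> are primitives of \<open>k\<close> and of \<open>s\<close> times the forcing term. As \<open>s p = 0\<close>
  and \<open>k p = 1\<close>, the loop leaves \<open>F\<close> unchanged and adds to \<open>A\<close> a multiple of \<open>f p * g p\<close>.
\<close>
lemma monodromy_automorphism:
  assumes "sin t0 \<noteq> 0"
  shows "\<exists>\<mu> \<kappa> p. \<mu> \<in> G \<and> \<kappa> \<noteq> 0 \<and> (\<forall>w x. oscillator w x \<longrightarrow> x \<in> L \<longrightarrow> \<mu> x = x) \<and>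
    (\<forall>f g z. f \<in> oscillator_functions a \<longrightarrow> g \<in> oscillator_functions b \<longrightarrow> (germ f t0, germ g t0, z) \<in> S \<longrightarrow>
       \<mu> z = z + fls_const (2 * \<theta> * \<kappa> * (f p * g p)) * germ (\<lambda>t. sn c (t - p)) t0)"
proof -
  obtain m where m: "t0 \<in> gap m" using gap_exists[OF assms] by blast
  interpret pole m .
  note R = loop_correspondence[OF m]
  interpret R: diff_correspondence t0 t0 "loop t0" by (rule R)
  obtain \<mu> where \<mu>: "\<mu> \<in> G" "\<And>x. x \<in> L \<Longrightarrow> (x, \<mu> x) \<in> loop t0"
    using automorphism_of_correspondence[OF R loop_total[OF m] loop_total_converse[OF m]] by blast
  have \<mu>_eq: "\<mu> x = x'" if "x \<in> L" "(x, x') \<in> loop t0" for x x'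
    using R.R_unique[OF \<mu>(2)[OF that(1)] that(2)] .
  have fixed: "\<mu> x = x" if x: "oscillator w x" "x \<in> L" for w x
  proof -
    obtain f where f: "f \<in> oscillator_functions w" "x = germ f t0"
      using oscillator_germ_ex[OF x(1)] by blast
    show ?thesis
      using loop_entire[OF oscillator_function_entire[OF f(1)]] f(2) by (intro \<mu>_eq x(2)) simp
  qed
  obtain \<kappa> where \<kappa>: "\<kappa> \<noteq> 0"
    and prim: "\<And>N. N holomorphic_on UNIV \<Longrightarrow> \<exists>F. fls_deriv F = germ N t0 * inverse (germ sin t0) \<and>
        (F, F + fls_const (N p * \<kappa>)) \<in> loop t0"
    using monodromy_of_primitive[OF m] by blast
  define s where "s = (\<lambda>t. sn c (t - p))"
  define k where "k = (\<lambda>t. cs c (t - p))"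
  have s_osc: "s \<in> oscillator_functions c" and k_osc: "k \<in> oscillator_functions c"
    using oscillator_function_translate[OF sn_oscillator_function, of c "- p"]
      oscillator_function_translate[OF cs_oscillator_function, of c "- p"] by (simp_all add: s_def k_def)
  have se: "s holomorphic_on UNIV" and ke: "k holomorphic_on UNIV"
    using oscillator_function_entire s_osc k_osc by blast+
  have sk: "s p = 0" "k p = 1" by (simp_all add: s_def k_def sn_def cs_def)
  have ds: "fls_deriv (germ s t0) = germ k t0"
  proof (rule germ_has_derivative[OF open_UNIV])
    show "(s has_field_derivative k t) (at t)" for t
      using DERIV_shift[of "sn c" "k t" t "- p"] has_derivative_sn[of c "t - p"] by (simp add: s_def k_def)
  qed simp
  have dk: "fls_deriv (germ k t0) = - fls_const (c\<^sup>2) * germ s t0"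
    using oscillator_germ[OF s_osc, of t0] ds by (simp add: oscillator_def)
  have py: "germ k t0 * germ k t0 + fls_const (c\<^sup>2) * (germ s t0 * germ s t0) = 1"
  proof -
    have "germ (\<lambda>t. k t * k t + c\<^sup>2 * (s t * s t)) t0 = germ k t0 * germ k t0 + fls_const (c\<^sup>2) * (germ s t0 * germ s t0)"
      by (simp add: germ_add[of _ UNIV] germ_mult[of _ UNIV] germ_const meromorphic_on_mult
          meromorphic_on_const entire_meromorphic se ke)
    moreover have "(\<lambda>t. k t * k t + c\<^sup>2 * (s t * s t)) = (\<lambda>_. 1)"
      by (simp add: s_def k_def cs_sn_pythagoras)
    ultimately show ?thesis using germ_const[of 1 t0] by simp
  qed
  have main: "\<mu> z = z + fls_const (2 * \<theta> * \<kappa> * (f p * g p)) * germ s t0"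
    if f: "f \<in> oscillator_functions a" and g: "g \<in> oscillator_functions b" and z: "(germ f t0, germ g t0, z) \<in> S" for f g z
  proof -
    have fe: "f holomorphic_on UNIV" and ge: "g holomorphic_on UNIV"
      using f g oscillator_function_entire by blast+
    define M where "M = (\<lambda>t. 2 * \<theta> * (f t * g t))"
    have M: "M holomorphic_on UNIV" unfolding M_def by (intro holomorphic_intros fe ge)
    have gM: "germ M t0 = 2 * fls_const \<theta> * germ f t0 * germ g t0"
      unfolding M_def
      using germ_scale[of "\<lambda>t. f t * g t" UNIV t0 "2 * \<theta>"]
      by (simp add: germ_mult[of _ UNIV] entire_meromorphic fe ge meromorphic_on_mult
          flip: fls_const_mult_const)
    obtain A where A: "fls_deriv A = germ (\<lambda>t. k t * M t) t0 * inverse (germ sin t0)"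
      "(A, A + fls_const (k p * M p * \<kappa>)) \<in> loop t0"
      using prim[of "\<lambda>t. k t * M t"] M ke holomorphic_on_mult by blast
    obtain F where F: "fls_deriv F = germ (\<lambda>t. s t * M t) t0 * inverse (germ sin t0)"
      "(F, F + fls_const (s p * M p * \<kappa>)) \<in> loop t0"
      using prim[of "\<lambda>t. s t * M t"] M se holomorphic_on_mult by blast
    define Q where "Q = germ M t0 * inverse (germ sin t0)"
    have dA: "fls_deriv A = germ k t0 * Q" and dF: "fls_deriv F = germ s t0 * Q"
      unfolding A(1) F(1) Q_def
      by (simp_all add: germ_mult[of _ UNIV] entire_meromorphic M ke se)
    define w where "w = germ s t0 * A - germ k t0 * F"
    have "fls_deriv (fls_deriv w) = - fls_const (c\<^sup>2) * w + Q"
      unfolding w_def by (rule variation_of_constants[OF ds dk py dA dF])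
    then have wS: "(germ f t0, germ g t0, w) \<in> S"
      using f g oscillator_germ by (simp add: S_iff Q_def gM divide_inverse algebra_simps)
    then have wL: "w \<in> L" using B_I(3) B_in_L by blast
    have zL: "z \<in> L" using z B_I(3) B_in_L by blast
    have zw: "oscillator c (z - w)"
      using z wS by (simp add: S_iff oscillator_def algebra_simps)
    have "(w, germ s t0 * (A + fls_const (k p * M p * \<kappa>)) - germ k t0 * (F + fls_const (s p * M p * \<kappa>))) \<in> loop t0"
      unfolding w_def by (intro R.R_diff R.R_mult A(2) F(2) loop_entire se ke)
    moreover have "germ s t0 * (A + fls_const (k p * M p * \<kappa>)) - germ k t0 * (F + fls_const (s p * M p * \<kappa>))
        = w + fls_const (2 * \<theta> * \<kappa> * (f p * g p)) * germ s t0"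
      by (simp add: w_def sk M_def algebra_simps)
    ultimately have "\<mu> w = w + fls_const (2 * \<theta> * \<kappa> * (f p * g p)) * germ s t0"
      using \<mu>_eq[OF wL] by simp
    moreover have "\<mu> (z - w) = z - w" by (rule fixed[OF zw L_diff[OF zL wL]])
    then have "\<mu> z = \<mu> w + (z - w)" using G_diff[OF \<mu>(1) zL wL] by (simp add: algebra_simps)
    ultimately show ?thesis by simp
  qed
  show ?thesis
    using \<mu>(1) \<kappa> fixed main unfolding s_def
    by (intro exI[of _ \<mu>] exI[of _ \<kappa>] exI[of _ p] conjI allI impI)
qed

end

section \<open>Orbits of triangular automorphisms\<close>

context ex2
begin

text \<open>
  The shift by a period is diagonal on \<open>exp (\<i> w t)\<close>, \<open>exp (-\<i> w t)\<close>, and for \<open>w = 0\<close> it is triangular on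
  \<open>1, t\<close>; the loop around a pole is the identity. This covers all these cases.
\<close>
definition triangular_on :: "complex set \<Rightarrow> (complex fls \<Rightarrow> complex fls) \<Rightarrow> complex \<Rightarrow> bool" where
  "triangular_on \<Lambda> \<sigma> w \<longleftrightarrow> (\<exists>x y l m \<nu>. l \<in> \<Lambda> \<and> m \<in> \<Lambda> \<and> oscillator w x \<and> oscillator w y \<and>
     (\<forall>v. oscillator w v \<longrightarrow> (\<exists>e f. v = fls_const e * x + fls_const f * y)) \<and>
     \<sigma> x = fls_const (epi l 1) * x \<and> \<sigma> y = fls_const (epi m 1) * y + fls_const \<nu> * x)"

lemma triangular_onI:
  assumes "l \<in> \<Lambda>" "m \<in> \<Lambda>" "oscillator w x" "oscillator w y"
    and "\<And>v. oscillator w v \<Longrightarrow> \<exists>e f. v = fls_const e * x + fls_const f * y"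
    and "\<sigma> x = fls_const (epi l 1) * x" "\<sigma> y = fls_const (epi m 1) * y + fls_const \<nu> * x"
  shows "triangular_on \<Lambda> \<sigma> w"
  unfolding triangular_on_def
  by (rule exI[of _ x], rule exI[of _ y], rule exI[of _ l], rule exI[of _ m], rule exI[of _ \<nu>])
    (intro conjI allI impI assms)

lemma oscillator_exp_poly_orbit:
  assumes \<Lambda>: "torsion_free_exponents \<Lambda>" and \<sigma>: "\<sigma> \<in> G" and tri: "triangular_on \<Lambda> \<sigma> w"
    and L: "\<And>y. oscillator w y \<Longrightarrow> y \<in> L" and v: "oscillator w v"
  shows "exp_poly_orbit \<Lambda> \<sigma> v"
proof -
  obtain x y l m \<nu> where *: "l \<in> \<Lambda>" "m \<in> \<Lambda>" "oscillator w x" "oscillator w y"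
    "\<sigma> x = fls_const (epi l 1) * x" "\<sigma> y = fls_const (epi m 1) * y + fls_const \<nu> * x"
    and span: "\<And>v. oscillator w v \<Longrightarrow> \<exists>e f. v = fls_const e * x + fls_const f * y"
    using tri unfolding triangular_on_def by blast
  have xyL: "x \<in> L" "y \<in> L" using L * by auto
  have x: "exp_poly_orbit \<Lambda> \<sigma> x" by (rule exp_poly_orbit_eigenvector[OF \<Lambda> \<sigma> xyL(1) *(1,5)])
  have "exp_poly_orbit \<Lambda> \<sigma> (\<sigma> y - fls_const (epi m 1) * y)"
    using exp_poly_orbit_scale[OF \<Lambda> \<sigma> xyL(1) x, of \<nu>] by (simp add: *(6))
  then have y: "exp_poly_orbit \<Lambda> \<sigma> y" by (rule exp_poly_orbit_triangular[OF \<Lambda> \<sigma> xyL(2) *(2)])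
  obtain e f where "v = fls_const e * x + fls_const f * y" using span[OF v] by blast
  then show ?thesis
    using exp_poly_orbit_add[OF \<sigma> L_mult[OF const_L xyL(1)] L_mult[OF const_L xyL(2)]
        exp_poly_orbit_scale[OF \<Lambda> \<sigma> xyL(1) x] exp_poly_orbit_scale[OF \<Lambda> \<sigma> xyL(2) y]] by simp
qed

lemma solution_exists:
  assumes "sin t0 \<noteq> 0" "oscillator a x" "oscillator b y"
  shows "\<exists>z. (x, y, z) \<in> S"
proof -
  obtain m where m: "t0 \<in> gap m" using gap_exists[OF assms(1)] by blast
  obtain f g where "f \<in> oscillator_functions a" "x = germ f t0" "g \<in> oscillator_functions b" "y = germ g t0"
    using oscillator_germ_ex assms(2,3) by metis
  then show ?thesis using particular_solution[OF m] by blast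
qed

text \<open>
  The \<open>z\<close>-components are treated as a bilinear function of \<open>x\<close> and \<open>y\<close> modulo homogeneous solutions, and the
  triangular bases for \<open>x\<close> and \<open>y\<close> are multiplied.
\<close>
lemma solution_orbits:
  assumes t0: "sin t0 \<noteq> 0" and \<Lambda>: "torsion_free_exponents \<Lambda>" and \<sigma>: "\<sigma> \<in> G"
    and tri: "triangular_on \<Lambda> \<sigma> a" "triangular_on \<Lambda> \<sigma> b" "triangular_on \<Lambda> \<sigma> c"
    and v: "v \<in> B"
  shows "exp_poly_orbit \<Lambda> \<sigma> v"
proof -
  define Q where "Q = (\<lambda>x y. \<forall>z. (x, y, z) \<in> S \<longrightarrow> exp_poly_orbit \<Lambda> \<sigma> z)"
  have c: "exp_poly_orbit \<Lambda> \<sigma> w" if "oscillator c w" for w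
    by (rule oscillator_exp_poly_orbit[OF \<Lambda> \<sigma> tri(3) oscillator_in_L(3) that])
  have SL: "z \<in> L" if "(x, y, z) \<in> S" for x y z using that B_I(3) B_in_L by blast
  note add = exp_poly_orbit_add[OF \<sigma>] and scale = exp_poly_orbit_scale[OF \<Lambda> \<sigma>]
  have Q0: "Q x 0" "Q 0 y" for x y
    unfolding Q_def by (auto simp: S_iff oscillator_def intro!: c)
  have comb: "exp_poly_orbit \<Lambda> \<sigma> z"
    if H: "z \<in> L" "z1 \<in> L" "z2 \<in> L" "exp_poly_orbit \<Lambda> \<sigma> z1" "exp_poly_orbit \<Lambda> \<sigma> z2"
      "oscillator c (z - (fls_const e * z1 + fls_const f * z2))" for e f z z1 z2
  proof -
    have "exp_poly_orbit \<Lambda> \<sigma> (fls_const e * z1 + fls_const f * z2)"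
      using H by (intro add scale L_mult const_L)
    from add[OF _ _ this c[OF H(6)]] show ?thesis
      using H(1-3) by (simp add: L_add L_mult L_diff const_L)
  qed
  have Ql: "Q (fls_const e * x + fls_const f * x') y"
    if H: "oscillator a x" "oscillator a x'" "oscillator b y" "Q x y" "Q x' y" for e f x x' y
    unfolding Q_def
  proof (intro allI impI)
    fix z assume z: "(fls_const e * x + fls_const f * x', y, z) \<in> S"
    obtain z1 z2 where z12: "(x, y, z1) \<in> S" "(x', y, z2) \<in> S" using solution_exists[OF t0] H by blast
    have "oscillator c (z - (fls_const e * z1 + fls_const f * z2))"
      by (simp add: oscillator_def S_forcing[OF z] S_forcing[OF z12(1)] S_forcing[OF z12(2)] algebra_simps
          del: fls_const_mult_const)
    then show "exp_poly_orbit \<Lambda> \<sigma> z"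
      using H(4,5) z12 SL[OF z] SL[OF z12(1)] SL[OF z12(2)] unfolding Q_def by (blast intro: comb)
  qed
  have Qr: "Q x (fls_const e * y + fls_const f * y')"
    if H: "oscillator a x" "oscillator b y" "oscillator b y'" "Q x y" "Q x y'" for e f x y y'
    unfolding Q_def
  proof (intro allI impI)
    fix z assume z: "(x, fls_const e * y + fls_const f * y', z) \<in> S"
    obtain z1 z2 where z12: "(x, y, z1) \<in> S" "(x, y', z2) \<in> S" using solution_exists[OF t0] H by blast
    have "oscillator c (z - (fls_const e * z1 + fls_const f * z2))"
      by (simp add: oscillator_def S_forcing[OF z] S_forcing[OF z12(1)] S_forcing[OF z12(2)] algebra_simps
          del: fls_const_mult_const)
    then show "exp_poly_orbit \<Lambda> \<sigma> z"
      using H(4,5) z12 SL[OF z] SL[OF z12(1)] SL[OF z12(2)] unfolding Q_def by (blast intro: comb)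
  qed
  \<comment> \<open>Subtracting from \<open>\<sigma> z\<close> the multiple of \<open>z\<close> by the product of the two eigenvalues leaves solutions
    with smaller \<open>x\<close> or \<open>y\<close>, plus a homogeneous solution.\<close>
  have Qt: "Q x y"
    if H: "oscillator a x" "oscillator b y" "oscillator a r" "oscillator b r'" "l \<in> \<Lambda>" "l' \<in> \<Lambda>"
      "\<sigma> x = fls_const (epi l 1) * x + r" "\<sigma> y = fls_const (epi l' 1) * y + r'" "Q x r'" "Q r y" "Q r r'"
    for x y r r' l l'
    unfolding Q_def
  proof (intro allI impI)
    fix z assume z: "(x, y, z) \<in> S"
    obtain z1 z2 z3 where zs: "(x, r', z1) \<in> S" "(r, y, z2) \<in> S" "(r, r', z3) \<in> S"
      using solution_exists[OF t0 H(1,4)] solution_exists[OF t0 H(3,2)] solution_exists[OF t0 H(3,4)] by blast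
    note zL = SL[OF z] SL[OF zs(1)] SL[OF zs(2)] SL[OF zs(3)] G_in[OF \<sigma> SL[OF z]]
    define e e' where "e = epi l 1" and "e' = epi l' 1"
    have ee: "epi (l + l') 1 = e * e'" by (simp add: e_def e'_def exp_add[symmetric] algebra_simps)
    define w where "w = (fls_const e * z1 + fls_const e' * z2) + z3"
    have \<sigma>z: "(fls_const e * x + r, fls_const e' * y + r', \<sigma> z) \<in> S"
      using G_S[OF \<sigma> z] H(7,8) by (simp add: e_def e'_def)
    have "oscillator c ((\<sigma> z - fls_const (epi (l + l') 1) * z) - w)"
      unfolding ee w_def fls_const_mult_const[symmetric]
      by (simp add: oscillator_def S_forcing[OF z] S_forcing[OF \<sigma>z] S_forcing[OF zs(1)]
          S_forcing[OF zs(2)] S_forcing[OF zs(3)] algebra_simps del: fls_const_mult_const)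
    then have *: "exp_poly_orbit \<Lambda> \<sigma> ((\<sigma> z - fls_const (epi (l + l') 1) * z) - w)" by (rule c)
    have "exp_poly_orbit \<Lambda> \<sigma> z1" "exp_poly_orbit \<Lambda> \<sigma> z2" "exp_poly_orbit \<Lambda> \<sigma> z3"
      using zs H unfolding Q_def by blast+
    then have w: "exp_poly_orbit \<Lambda> \<sigma> w"
      using zL unfolding w_def by (intro add scale L_mult const_L L_add)
    have wL: "w \<in> L" using zL unfolding w_def by (intro L_mult const_L L_add)
    have "exp_poly_orbit \<Lambda> \<sigma> (\<sigma> z - fls_const (epi (l + l') 1) * z)"
      using add[OF _ _ w *] zL wL by (simp add: L_mult L_diff const_L)
    moreover have "l + l' \<in> \<Lambda>" using \<Lambda> H(5,6) by (simp add: torsion_free_exponents_def)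
    ultimately show "exp_poly_orbit \<Lambda> \<sigma> z" by (intro exp_poly_orbit_triangular[OF \<Lambda> \<sigma> zL(1)])
  qed
  obtain x1 x2 k l \<nu> where x: "k \<in> \<Lambda>" "l \<in> \<Lambda>" "oscillator a x1" "oscillator a x2"
    "\<sigma> x1 = fls_const (epi k 1) * x1" "\<sigma> x2 = fls_const (epi l 1) * x2 + fls_const \<nu> * x1"
    and spanx: "\<And>v. oscillator a v \<Longrightarrow> \<exists>e f. v = fls_const e * x1 + fls_const f * x2"
    using tri(1) unfolding triangular_on_def by blast
  obtain y1 y2 k' l' \<nu>' where y: "k' \<in> \<Lambda>" "l' \<in> \<Lambda>" "oscillator b y1" "oscillator b y2"
    "\<sigma> y1 = fls_const (epi k' 1) * y1" "\<sigma> y2 = fls_const (epi l' 1) * y2 + fls_const \<nu>' * y1"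
    and spany: "\<And>v. oscillator b v \<Longrightarrow> \<exists>e f. v = fls_const e * y1 + fls_const f * y2"
    using tri(2) unfolding triangular_on_def by blast
  have multl: "Q (fls_const e * v) u" if "oscillator a v" "oscillator b u" "Q v u" for e v u
    using Ql[of v v u e 0] that by simp
  have multr: "Q u (fls_const e * v)" if "oscillator a u" "oscillator b v" "Q u v" for e v u
    using Qr[of u v v e 0] that by simp
  have Q11: "Q x1 y1"
    by (rule Qt[OF x(3) y(3) oscillator_0 oscillator_0 x(1) y(1)]) (simp_all add: x(5) y(5) Q0)
  have Q12: "Q x1 y2"
    by (rule Qt[OF x(3) y(4) oscillator_0 oscillator_scale[OF y(3)] x(1) y(2) _ y(6)])
      (simp_all add: x(5) Q0 multr[OF x(3) y(3) Q11])
  have Q21: "Q x2 y1"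
    by (rule Qt[OF x(4) y(3) oscillator_scale[OF x(3)] oscillator_0 x(2) y(1) x(6)])
      (simp_all add: y(5) Q0 multl[OF x(3) y(3) Q11])
  have Q22: "Q x2 y2"
    by (rule Qt[OF x(4) y(4) oscillator_scale[OF x(3)] oscillator_scale[OF y(3)] x(2) y(2) x(6) y(6)])
      (auto intro!: multl multr Q21 Q12 Q11 x y oscillator_scale)
  have Qall: "Q u v" if "oscillator a u" "oscillator b v" for u v
  proof -
    obtain e f where u: "u = fls_const e * x1 + fls_const f * x2" using spanx \<open>oscillator a u\<close> by blast
    obtain g h where v: "v = fls_const g * y1 + fls_const h * y2" using spany \<open>oscillator b v\<close> by blast
    have "Q x1 v" "Q x2 v" unfolding v by (intro Qr x y Q11 Q12 Q21 Q22)+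
    then show ?thesis unfolding u by (intro Ql x that(2))
  qed
  from v show ?thesis
  proof (rule B_cases)
    fix x y assume "(v, x, y) \<in> S"
    then show ?thesis
      by (intro oscillator_exp_poly_orbit[OF \<Lambda> \<sigma> tri(1) oscillator_in_L(1)]) (auto simp: S_iff)
  next
    fix x y assume "(x, v, y) \<in> S"
    then show ?thesis
      by (intro oscillator_exp_poly_orbit[OF \<Lambda> \<sigma> tri(2) oscillator_in_L(2)]) (auto simp: S_iff)
  next
    fix x y assume "(x, y, v) \<in> S"
    then show ?thesis using Qall[of x y] unfolding Q_def by (simp add: S_iff)
  qed
qed

lemma triangular_in_G0:
  assumes t0: "sin t0 \<noteq> 0" and \<Lambda>: "torsion_free_exponents \<Lambda>" and \<sigma>: "\<sigma> \<in> G"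
    and tri: "triangular_on \<Lambda> \<sigma> a" "triangular_on \<Lambda> \<sigma> b" "triangular_on \<Lambda> \<sigma> c"
  shows "\<sigma> \<in> G0"
proof -
  have "power_aut \<sigma> 1 \<in> G0"
    by (rule exp_poly_orbit_in_G0[OF \<Lambda> \<sigma> solution_orbits[OF t0 \<Lambda> \<sigma> tri]])
  moreover have "power_aut \<sigma> 1 = \<sigma>"
    using G_ext[OF \<sigma>] by (auto simp: power_aut_def fun_eq_iff extensional_def)
  ultimately show ?thesis by simp
qed

lemma triangular_identity:
  assumes "torsion_free_exponents \<Lambda>" "\<And>x. oscillator w x \<Longrightarrow> \<sigma> x = x"
  shows "triangular_on \<Lambda> \<sigma> w"
proof (rule triangular_onI[OF _ _ oscillator_cs oscillator_sn oscillator_span])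
  show "0 \<in> \<Lambda>" "0 \<in> \<Lambda>" using assms(1) by (simp_all add: torsion_free_exponents_def)
  show "\<sigma> (germ (cs w) t0) = fls_const (epi 0 1) * germ (cs w) t0"
    "\<sigma> (germ (sn w) t0) = fls_const (epi 0 1) * germ (sn w) t0 + fls_const 0 * germ (cs w) t0"
    using assms(2) oscillator_cs oscillator_sn by simp_all
qed

text \<open>
  Here \<open>\<sigma>\<close> is the shift by \<open>N\<close> periods.
\<close>
lemma triangular_shift:
  assumes \<Lambda>: "torsion_free_exponents \<Lambda>"
    and \<sigma>: "\<And>f. f \<in> oscillator_functions w \<Longrightarrow> \<sigma> (germ f t0) = germ (\<lambda>t. f (t + 2 * of_real pi * of_nat N)) t0"
    and l: "l \<in> \<Lambda>" "epi (of_nat N * w) 1 = epi l 1" and l': "l' \<in> \<Lambda>" "epi (of_nat N * (- w)) 1 = epi l' 1"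
  shows "triangular_on \<Lambda> \<sigma> w"
proof (cases "w = 0")
  case True
  define T where "T = 2 * complex_of_real pi * of_nat N"
  have 0: "0 \<in> \<Lambda>" using \<Lambda> by (simp add: torsion_free_exponents_def)
  have c1: "cs w = (\<lambda>_. 1)" by (simp add: True cs_def fun_eq_iff)
  have s1: "(\<lambda>t. sn w (t + T)) = (\<lambda>t. T * cs w t + 1 * sn w t)" by (simp add: True sn_def cs_def fun_eq_iff)
  have e1: "\<sigma> (germ (cs w) t0) = fls_const (epi 0 1) * germ (cs w) t0"
    unfolding \<sigma>[OF cs_oscillator_function] by (simp add: c1)
  have e2: "\<sigma> (germ (sn w) t0) = fls_const (epi 0 1) * germ (sn w) t0 + fls_const T * germ (cs w) t0"
    unfolding \<sigma>[OF sn_oscillator_function] T_def[symmetric] s1 germ_oscillator_function by simp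
  show ?thesis
    by (rule triangular_onI[OF 0 0 oscillator_cs oscillator_sn oscillator_span e1 e2])
next
  case False
  have ex_shift: "germ (\<lambda>t. ex u (t + 2 * of_real pi * of_nat N)) t0 = fls_const (epi (of_nat N * u) 1) * germ (ex u) t0" for u
  proof -
    have "(\<lambda>t. ex u (t + 2 * of_real pi * of_nat N)) = (\<lambda>t. epi (of_nat N * u) 1 * ex u t)"
      by (simp add: ex_def fun_eq_iff exp_add[symmetric] algebra_simps)
    then show ?thesis by (simp only: germ_scale[of _ UNIV] elementary_meromorphic UNIV_I)
  qed
  have e1: "\<sigma> (germ (ex w) t0) = fls_const (epi l 1) * germ (ex w) t0"
    unfolding \<sigma>[OF ex_oscillator_function(1)] ex_shift l(2) ..
  have e2: "\<sigma> (germ (ex (- w)) t0) = fls_const (epi l' 1) * germ (ex (- w)) t0 + fls_const 0 * germ (ex w) t0"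
    unfolding \<sigma>[OF ex_oscillator_function(2)] ex_shift l'(2) by simp
  show ?thesis
    by (rule triangular_onI[OF l(1) l'(1) oscillator_ex oscillator_span_ex[OF False] e1 e2])
qed

end

section \<open>Commuting monodromies force rational exponents\<close>

context ex2
begin

text \<open>
  Let \<open>\<tau>\<close> be the shift by \<open>N\<close> periods \<open>T = 2 \<pi> N\<close>, with \<open>N\<close> such that the eigenvalues of \<open>\<tau>\<close> generate a
  torsion-free group, and let \<open>\<mu>\<close> be the loop around a pole \<open>p\<close>. Both lie in the identity component. The two sides of the equation
  are, up to a common factor, the jumps \<open>\<mu> (\<tau> z) - \<tau> z\<close> and \<open>\<tau> (\<mu> z) - \<tau> z\<close>.
\<close>
lemma commuting_implies_functional_equation:
  assumes t0: "sin t0 \<noteq> 0" and \<theta>: "\<theta> \<noteq> 0" and ab: "ex2_virtually_abelian t0 a b c \<theta>"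
  shows "\<exists>N p. N > (0::nat) \<and> (\<forall>f\<in>oscillator_functions a. \<forall>g\<in>oscillator_functions b. \<forall>t.
    f (p + 2 * of_real pi * of_nat N) * g (p + 2 * of_real pi * of_nat N) * sn c (t - p)
      = f p * g p * sn c (t + 2 * of_real pi * of_nat N - p))"
proof -
  obtain \<mu> \<kappa> p where mono: "\<mu> \<in> G \<and> \<kappa> \<noteq> 0 \<and> (\<forall>w x. oscillator w x \<longrightarrow> x \<in> L \<longrightarrow> \<mu> x = x) \<and>
    (\<forall>f g z. f \<in> oscillator_functions a \<longrightarrow> g \<in> oscillator_functions b \<longrightarrow> (germ f t0, germ g t0, z) \<in> S \<longrightarrow>
       \<mu> z = z + fls_const (2 * \<theta> * \<kappa> * (f p * g p)) * germ (\<lambda>t. sn c (t - p)) t0)"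
    using monodromy_automorphism[OF t0] by (elim exE) (rule that)
  note \<mu> = mono[THEN conjunct1] mono[THEN conjunct2, THEN conjunct1]
    mono[THEN conjunct2, THEN conjunct2, THEN conjunct1, rule_format]
    mono[THEN conjunct2, THEN conjunct2, THEN conjunct2, rule_format]
  obtain \<sigma> where \<sigma>G: "\<sigma> \<in> G" and "\<forall>f. f holomorphic_on UNIV \<longrightarrow> germ f t0 \<in> L \<longrightarrow>
      \<sigma> (germ f t0) = germ (\<lambda>t. f (t + 2 * of_real pi)) t0"
    by (rule bexE[OF shift_automorphism[OF t0]])
  then have \<sigma>: "\<sigma> (germ f t0) = germ (\<lambda>t. f (t + 2 * of_real pi)) t0"
    if "f holomorphic_on UNIV" "germ f t0 \<in> L" for f using that by blast
  define A where "A = {a, -a, b, -b, c, -c}"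
  have fin: "finite A" by (simp add: A_def)
  obtain N \<Lambda> where N: "N > (0::nat)" and \<Lambda>: "torsion_free_exponents \<Lambda>"
    and ex: "\<And>w. w \<in> A \<Longrightarrow> \<exists>l\<in>\<Lambda>. epi (of_nat N * w) 1 = epi l 1"
    using torsion_free_exponents_exist[OF fin] by blast
  define T where "T = 2 * complex_of_real pi * of_nat N"
  define \<tau> where "\<tau> = power_aut \<sigma> N"
  have \<tau>G: "\<tau> \<in> G" unfolding \<tau>_def by (rule power_aut_in_G[OF \<sigma>G])
  have \<tau>: "\<tau> (germ f t0) = germ (\<lambda>t. f (t + T)) t0"
    if f: "f \<in> oscillator_functions w" and wL: "\<And>y. oscillator w y \<Longrightarrow> y \<in> L" for f w
  proof -
    have "(\<sigma> ^^ k) (germ f t0) = germ (\<lambda>t. f (t + 2 * of_real pi * of_nat k)) t0" for k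
    proof (induction k)
      case 0
      then show ?case by simp
    next
      case (Suc k)
      have fk: "(\<lambda>t. f (t + 2 * of_real pi * of_nat k)) \<in> oscillator_functions w"
        by (rule oscillator_function_translate[OF f])
      have "\<sigma> (germ (\<lambda>t. f (t + 2 * of_real pi * of_nat k)) t0) = germ (\<lambda>t. f ((t + 2 * of_real pi) + 2 * of_real pi * of_nat k)) t0"
        by (rule \<sigma>[OF oscillator_function_entire[OF fk] wL[OF oscillator_germ[OF fk]]])
      then show ?case using Suc by (simp add: algebra_simps)
    qed
    then show ?thesis using wL[OF oscillator_germ[OF f]] by (simp add: \<tau>_def power_aut_def T_def)
  qed
  have \<tau>G0: "\<tau> \<in> G0"
  proof (rule triangular_in_G0[OF t0 \<Lambda> \<tau>G])
    have "triangular_on \<Lambda> \<tau> w" if "w \<in> {a, b, c}" "\<And>y. oscillator w y \<Longrightarrow> y \<in> L" for w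
    proof -
      have "w \<in> A" "- w \<in> A" using that(1) by (auto simp: A_def)
      then obtain l l' where "l \<in> \<Lambda>" "epi (of_nat N * w) 1 = epi l 1" "l' \<in> \<Lambda>" "epi (of_nat N * (- w)) 1 = epi l' 1"
        using ex by meson
      moreover have "\<tau> (germ f t0) = germ (\<lambda>t. f (t + 2 * of_real pi * of_nat N)) t0"
        if "f \<in> oscillator_functions w" for f
        using \<tau>[OF that \<open>\<And>y. oscillator w y \<Longrightarrow> y \<in> L\<close>] unfolding T_def .
      ultimately show ?thesis by (intro triangular_shift[OF \<Lambda>])
    qed
    then show "triangular_on \<Lambda> \<tau> a" "triangular_on \<Lambda> \<tau> b" "triangular_on \<Lambda> \<tau> c"
      using oscillator_in_L by auto
  qed
  have \<mu>G0: "\<mu> \<in> G0"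
    by (rule triangular_in_G0[OF t0 \<Lambda> \<mu>(1)]; rule triangular_identity[OF \<Lambda>]; rule \<mu>(3))
      (auto intro: oscillator_in_L)
  have comm: "compose L \<mu> \<tau> = compose L \<tau> \<mu>"
    using ab \<tau>G0 \<mu>G0 unfolding ex2_virtually_abelian_iff by blast
  have "f (p + T) * g (p + T) * sn c (t - p) = f p * g p * sn c (t + T - p)"
    if f: "f \<in> oscillator_functions a" and g: "g \<in> oscillator_functions b" for f g t
  proof -
    define s where "s = (\<lambda>t. sn c (t - p))"
    have s_osc: "s \<in> oscillator_functions c"
      using oscillator_function_translate[OF sn_oscillator_function, of c "- p"] by (simp add: s_def)
    then have sT_osc: "(\<lambda>t. s (t + T)) \<in> oscillator_functions c" by (rule oscillator_function_translate)
    have sL: "germ s t0 \<in> L" by (rule oscillator_in_L(3)[OF oscillator_germ[OF s_osc]])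
    obtain z where z: "(germ f t0, germ g t0, z) \<in> S"
      using solution_exists[OF t0 oscillator_germ[OF f] oscillator_germ[OF g]] by blast
    then have zL: "z \<in> L" using B_I(3) B_in_L by blast
    define K where "K = 2 * \<theta> * \<kappa>"
    have "K \<noteq> 0" using \<theta> \<mu>(2) by (simp add: K_def)
    have fT: "(\<lambda>t. f (t + T)) \<in> oscillator_functions a" and gT: "(\<lambda>t. g (t + T)) \<in> oscillator_functions b"
      using f g oscillator_function_translate by blast+
    have \<tau>z: "(germ (\<lambda>t. f (t + T)) t0, germ (\<lambda>t. g (t + T)) t0, \<tau> z) \<in> S"
      using G_S[OF \<tau>G z] \<tau>[OF f oscillator_in_L(1)] \<tau>[OF g oscillator_in_L(2)] by simp
    have "\<mu> (\<tau> z) = \<tau> z + fls_const (K * (f (p + T) * g (p + T))) * germ s t0"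
      unfolding K_def s_def by (rule \<mu>(4)[OF fT gT \<tau>z])
    moreover have "\<tau> (\<mu> z) = \<tau> z + fls_const (K * (f p * g p)) * germ (\<lambda>t. s (t + T)) t0"
    proof -
      have "\<mu> z = z + fls_const (K * (f p * g p)) * germ s t0"
        unfolding K_def s_def by (rule \<mu>(4)[OF f g z])
      then show ?thesis
        using \<tau>[OF s_osc oscillator_in_L(3)]
        by (simp add: G_add[OF \<tau>G zL L_mult[OF const_L sL]] G_scale[OF \<tau>G sL])
    qed
    moreover have "\<mu> (\<tau> z) = \<tau> (\<mu> z)"
      using fun_cong[OF comm, of z] zL by (simp add: compose_def)
    ultimately have "fls_const (K * (f (p + T) * g (p + T))) * germ s t0
        = fls_const (K * (f p * g p)) * germ (\<lambda>t. s (t + T)) t0" by simp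
    then have "germ (\<lambda>t. K * (f (p + T) * g (p + T)) * s t) t0 = germ (\<lambda>t. K * (f p * g p) * s (t + T)) t0"
      using entire_meromorphic[OF oscillator_function_entire[OF s_osc]]
        entire_meromorphic[OF oscillator_function_entire[OF sT_osc]]
      by (simp add: germ_scale[of _ UNIV])
    then have "K * (f (p + T) * g (p + T)) * s t = K * (f p * g p) * s (t + T)"
      by (rule entire_germ_eq[rotated 2])
        (intro holomorphic_intros oscillator_function_entire[OF s_osc] oscillator_function_entire[OF sT_osc])+
    then show ?thesis using \<open>K \<noteq> 0\<close> by (simp add: s_def mult.assoc)
  qed
  then show ?thesis using N unfolding T_def by blast
qed

end

lemma rational_of_exp:
  assumes "exp (\<i> * w * (2 * of_real pi * of_nat N)) = 1" "N > 0"
  shows "w \<in> \<rat>"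
proof -
  have "epi (of_nat N * w) 1 = 1" using assms(1) by (simp add: mult_ac)
  then obtain n where "of_nat N * w = of_int n" using epi_eq_1_iff by (auto elim: Ints_cases)
  then have "w = of_int n / of_nat N" using assms(2) by (simp add: field_simps)
  then show ?thesis by simp
qed

text \<open>
  At \<open>t = p\<close> the equation gives \<open>sn c T = 0\<close>, hence \<open>c \<noteq> 0\<close> and \<open>c\<close> is rational. What remains is
  \<open>f (p + T) * g (p + T) = f p * g p * \<epsilon>\<close> with \<open>\<epsilon> = cs c T\<close> and \<open>\<epsilon>\<^sup>2 = 1\<close>. Exponentials for \<open>f\<close> and \<open>g\<close> give
  \<open>exp (\<i> (\<plusminus>a \<plusminus> b) T) = \<epsilon>\<close>, hence the rationality of \<open>a\<close> and \<open>b\<close>. If \<open>a = 0\<close>, the choices \<open>f = 1\<close>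
  and \<open>f = t\<close> contradict each other because \<open>T \<noteq> 0\<close>; likewise for \<open>b\<close>.
\<close>
lemma rational_of_functional_equation:
  assumes N: "N > (0::nat)" and T: "T = 2 * of_real pi * of_nat N"
    and eq: "\<And>f g t. f \<in> oscillator_functions a \<Longrightarrow> g \<in> oscillator_functions b \<Longrightarrow>
       f (p + T) * g (p + T) * sn c (t - p) = f p * g p * sn c (t + T - p)"
  shows "a \<in> \<rat> - {0}" "b \<in> \<rat> - {0}" "c \<in> \<rat> - {0}"
proof -
  have T0: "T \<noteq> 0" using N by (simp add: T)
  have ex0: "ex l t \<noteq> 0" for l t by (simp add: ex_def)
  have snT: "sn c T = 0"
  proof -
    have "sn c 0 = 0" by (simp add: sn_def)
    then show ?thesis using eq[of "ex a" "ex b" p] ex_oscillator_function(1) ex0 by simp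
  qed
  then have c0: "c \<noteq> 0" using T0 by (auto simp: sn_def)
  define \<epsilon> where "\<epsilon> = cs c T"
  have \<epsilon>2: "\<epsilon> * \<epsilon> = 1" using cs_sn_pythagoras[of c T] snT by (simp add: \<epsilon>_def)
  have "exp (\<i> * c * T) = \<epsilon>" using ex_cs_sn[of c T] snT by (simp add: \<epsilon>_def ex_def)
  then have "exp (\<i> * (2 * c) * T) = 1"
    using \<epsilon>2 exp_add[of "\<i> * c * T" "\<i> * c * T"] by (simp add: algebra_simps)
  then have "2 * c \<in> \<rat>" using rational_of_exp N unfolding T by blast
  then have "2 * c / 2 \<in> \<rat>" by (rule Rats_divide) simp
  then show "c \<in> \<rat> - {0}" using c0 by simp
  have fg: "f (p + T) * g (p + T) = f p * g p * \<epsilon>"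
    if "f \<in> oscillator_functions a" "g \<in> oscillator_functions b" for f g
  proof -
    define s where "s = of_real pi / (2 * c)"
    have "c * s = of_real (pi / 2)" using c0 by (simp add: s_def)
    then have "sin (c * s) = 1" by (simp only: sin_of_real sin_pi_half of_real_1)
    then have s: "sn c s \<noteq> 0" using c0 by (simp add: sn_def)
    have "sn c (s + T) = sn c s * \<epsilon> + cs c s * sn c T"
      using c0 by (simp add: sn_def cs_def \<epsilon>_def sin_add distrib_left add_divide_distrib)
    then have "f (p + T) * g (p + T) * sn c s = f p * g p * \<epsilon> * sn c s"
      using eq[OF that, of "p + s"] by (simp add: snT algebra_simps)
    then show ?thesis using s by simp
  qed
  have ex_shift: "ex l (p + T) = ex l p * exp (\<i> * l * T)" for l
    by (simp add: ex_def exp_add[symmetric] algebra_simps)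
  have e: "exp (\<i> * l * T) * exp (\<i> * l' * T) = \<epsilon>"
    if "l \<in> {a, - a}" "l' \<in> {b, - b}" for l l'
  proof -
    have "ex l (p + T) * ex l' (p + T) = ex l p * ex l' p * \<epsilon>"
      using that ex_oscillator_function by (intro fg) auto
    then show ?thesis using ex0[of l p] ex0[of l' p] by (simp add: ex_shift)
  qed
  have "exp (\<i> * (2 * a) * T) = (exp (\<i> * a * T) * exp (\<i> * b * T)) * (exp (\<i> * a * T) * exp (\<i> * (- b) * T))"
    by (simp add: exp_add[symmetric] algebra_simps)
  also have "\<dots> = 1" using e[of a b] e[of a "- b"] \<epsilon>2 by simp
  finally have "2 * a \<in> \<rat>" using rational_of_exp N unfolding T by blast
  then have "2 * a / 2 \<in> \<rat>" by (rule Rats_divide) simp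
  then have aQ: "a \<in> \<rat>" by simp
  have "exp (\<i> * (2 * b) * T) = (exp (\<i> * a * T) * exp (\<i> * b * T)) * (exp (\<i> * (- a) * T) * exp (\<i> * b * T))"
    by (simp add: exp_add[symmetric] algebra_simps)
  also have "\<dots> = 1" using e[of a b] e[of "- a" b] \<epsilon>2 by simp
  finally have "2 * b \<in> \<rat>" using rational_of_exp N unfolding T by blast
  then have "2 * b / 2 \<in> \<rat>" by (rule Rats_divide) simp
  then have bQ: "b \<in> \<rat>" by simp
  have "a \<noteq> 0"
  proof
    assume "a = 0"
    then have "ex b (p + T) = ex b p * \<epsilon>" "(p + T) * ex b (p + T) = p * ex b p * \<epsilon>"
      using fg[OF cs_oscillator_function ex_oscillator_function(1)]
        fg[OF sn_oscillator_function ex_oscillator_function(1)] by (simp_all add: cs_def sn_def)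
    then have "T * ex b (p + T) = 0" by (simp add: algebra_simps)
    then show False using T0 ex0 by simp
  qed
  then show "a \<in> \<rat> - {0}" using aQ by simp
  have "b \<noteq> 0"
  proof
    assume "b = 0"
    then have "ex a (p + T) = ex a p * \<epsilon>" "ex a (p + T) * (p + T) = ex a p * p * \<epsilon>"
      using fg[OF ex_oscillator_function(1) cs_oscillator_function]
        fg[OF ex_oscillator_function(1) sn_oscillator_function] by (simp_all add: cs_def sn_def)
    then have "T * ex a (p + T) = 0" by (simp add: algebra_simps)
    then show False using T0 ex0 by simp
  qed
  then show "b \<in> \<rat> - {0}" using bQ by simp
qed

theorem ex2_virtually_abelian_iff_rational:
  assumes "sin t0 \<noteq> 0"
  shows "ex2_virtually_abelian t0 a b c \<theta> \<longleftrightarrow>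
    \<theta> = 0 \<or> a \<in> \<rat> - {0} \<and> b \<in> \<rat> - {0} \<and> c \<in> \<rat> - {0}"
proof
  assume ab: "ex2_virtually_abelian t0 a b c \<theta>"
  show "\<theta> = 0 \<or> a \<in> \<rat> - {0} \<and> b \<in> \<rat> - {0} \<and> c \<in> \<rat> - {0}"
  proof (cases "\<theta> = 0")
    case False
    obtain N p where N: "N > (0::nat)" and eq: "\<And>f g t. f \<in> oscillator_functions a \<Longrightarrow> g \<in> oscillator_functions b \<Longrightarrow>
        f (p + 2 * of_real pi * of_nat N) * g (p + 2 * of_real pi * of_nat N) * sn c (t - p)
          = f p * g p * sn c (t + 2 * of_real pi * of_nat N - p)"
      using ex2.commuting_implies_functional_equation[OF assms False ab] by blast
    show ?thesis using rational_of_functional_equation[OF N refl eq] by blast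
  qed simp
next
  assume "\<theta> = 0 \<or> a \<in> \<rat> - {0} \<and> b \<in> \<rat> - {0} \<and> c \<in> \<rat> - {0}"
  then show "ex2_virtually_abelian t0 a b c \<theta>"
    using ex2.virtually_abelian_if_theta_zero ex2.virtually_abelian_if_rational by blast
qed

theorem lemma4p3:
  fixes V :: "complex ^ 'n \<Rightarrow> complex" and U :: "(complex ^ 'n) set" and d :: "complex ^ 'n"
    and \<omega> :: "'n \<Rightarrow> complex" and \<alpha> \<beta> \<gamma> :: 'n and t0 :: complex
  assumes "open U" and "d \<in> U" and "d \<noteq> 0"
    and "holomorphic_vec_on V U" and "homogeneous_on 2 V U"
    and "grad V d = d"
    and "hessian V d = (\<chi> i j. if i = j then (\<omega> i)\<^sup>2 else 0)"
    and "\<alpha> \<noteq> \<beta>"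
    and "sin t0 \<noteq> 0"
  shows "ex2_virtually_abelian t0 (\<omega> \<alpha>) (\<omega> \<beta>) (\<omega> \<gamma>) (theta V d \<gamma> \<alpha> \<beta>) \<longleftrightarrow>
     theta V d \<gamma> \<alpha> \<beta> = 0 \<or>
     theta V d \<gamma> \<alpha> \<beta> \<noteq> 0 \<and> \<omega> \<alpha> \<in> \<rat> - {0} \<and> \<omega> \<beta> \<in> \<rat> - {0} \<and> \<omega> \<gamma> \<in> \<rat> - {0}"
  using ex2_virtually_abelian_iff_rational[OF assms(9)] by blast

end
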